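(* Let $(W,S)$ be a Coxeter group with $S$ finite, and let $w\mapsto w^*$ be an involutive automorphism of $W$ (the identity is allowed) preserving $S$. Then, in $\mathbb{Z}[[u]]$, $$\mathcal{R}(u)=\mathbf{P}(u^2)/\mathbf{P}_*(u),$$ where $$\mathbf{P}(u)=\sum_{w\in W}u^{l(w)},\qquad \mathbf{P}_*(u)=\sum_{w\in W;\,w=w^*}u^{l(w)},\qquad \mathcal{R}(u)=\sum_{z\in\mathbf{I}_*}u^{l(z)}\left(\frac{u-1}{u+1}\right)^{\phi(z)}.$$
   Context: $l:W\to\mathbb{N}$ is the usual length function of $(W,S)$, $\le$ is the standard (Bruhat) partial order on $W$, and $u$ is an indeterminate. Put $\mathbf{I}_*=\{w\in W;\ w^*=w^{-1}\}$. The function $\phi:\mathbf{I}_*\to\mathbb{N}$ is the unique function such that $\phi(1)=0$ and such that for any $w\in\mathbf{I}_*$ and any $s\in S$ with $sw<w$ we have $\phi(w)=\phi(sw)+1$ if $sw=ws^*$, and $\phi(w)=\phi(sws^* )$ if $sw\ne ws^*$ (existence and uniqueness of $\phi$ are known). The rational function $\frac{u-1}{u+1}$ is regarded as an element of $\mathbb{Z}[[u]]$. *)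

theory Defs
  imports
    "HOL-Algebra.Generated_Groups"
    "HOL-Analysis.Infinite_Sum"
    "HOL-Computational_Algebra.Formal_Power_Series"
    "HOL-Library.Extended_Nat"
begin

section \<open>Group presentations and Coxeter systems\<close>

text \<open>The letter \<open>(x, True)\<close> stands for the generator \<open>x\<close>, the letter \<open>(x, False)\<close>
  for its formal inverse.\<close>

type_synonym 'a group_word = "('a \<times> bool) list"

definition letter_value :: "('a, 'b) monoid_scheme \<Rightarrow> 'a \<times> bool \<Rightarrow> 'a" where
  "letter_value G p = (if snd p then fst p else inv\<^bsub>G\<^esub> (fst p))"

definition word_value :: "('a, 'b) monoid_scheme \<Rightarrow> 'a group_word \<Rightarrow> 'a" where
  "word_value G u = foldr (\<lambda>p g. letter_value G p \<otimes>\<^bsub>G\<^esub> g) u \<one>\<^bsub>G\<^esub>"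

text \<open>Two words over \<open>X\<close> are congruent iff they represent the same element of the abstract
  group with generators \<open>X\<close> and relations \<open>r = 1\<close> for \<open>r \<in> R\<close>.\<close>

inductive presentation_cong :: "'a set \<Rightarrow> 'a group_word set \<Rightarrow> 'a group_word \<Rightarrow> 'a group_word \<Rightarrow> bool"
  for X R where
  refl: "u \<in> lists (X \<times> UNIV) \<Longrightarrow> presentation_cong X R u u"
| sym: "presentation_cong X R u v \<Longrightarrow> presentation_cong X R v u"
| trans: "presentation_cong X R u v \<Longrightarrow> presentation_cong X R v w \<Longrightarrow> presentation_cong X R u w"
| cancel: "u \<in> lists (X \<times> UNIV) \<Longrightarrow> v \<in> lists (X \<times> UNIV) \<Longrightarrow> x \<in> X \<Longrightarrow>
    presentation_cong X R (u @ [(x, b), (x, \<not> b)] @ v) (u @ v)"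
| relator: "u \<in> lists (X \<times> UNIV) \<Longrightarrow> v \<in> lists (X \<times> UNIV) \<Longrightarrow> r \<in> R \<Longrightarrow>
    presentation_cong X R (u @ r @ v) (u @ v)"

text \<open>The canonical map from the abstract group presented by generators \<open>X\<close> and relators \<open>R\<close>
  to \<open>G\<close> is well defined and bijective.\<close>

definition presented_by :: "('a, 'b) monoid_scheme \<Rightarrow> 'a set \<Rightarrow> 'a group_word set \<Rightarrow> bool" where
  "presented_by G X R \<longleftrightarrow> X \<subseteq> carrier G \<and> R \<subseteq> lists (X \<times> UNIV) \<and>
     generate G X = carrier G \<and>
     (\<forall>u \<in> lists (X \<times> UNIV). \<forall>v \<in> lists (X \<times> UNIV).
        word_value G u = word_value G v \<longleftrightarrow> presentation_cong X R u v)"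

definition coxeter_matrix :: "'a set \<Rightarrow> ('a \<Rightarrow> 'a \<Rightarrow> enat) \<Rightarrow> bool" where
  "coxeter_matrix S m \<longleftrightarrow> (\<forall>s \<in> S. m s s = 1) \<and>
     (\<forall>s \<in> S. \<forall>t \<in> S. s \<noteq> t \<longrightarrow> m s t = m t s \<and> 2 \<le> m s t)"

text \<open>The words \<open>(st)\<^sup>k\<close> with \<open>k = m s t\<close>; there is no relator when \<open>m s t = \<infinity>\<close>.\<close>

definition coxeter_relators :: "'a set \<Rightarrow> ('a \<Rightarrow> 'a \<Rightarrow> enat) \<Rightarrow> 'a group_word set" where
  "coxeter_relators S m =
     {concat (replicate k [(s, True), (t, True)]) | s t k. s \<in> S \<and> t \<in> S \<and> m s t = enat k}"

definition coxeter_system :: "('a, 'b) monoid_scheme \<Rightarrow> 'a set \<Rightarrow> bool" where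
  "coxeter_system G S \<longleftrightarrow> group G \<and>
     (\<exists>m. coxeter_matrix S m \<and> presented_by G S (coxeter_relators S m))"


section \<open>Length and Bruhat order\<close>

definition cox_length :: "('a, 'b) monoid_scheme \<Rightarrow> 'a set \<Rightarrow> 'a \<Rightarrow> nat" where
  "cox_length G S w = (LEAST n. \<exists>ss \<in> lists S. length ss = n \<and> foldr (\<otimes>\<^bsub>G\<^esub>) ss \<one>\<^bsub>G\<^esub> = w)"

definition reflections :: "('a, 'b) monoid_scheme \<Rightarrow> 'a set \<Rightarrow> 'a set" where
  "reflections G S = {g \<otimes>\<^bsub>G\<^esub> s \<otimes>\<^bsub>G\<^esub> inv\<^bsub>G\<^esub> g | g s. g \<in> carrier G \<and> s \<in> S}"

definition bruhat_step :: "('a, 'b) monoid_scheme \<Rightarrow> 'a set \<Rightarrow> 'a \<Rightarrow> 'a \<Rightarrow> bool" where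
  "bruhat_step G S x y \<longleftrightarrow> x \<in> carrier G \<and> cox_length G S x < cox_length G S y \<and>
     (\<exists>t \<in> reflections G S. y = t \<otimes>\<^bsub>G\<^esub> x)"

definition bruhat_le :: "('a, 'b) monoid_scheme \<Rightarrow> 'a set \<Rightarrow> 'a \<Rightarrow> 'a \<Rightarrow> bool" where
  "bruhat_le G S = (bruhat_step G S)\<^sup>*\<^sup>*"

definition bruhat_less :: "('a, 'b) monoid_scheme \<Rightarrow> 'a set \<Rightarrow> 'a \<Rightarrow> 'a \<Rightarrow> bool" where
  "bruhat_less G S x y \<longleftrightarrow> bruhat_le G S x y \<and> x \<noteq> y"


section \<open>Twisted involutions\<close>

definition coxeter_involution :: "('a, 'b) monoid_scheme \<Rightarrow> 'a set \<Rightarrow> ('a \<Rightarrow> 'a) \<Rightarrow> bool" where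
  "coxeter_involution G S star \<longleftrightarrow>
     star \<in> iso G G \<and> (\<forall>w \<in> carrier G. star (star w) = w) \<and> star ` S = S"

definition twisted_involutions :: "('a, 'b) monoid_scheme \<Rightarrow> ('a \<Rightarrow> 'a) \<Rightarrow> 'a set" where
  "twisted_involutions G star = {w \<in> carrier G. star w = inv\<^bsub>G\<^esub> w}"

text \<open>These conditions determine \<open>\<phi>\<close> on the twisted involutions; its values elsewhere are
  unconstrained and irrelevant.\<close>

definition is_phi ::
  "('a, 'b) monoid_scheme \<Rightarrow> 'a set \<Rightarrow> ('a \<Rightarrow> 'a) \<Rightarrow> ('a \<Rightarrow> nat) \<Rightarrow> bool" where
  "is_phi G S star \<phi> \<longleftrightarrow> \<phi> \<one>\<^bsub>G\<^esub> = 0 \<and>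
     (\<forall>w \<in> twisted_involutions G star. \<forall>s \<in> S. bruhat_less G S (s \<otimes>\<^bsub>G\<^esub> w) w \<longrightarrow>
        (if s \<otimes>\<^bsub>G\<^esub> w = w \<otimes>\<^bsub>G\<^esub> star s
         then \<phi> w = \<phi> (s \<otimes>\<^bsub>G\<^esub> w) + 1
         else \<phi> w = \<phi> (s \<otimes>\<^bsub>G\<^esub> w \<otimes>\<^bsub>G\<^esub> star s)))"


section \<open>The power series\<close>

text \<open>Division in \<open>\<int>[[u]]\<close> by a series \<open>g\<close> with constant term 1. (The generic division on
  \<open>fps\<close> is not available, since \<open>int\<close> has no \<open>inverse\<close> operation.) The second argument of
  \<open>fps_right_inverse\<close> is the inverse of the constant term of \<open>g\<close>.\<close>

definition fps_unit_div :: "int fps \<Rightarrow> int fps \<Rightarrow> int fps" where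
  "fps_unit_div f g = f * fps_right_inverse g 1"

text \<open>Infinite sums are taken in the \<open>u\<close>-adic topology, with \<open>fps_X\<close> as the indeterminate \<open>u\<close>.\<close>

definition P_series :: "('a, 'b) monoid_scheme \<Rightarrow> 'a set \<Rightarrow> int fps" where
  "P_series G S = (\<Sum>\<^sub>\<infinity>w \<in> carrier G. fps_X ^ cox_length G S w)"

definition P_star_series :: "('a, 'b) monoid_scheme \<Rightarrow> 'a set \<Rightarrow> ('a \<Rightarrow> 'a) \<Rightarrow> int fps" where
  "P_star_series G S star =
     (\<Sum>\<^sub>\<infinity>w \<in> {w \<in> carrier G. w = star w}. fps_X ^ cox_length G S w)"

definition R_series ::
  "('a, 'b) monoid_scheme \<Rightarrow> 'a set \<Rightarrow> ('a \<Rightarrow> 'a) \<Rightarrow> ('a \<Rightarrow> nat) \<Rightarrow> int fps" where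
  "R_series G S star \<phi> =
     (\<Sum>\<^sub>\<infinity>z \<in> twisted_involutions G star.
        fps_X ^ cox_length G S z * fps_unit_div (fps_X - 1) (fps_X + 1) ^ \<phi> z)"

end

theory Submission
  imports Defs
begin

text \<open>
The identity is a count of flags. Suppose that \<open>W\<close> is the Weyl group of a reductive group with a
Frobenius map \<open>F\<close> that acts on \<open>W\<close> by \<open>*\<close>, and put \<open>u = q\<close>. Then \<open>P(q\<^sup>2)\<close> is the number of flags
over the field with \<open>q\<^sup>2\<close> elements and \<open>P\<^sub>*(q)\<close> is the number of those that \<open>F\<close> fixes. The
relative position \<open>z\<close> of a flag \<open>B\<close> and \<open>F B\<close> is a twisted involution, because \<open>F\<^sup>2\<close> fixes \<open>B\<close>,
and exactly \<open>P\<^sub>*(q) \<zeta>(z)\<close> flags yield \<open>z\<close>, where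
\<open>\<zeta>(z) = u\<^bsup>l(z)\<^esup> ((u - 1) / (u + 1))\<^bsup>\<phi>(z)\<^esup>\<close>. Summing over \<open>z\<close> gives \<open>P(u\<^sup>2) = P\<^sub>* \<R>\<close>.

For a general Coxeter group there are no flags, but there is a refined count. Fix an \<open>F\<close>-stable
flag \<open>B\<^sub>0\<close> and let \<open>f x z\<close> be the number of flags \<open>B\<close> such that \<open>(B, B\<^sub>0)\<close> has position \<open>x\<close> and
\<open>(B, F B)\<close> has position \<open>z\<close>. Prolonging galleries by one step expresses \<open>f (s x)\<close>, for
\<open>s x > x\<close>, through \<open>f x\<close> by an explicit operator \<open>T s\<close> on functions of \<open>z\<close>, which is the transpose
of the action of a generator on the Lusztig-Vogan module of twisted involutions. So
\<open>f x = T s\<^sub>1 (\<dots> (T s\<^sub>k \<delta>))\<close> for a reduced word \<open>s\<^sub>1 \<dots> s\<^sub>k\<close> of \<open>x\<close>, and this formula makes sense in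
every Coxeter group as soon as the operators satisfy the braid relations (\<open>braid\<close>,
\<open>Tw_reduced_words\<close>); here \<open>f\<close> is called \<open>fam\<close>. Three facts about it imply the theorem.

\<^item> Row sums: \<open>T s\<close> multiplies the sum of the values by \<open>u\<^sup>2\<close>, so \<open>\<Sum>z. f x z = u\<^bsup>2 l(x)\<^esup>\<close>
  (\<open>fam_sum\<close>).

\<^item> Initial column: \<open>f x 1\<close> is \<open>u\<^bsup>l(x)\<^esup>\<close> if \<open>x = x\<^sup>*\<close> and \<open>0\<close> otherwise (\<open>fam_at_one\<close>), so
  \<open>\<Sum>x. f x 1 = P\<^sub>*\<close>.

\<^item> Column sums: summing \<open>T s (f x)\<close> over \<open>x\<close> shows that the column sums obey the recursion in
  \<open>z\<close> that defines \<open>\<zeta>\<close>, so \<open>\<Sum>x. f x z = P\<^sub>* \<zeta>(z)\<close> (\<open>column_eq\<close>).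

Summing \<open>f x z\<close> over all \<open>x\<close> and \<open>z\<close> in both orders gives the identity; the lemmas \<open>fam_dvd\<close> and
\<open>fam_dvd_left\<close> make each coefficient of the double sum finite.

The braid relations are the hardest step. For \<open>s\<close>, \<open>t\<close> with \<open>s t\<close> of order \<open>m\<close>, the difference
\<open>D\<^sub>k\<close> of the two alternating products of length \<open>k\<close> satisfies
\<open>D\<^sub>k\<^sub>+\<^sub>1 = D\<^sub>k X - u\<^sup>2 D\<^sub>k\<^sub>-\<^sub>1\<close> with an operator \<open>X\<close> independent of \<open>k\<close>, and \<open>D\<^sub>k\<close> commutes with \<open>T s\<close> and
\<open>T t\<close> up to sign, a shift by a scalar and exchange of \<open>s\<close> and \<open>t\<close>. Hence \<open>D\<^sub>m = 0\<close> only has to be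
tested at the twisted involutions that are minimal for \<open>s\<close> and \<open>t\<close>. There the climb to the maximal
element of the double coset yields a relation between \<open>D\<^sub>k\<close> for \<open>k\<close> near \<open>m\<close> or near \<open>m / 2\<close>, and the
recursion carries it to \<open>D\<^sub>m\<close>.
\<close>

section \<open>From a presentation to the exchange condition\<close>

locale involution_generated = group W for W :: "('a, 'b) monoid_scheme" (structure) +
  fixes S :: "'a set"
  assumes S_carrier: "S \<subseteq> carrier W"
    and S_sq: "s \<in> S \<Longrightarrow> s \<otimes> s = \<one>"
    and generate_S: "generate W S = carrier W"
begin

definition val :: "'a list \<Rightarrow> 'a" where "val ss = foldr (\<otimes>) ss \<one>"

lemma val_Nil [simp]: "val [] = \<one>"
  and val_Cons [simp]: "val (s # ss) = s \<otimes> val ss"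
  by (auto simp: val_def)

abbreviation len :: "'a \<Rightarrow> nat" where "len \<equiv> cox_length W S"

lemma S_closed [simp, intro]: "s \<in> S \<Longrightarrow> s \<in> carrier W"
  using S_carrier by auto

lemma S_inv [simp]: "s \<in> S \<Longrightarrow> inv s = s"
  using S_sq inv_equality by blast

lemma S_cancel_left [simp]: "s \<in> S \<Longrightarrow> x \<in> carrier W \<Longrightarrow> s \<otimes> (s \<otimes> x) = x"
  by (metis S_closed S_sq l_one m_assoc)

lemma S_cancel_right [simp]: "s \<in> S \<Longrightarrow> x \<in> carrier W \<Longrightarrow> x \<otimes> s \<otimes> s = x"
  by (simp add: m_assoc S_sq)

lemma val_closed [simp, intro]: "ss \<in> lists S \<Longrightarrow> val ss \<in> carrier W"
  by (induction ss) auto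

lemma val_append [simp]: "us \<in> lists S \<Longrightarrow> vs \<in> lists S \<Longrightarrow> val (us @ vs) = val us \<otimes> val vs"
  by (induction us) (auto simp: m_assoc)

lemma inv_val: "ss \<in> lists S \<Longrightarrow> inv (val ss) = val (rev ss)"
  by (induction ss) (simp_all add: inv_mult_group in_lists_conv_set)

lemma ex_word:
  assumes "x \<in> carrier W" shows "\<exists>ss \<in> lists S. val ss = x"
proof -
  have "x \<in> generate W S" using assms generate_S by simp
  then show ?thesis
  proof (induction rule: generate.induct)
    case one show ?case by (intro bexI[of _ "[]"]) auto
  next
    case (incl h) then show ?case by (intro bexI[of _ "[h]"]) auto
  next
    case (inv h) then show ?case by (intro bexI[of _ "[h]"]) auto
  next
    case (eng g h)
    then obtain us vs where "us \<in> lists S" "val us = g" "vs \<in> lists S" "val vs = h" by blast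
    then show ?case by (intro bexI[of _ "us @ vs"]) auto
  qed
qed

lemma len_le: "ss \<in> lists S \<Longrightarrow> len (val ss) \<le> length ss"
  unfolding cox_length_def val_def by (rule Least_le) auto

lemma ex_reduced_word:
  assumes "x \<in> carrier W" shows "\<exists>ss \<in> lists S. val ss = x \<and> length ss = len x"
proof -
  obtain ss where "ss \<in> lists S" "val ss = x" using ex_word[OF assms] by blast
  then have "\<exists>n. \<exists>ss \<in> lists S. length ss = n \<and> val ss = x" by blast
  from LeastI_ex[OF this] show ?thesis unfolding cox_length_def val_def by blast
qed

text \<open>The number of prefixes \<open>u s\<close> of the word whose reflection \<open>u s u\<^sup>-\<^sup>1\<close> equals \<open>t\<close>. Its parity
  turns out to depend on the value of the word only, which is what forces the exchange
  condition.\<close>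

fun refl_count :: "'a list \<Rightarrow> 'a \<Rightarrow> nat" where
  "refl_count [] t = 0"
| "refl_count (s # ss) t = (if s = t then 1 else 0) + refl_count ss (s \<otimes> t \<otimes> s)"

lemma refl_count_append:
  assumes "us \<in> lists S" "t \<in> carrier W"
  shows "refl_count (us @ vs) t = refl_count us t + refl_count vs (inv (val us) \<otimes> t \<otimes> val us)"
  using assms
proof (induction us arbitrary: t)
  case Nil then show ?case by simp
next
  case (Cons s us)
  then show ?case by (simp add: inv_mult_group m_assoc)
qed

text \<open>A letter whose prefix has the reflection \<open>t\<close> is cancelled when the word is multiplied by \<open>t\<close>.\<close>

lemma refl_count_pos:
  assumes "ss \<in> lists S" "t \<in> carrier W" "refl_count ss t > 0"
  shows "\<exists>us s vs. ss = us @ s # vs \<and> t \<otimes> val ss = val (us @ vs)"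
  using assms
proof (induction ss arbitrary: t)
  case Nil then show ?case by simp
next
  case (Cons s ss)
  show ?case
  proof (cases "s = t")
    case True
    have "t \<in> S" "val ss \<in> carrier W" using Cons.prems Cons.hyps True by auto
    then have "s # ss = [] @ s # ss \<and> t \<otimes> val (s # ss) = val ([] @ ss)"
      using True by simp
    then show ?thesis by blast
  next
    case False
    then obtain us r vs where *: "ss = us @ r # vs" "s \<otimes> t \<otimes> s \<otimes> val ss = val (us @ vs)"
      using Cons.IH[of "s \<otimes> t \<otimes> s"] Cons.prems Cons.hyps by auto
    have "t \<otimes> val (s # ss) = s \<otimes> (s \<otimes> t \<otimes> s \<otimes> val ss)"
      using Cons.prems Cons.hyps by (simp add: m_assoc)
    then have "s # ss = (s # us) @ r # vs \<and> t \<otimes> val (s # ss) = val ((s # us) @ vs)"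
      using * by simp
    then show ?thesis by blast
  qed
qed

lemma len_Cons_le:
  assumes "s \<in> S" "x \<in> carrier W" shows "len (s \<otimes> x) \<le> len x + 1"
proof -
  obtain ss where "ss \<in> lists S" "val ss = x" "length ss = len x" using ex_reduced_word assms by blast
  then show ?thesis using len_le[of "s # ss"] assms by auto
qed

text \<open>A reduced word of the same element that starts with \<open>s\<close> counts the reflection \<open>s\<close> once, hence
  every word counts it an odd number of times and has a letter to delete.\<close>

lemma exchange_if_refl_parity:
  assumes parity: "\<And>us vs t. us \<in> lists S \<Longrightarrow> vs \<in> lists S \<Longrightarrow> val us = val vs \<Longrightarrow>
      t \<in> carrier W \<Longrightarrow> even (refl_count us t) = even (refl_count vs t)"
    and ss: "ss \<in> lists S" and s: "s \<in> S" and less: "len (s \<otimes> val ss) < len (val ss)"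
  shows "\<exists>us t vs. ss = us @ t # vs \<and> s \<otimes> val ss = val (us @ vs)"
proof -
  obtain rs where rs: "rs \<in> lists S" "val rs = s \<otimes> val ss" "length rs = len (s \<otimes> val ss)"
    using ex_reduced_word[of "s \<otimes> val ss"] ss s by auto
  have val: "val (s # rs) = val ss" using rs ss s by simp
  have "refl_count rs s = 0"
  proof (rule ccontr)
    assume "refl_count rs s \<noteq> 0"
    then obtain us r vs where *: "rs = us @ r # vs" "s \<otimes> val rs = val (us @ vs)"
      using refl_count_pos[of rs s] rs s by auto
    then have "len (val ss) \<le> length (us @ vs)"
      using len_le[of "us @ vs"] rs(1) val by simp
    then show False using * rs less by simp
  qed
  then have "odd (refl_count (s # rs) s)" using s S_sq by simp
  then have "odd (refl_count ss s)" using parity[of "s # rs" ss s] val rs ss s by auto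
  then show ?thesis using refl_count_pos[of ss s] ss s by fastforce
qed

end

text \<open>The two properties through which a Coxeter system enters the proof.\<close>

locale coxeter_group = involution_generated W S for W :: "('a, 'b) monoid_scheme" (structure) and S +
  assumes len_mult_ne: "s \<in> S \<Longrightarrow> x \<in> carrier W \<Longrightarrow> len (s \<otimes> x) \<noteq> len x"
    and exchange: "ss \<in> lists S \<Longrightarrow> s \<in> S \<Longrightarrow> len (s \<otimes> val ss) < len (val ss) \<Longrightarrow>
      \<exists>us t vs. ss = us @ t # vs \<and> s \<otimes> val ss = val (us @ vs)"

primrec alt :: "'a \<Rightarrow> 'a \<Rightarrow> nat \<Rightarrow> 'a list" where
  "alt s t 0 = []"
| "alt s t (Suc n) = s # alt t s n"

lemma length_alt [simp]: "length (alt s t n) = n"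
  by (induction n arbitrary: s t) auto

lemma alt_in_lists: "s \<in> J \<Longrightarrow> t \<in> J \<Longrightarrow> alt s t n \<in> lists J"
  by (induction n arbitrary: s t) auto

lemma alt_double: "alt s t (2 * k) = concat (replicate k [s, t])"
  by (induction k) auto

context involution_generated
begin

lemma pow_mult_shift:
  assumes "x \<in> carrier W" "y \<in> carrier W"
  shows "x \<otimes> (y \<otimes> x) [^] (i::nat) \<otimes> y = (x \<otimes> y) [^] Suc i"
proof (induction i)
  case 0 then show ?case using assms by simp
next
  case (Suc i)
  have "x \<otimes> (y \<otimes> x) [^] Suc i \<otimes> y = x \<otimes> (y \<otimes> x) [^] i \<otimes> y \<otimes> (x \<otimes> y)"
    using assms by (simp add: m_assoc)
  then show ?case using Suc assms by simp
qed

text \<open>The reflections of the prefixes of \<open>s t s t \<dots>\<close> are the elements \<open>(s t)\<^sup>i s\<close>.\<close>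

lemma refl_count_alt:
  assumes "s \<in> S" "t \<in> S" "r \<in> carrier W"
  shows "refl_count (alt s t n) r = (\<Sum>i<n. if (s \<otimes> t) [^] i \<otimes> s = r then 1 else 0)"
  using assms
proof (induction n arbitrary: s t r)
  case 0 then show ?case by simp
next
  case (Suc n)
  have eq: "(t \<otimes> s) [^] i \<otimes> t = s \<otimes> r \<otimes> s \<longleftrightarrow> (s \<otimes> t) [^] Suc i \<otimes> s = r" for i
  proof -
    have "(s \<otimes> t) [^] Suc i \<otimes> s = s \<otimes> ((t \<otimes> s) [^] i \<otimes> t) \<otimes> s"
      using pow_mult_shift[of s t i] Suc.prems by (simp add: m_assoc)
    moreover have "s \<otimes> (s \<otimes> x \<otimes> s) \<otimes> s = x" if "x \<in> carrier W" for x
      using that Suc.prems by (simp add: m_assoc S_sq)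
    moreover have "(t \<otimes> s) [^] i \<otimes> t \<in> carrier W" using Suc.prems by simp
    ultimately show ?thesis using Suc.prems by (metis (no_types))
  qed
  show ?case
    using Suc.IH[of t s "s \<otimes> r \<otimes> s"] Suc.prems
    by (simp add: sum.lessThan_Suc_shift eq del: sum.lessThan_Suc nat_pow_Suc)
qed

text \<open>The reflections of the prefixes of \<open>(s t)\<^sup>k\<close> run twice through the same list.\<close>

lemma even_refl_count_relator:
  assumes "s \<in> S" "t \<in> S" "r \<in> carrier W" "(s \<otimes> t) [^] k = \<one>"
  shows "even (refl_count (alt s t (2 * k)) r)"
proof -
  let ?f = "\<lambda>i. if (s \<otimes> t) [^] i \<otimes> s = r then 1 else (0::nat)"
  have "?f (i + k) = ?f i" for i
    using assms by (simp flip: nat_pow_mult)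
  then have "sum ?f {k..<2 * k} = sum ?f {0..<k}"
    using sum.shift_bounds_nat_ivl[of ?f 0 k k] by (simp add: mult_2)
  moreover have "refl_count (alt s t (2 * k)) r = sum ?f {0..<k} + sum ?f {k..<2 * k}"
    using refl_count_alt[OF assms(1,2,3)] sum.atLeastLessThan_concat[of 0 k "2 * k" ?f]
    by (simp add: lessThan_atLeast0)
  ultimately show ?thesis by (simp only: even_add)
qed

lemma val_alt_double:
  assumes "s \<in> S" "t \<in> S"
  shows "val (alt s t (2 * k)) = (s \<otimes> t) [^] k"
proof (induction k)
  case 0 then show ?case by simp
next
  case (Suc k)
  have "(s \<otimes> t) [^] Suc k = (s \<otimes> t) \<otimes> (s \<otimes> t) [^] k"
    using assms by (intro nat_pow_Suc2) auto
  then show ?case using Suc assms by (simp add: m_assoc del: nat_pow_Suc)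
qed

end

text \<open>The parity of the length of a word and the parities of its reflection counts do not change under
  the defining relations, so they are functions of the group element.\<close>

lemma coxeter_system_imp_coxeter_group:
  fixes W (structure)
  assumes "coxeter_system W S"
  shows "coxeter_group W S"
proof -
  interpret group W using assms unfolding coxeter_system_def by blast
  obtain m where m: "coxeter_matrix S m" and P: "presented_by W S (coxeter_relators S m)"
    using assms unfolding coxeter_system_def by blast
  define R where "R = coxeter_relators S m"
  have SC: "S \<subseteq> carrier W" and RL: "R \<subseteq> lists (S \<times> UNIV)" and gen: "generate W S = carrier W"
    and pres: "\<And>u v. u \<in> lists (S \<times> UNIV) \<Longrightarrow> v \<in> lists (S \<times> UNIV) \<Longrightarrow>
        word_value W u = word_value W v \<longleftrightarrow> presentation_cong S R u v"
    using P unfolding presented_by_def R_def by blast+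
  have nil: "word_value W [] = \<one>" by (simp add: word_value_def)
  have relator_one: "word_value W r = \<one>" if "r \<in> R" for r
    using pres[of r "[]"] presentation_cong.relator[of "[]" S "[]" r R] that RL nil by auto
  have sq: "s \<otimes> s = \<one>" if "s \<in> S" for s
  proof -
    have "m s s = enat 1" using m that unfolding coxeter_matrix_def by (simp add: one_enat_def)
    then have "[(s, True), (s, True)] \<in> R"
      unfolding R_def coxeter_relators_def using that
      by (auto intro!: exI[of _ s] exI[of _ 1])
    from relator_one[OF this] show ?thesis
      using that SC by (auto simp: word_value_def letter_value_def)
  qed
  interpret involution_generated W S
    by unfold_locales (use SC sq gen in auto)
  have word_value_val: "word_value W u = val (map fst u)" if "u \<in> lists (S \<times> UNIV)" for u
    using that by (induction u) (auto simp: word_value_def letter_value_def)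
  have map_fst: "map fst u \<in> lists S" if "u \<in> lists (S \<times> UNIV)" for u :: "'a group_word"
    using that by (induction u) auto
  have relator_alt: "\<exists>s\<in>S. \<exists>t\<in>S. \<exists>k. map fst r = alt s t (2 * k) \<and> (s \<otimes> t) [^] k = \<one>"
    if rR: "r \<in> R" for r
  proof -
    obtain s t k where r: "r = concat (replicate k [(s, True), (t, True)])" and st: "s \<in> S" "t \<in> S"
      using rR unfolding R_def coxeter_relators_def by blast
    have "map fst r = alt s t (2 * k)"
      unfolding r alt_double by (simp add: map_concat)
    moreover have "val (map fst r) = \<one>"
      using relator_one[OF rR] word_value_val[of r] subsetD[OF RL rR] by simp
    ultimately show ?thesis using val_alt_double[of s t k] st by metis
  qed
  have invariant: "u \<in> lists (S \<times> UNIV) \<and> v \<in> lists (S \<times> UNIV) \<and>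
      even (length u) = even (length v) \<and>
      (\<forall>t\<in>carrier W. even (refl_count (map fst u) t) = even (refl_count (map fst v) t))"
    if "presentation_cong S R u v" for u v
    using that
  proof (induction rule: presentation_cong.induct)
    case (cancel u v x b)
    have fu: "map fst u \<in> lists S" using cancel map_fst by simp
    have "refl_count (map fst (u @ [(x, b), (x, \<not> b)] @ v)) t =
       refl_count (map fst u) t + refl_count [x, x] (inv (val (map fst u)) \<otimes> t \<otimes> val (map fst u))
        + refl_count (map fst v) (inv (val (map fst u)) \<otimes> t \<otimes> val (map fst u))"
      if "t \<in> carrier W" for t
      using cancel fu that
      by (simp add: refl_count_append m_assoc S_sq)
    moreover have "even (refl_count [x, x] t)" if "t \<in> carrier W" for t
    proof -
      have "x = x \<otimes> t \<otimes> x \<longleftrightarrow> x = t"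
        using cancel(3) that S_sq by (metis S_cancel_left S_cancel_right S_closed l_one m_closed)
      then show ?thesis by simp
    qed
    ultimately show ?case using cancel fu by (auto simp: refl_count_append)
  next
    case (relator u v r)
    then obtain s t k where r: "s \<in> S" "t \<in> S" "map fst r = alt s t (2 * k)" "(s \<otimes> t) [^] k = \<one>"
      using relator_alt by blast
    have fu: "map fst u \<in> lists S" using relator map_fst by simp
    have fr: "map fst r \<in> lists S" using r by (simp add: alt_in_lists)
    have "val (map fst r) = \<one>" using val_alt_double[of s t k] r by simp
    then have "refl_count (map fst (u @ r @ v)) t' =
       refl_count (map fst u) t' + refl_count (map fst r) (inv (val (map fst u)) \<otimes> t' \<otimes> val (map fst u))
        + refl_count (map fst v) (inv (val (map fst u)) \<otimes> t' \<otimes> val (map fst u))"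
      if "t' \<in> carrier W" for t'
      using relator fu fr that by (simp add: refl_count_append)
    moreover have "even (refl_count (map fst r) t')" if "t' \<in> carrier W" for t'
      using even_refl_count_relator[of s t t' k] r that by simp
    moreover have "even (length r)" using arg_cong[OF r(3), of length] by simp
    ultimately show ?case using relator fu RL by (auto simp: refl_count_append)
  qed auto
  define lift where "lift = map (\<lambda>s::'a. (s, True))"
  have lift: "lift ss \<in> lists (S \<times> UNIV)" "map fst (lift ss) = ss" "length (lift ss) = length ss"
    if "ss \<in> lists S" for ss
    using that unfolding lift_def by (auto simp: o_def)
  have cong: "presentation_cong S R (lift us) (lift vs)"
    if "us \<in> lists S" "vs \<in> lists S" "val us = val vs" for us vs
    using pres[of "lift us" "lift vs"] that by (simp add: lift word_value_val)
  have length_parity: "even (length us) = even (length vs)"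
    if "us \<in> lists S" "vs \<in> lists S" "val us = val vs" for us vs
    using invariant[OF cong[OF that]] that by (simp add: lift)
  have refl_parity: "even (refl_count us t) = even (refl_count vs t)"
    if "us \<in> lists S" "vs \<in> lists S" "val us = val vs" "t \<in> carrier W" for us vs t
    using invariant[OF cong[OF that(1-3)]] that by (simp add: lift)
  show ?thesis
  proof
    fix s x assume *: "s \<in> S" "x \<in> carrier W"
    obtain us where us: "us \<in> lists S" "val us = x" "length us = len x"
      using ex_reduced_word[OF *(2)] by blast
    obtain vs where vs: "vs \<in> lists S" "val vs = s \<otimes> x" "length vs = len (s \<otimes> x)"
      using ex_reduced_word[of "s \<otimes> x"] * by auto
    show "len (s \<otimes> x) \<noteq> len x"
      using length_parity[of "s # us" vs] us vs * by auto
  next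
    fix ss s assume "ss \<in> lists S" "s \<in> S" "len (s \<otimes> val ss) < len (val ss)"
    then show "\<exists>us t vs. ss = us @ t # vs \<and> s \<otimes> val ss = val (us @ vs)"
      using exchange_if_refl_parity refl_parity by blast
  qed
qed

section \<open>Lengths, parabolic subgroups and dihedral subgroups\<close>

text \<open>Membership in \<open>lists S\<close> stays folded in automatic proofs, so that rules such as \<open>val_closed\<close>
  apply.\<close>

declare in_listsD [rule del] in_listsI [rule del]

lemma rev_in_lists_iff [simp]: "rev ss \<in> lists A \<longleftrightarrow> ss \<in> lists A"
  by (simp add: in_lists_conv_set)

lemma alt_add: "alt s t (j + k) = alt s t j @ (if even j then alt s t k else alt t s k)"
  by (induction j arbitrary: s t) auto

lemma rev_alt:
  fixes s t :: "'a"
  shows "rev (alt s t k) = (if even k then alt t s k else alt s t k)"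
proof (induction k arbitrary: s t)
  case (Suc k)
  have snoc: "alt s t (Suc k) = alt s t k @ [if even k then s else t]" for s t :: "'a"
    using alt_add[of s t k 1] by auto
  show ?case by (subst snoc) (auto simp: Suc)
qed simp

context coxeter_group
begin

lemma inv_cancel [simp]:
  "x \<in> carrier W \<Longrightarrow> y \<in> carrier W \<Longrightarrow> inv x \<otimes> (x \<otimes> y) = y"
  "x \<in> carrier W \<Longrightarrow> y \<in> carrier W \<Longrightarrow> x \<otimes> (inv x \<otimes> y) = y"
  by (simp_all flip: m_assoc)

lemma left_cancel_W:
  "x \<in> carrier W \<Longrightarrow> y \<in> carrier W \<Longrightarrow> z \<in> carrier W \<Longrightarrow> x \<otimes> y = x \<otimes> z \<Longrightarrow> y = z"
  by (metis inv_cancel(1))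

lemma len_one [simp]: "len \<one> = 0"
  using len_le[of "[]"] by simp

lemma len_eq_0_iff: "x \<in> carrier W \<Longrightarrow> len x = 0 \<longleftrightarrow> x = \<one>"
  using ex_reduced_word[of x] by fastforce

lemma len_S [simp]: "s \<in> S \<Longrightarrow> len s = 1"
  using len_mult_ne[of s "\<one>"] len_Cons_le[of s "\<one>"] by simp

lemma len_cases:
  assumes "s \<in> S" "x \<in> carrier W"
  shows "len (s \<otimes> x) = len x + 1 \<or> len x = len (s \<otimes> x) + 1"
  using len_Cons_le[of s x] len_Cons_le[of s "s \<otimes> x"] len_mult_ne[of s x] assms by auto

lemma len_mult_le: "x \<in> carrier W \<Longrightarrow> y \<in> carrier W \<Longrightarrow> len (x \<otimes> y) \<le> len x + len y"
proof -
  assume *: "x \<in> carrier W" "y \<in> carrier W"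
  obtain us where us: "us \<in> lists S" "val us = x" "length us = len x" using ex_reduced_word * by blast
  obtain vs where vs: "vs \<in> lists S" "val vs = y" "length vs = len y" using ex_reduced_word * by blast
  show ?thesis using len_le[of "us @ vs"] us vs by simp
qed

lemma len_inv_le: assumes "x \<in> carrier W" shows "len (inv x) \<le> len x"
proof -
  obtain us where us: "us \<in> lists S" "val us = x" "length us = len x" using ex_reduced_word assms by blast
  have "rev us \<in> lists S" using us(1) by (simp add: in_lists_conv_set)
  then show ?thesis using len_le[of "rev us"] us inv_val[of us] by simp
qed

lemma len_inv [simp]: "x \<in> carrier W \<Longrightarrow> len (inv x) = len x"
  using len_inv_le[of x] len_inv_le[of "inv x"] by simp

lemma len_right_inv:
  assumes "s \<in> S" "x \<in> carrier W" shows "len (x \<otimes> s) = len (s \<otimes> inv x)"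
  using len_inv[of "x \<otimes> s"] assms by (simp add: inv_mult_group)

lemma len_cases_right:
  assumes "s \<in> S" "x \<in> carrier W"
  shows "len (x \<otimes> s) = len x + 1 \<or> len x = len (x \<otimes> s) + 1"
  using len_cases[of s "inv x"] len_right_inv[of s x] assms by simp

lemma exchange_right:
  assumes "ss \<in> lists S" "s \<in> S" "len (val ss \<otimes> s) < len (val ss)"
  shows "\<exists>us t vs. ss = us @ t # vs \<and> val ss \<otimes> s = val (us @ vs)"
proof -
  have rev: "rev ss \<in> lists S" using assms(1) by (simp add: in_lists_conv_set)
  have "len (s \<otimes> val (rev ss)) < len (val (rev ss))"
    using assms len_right_inv[of s "val ss"] inv_val[of ss] len_inv[of "val ss"] by simp
  then obtain us t vs where *: "rev ss = us @ t # vs" "s \<otimes> val (rev ss) = val (us @ vs)"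
    using exchange[OF rev assms(2)] by blast
  have "ss = rev vs @ t # rev us" using arg_cong[OF *(1), of rev] by simp
  moreover have "val ss \<otimes> s = inv (s \<otimes> val (rev ss))"
    using assms inv_val[of ss] by (simp add: inv_mult_group flip: inv_val)
  moreover have "us @ vs \<in> lists S" using rev *(1) by simp
  ultimately have "val ss \<otimes> s = val (rev vs @ rev us)"
    using inv_val[of "us @ vs"] *(2) by simp
  then show ?thesis using \<open>ss = _\<close> by blast
qed

text \<open>When \<open>s x\<close> and \<open>x t\<close> both go up but \<open>s x t\<close> does not go up further, the exchange condition for
  \<open>x t\<close> can only delete the last letter.\<close>

lemma lifting:
  assumes "s \<in> S" "t \<in> S" "x \<in> carrier W"
    and "len (s \<otimes> x) = len x + 1" "len (x \<otimes> t) = len x + 1" "len (s \<otimes> x \<otimes> t) \<le> len x + 1"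
  shows "s \<otimes> x = x \<otimes> t"
proof -
  obtain ss where ss: "ss \<in> lists S" "val ss = x" "length ss = len x"
    using ex_reduced_word assms by blast
  have *: "ss @ [t] \<in> lists S" "val (ss @ [t]) = x \<otimes> t" using ss assms by auto
  have "len (s \<otimes> (x \<otimes> t)) < len (x \<otimes> t)"
    using len_cases[of s "x \<otimes> t"] assms by (simp add: m_assoc)
  then obtain us r vs where e: "ss @ [t] = us @ r # vs" "s \<otimes> (x \<otimes> t) = val (us @ vs)"
    using exchange[OF *(1) assms(1)] *(2) by metis
  show ?thesis
  proof (cases vs rule: rev_cases)
    case Nil
    then have "s \<otimes> (x \<otimes> t) = x" using e ss by simp
    then show ?thesis using assms by (metis S_cancel_left S_closed m_closed)
  next
    case (snoc vs' r')
    then have ss': "ss = us @ r # vs'" "r' = t" using e by auto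
    then have L: "us \<in> lists S" "vs' \<in> lists S" using ss by auto
    have "s \<otimes> x \<otimes> t = val (us @ vs') \<otimes> t"
      using e(2) snoc ss' L assms by (simp add: m_assoc)
    then have "s \<otimes> x = val (us @ vs')" using assms L by (metis S_closed append_in_lists_conv m_closed right_cancel val_closed)
    then have "len (s \<otimes> x) \<le> length (us @ vs')" using len_le[of "us @ vs'"] L by simp
    then show ?thesis using ss ss' assms by simp
  qed
qed

lemma reduced_append:
  assumes "us \<in> lists S" "vs \<in> lists S" "len (val (us @ vs)) = length (us @ vs)"
  shows "len (val us) = length us" "len (val vs) = length vs"
  using assms len_le[of us] len_le[of vs] len_mult_le[of "val us" "val vs"] by auto


subsection \<open>Parabolic subgroups\<close>

definition par :: "'a set \<Rightarrow> 'a set" where "par J = val ` lists J"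

definition lmin :: "'a set \<Rightarrow> 'a \<Rightarrow> bool" where
  "lmin J d \<longleftrightarrow> d \<in> carrier W \<and> (\<forall>s\<in>J. len (s \<otimes> d) = len d + 1)"

definition rmin :: "'a set \<Rightarrow> 'a \<Rightarrow> bool" where
  "rmin J d \<longleftrightarrow> d \<in> carrier W \<and> (\<forall>s\<in>J. len (d \<otimes> s) = len d + 1)"

lemma lists_mono_S: "J \<subseteq> S \<Longrightarrow> ss \<in> lists J \<Longrightarrow> ss \<in> lists S"
  using lists_mono by blast

lemma par_closed: "J \<subseteq> S \<Longrightarrow> x \<in> par J \<Longrightarrow> x \<in> carrier W"
  unfolding par_def using lists_mono_S by auto

lemma one_par: "\<one> \<in> par J"
  unfolding par_def by (intro image_eqI[of _ _ "[]"]) auto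

lemma gen_par: "J \<subseteq> S \<Longrightarrow> r \<in> J \<Longrightarrow> r \<in> par J"
  unfolding par_def by (intro image_eqI[of _ _ "[r]"]) auto

lemma par_mult: "J \<subseteq> S \<Longrightarrow> x \<in> par J \<Longrightarrow> y \<in> par J \<Longrightarrow> x \<otimes> y \<in> par J"
  unfolding par_def
proof (elim imageE)
  fix us vs assume "J \<subseteq> S" "x = val us" "us \<in> lists J" "y = val vs" "vs \<in> lists J"
  then show "x \<otimes> y \<in> val ` lists J"
    by (intro image_eqI[of _ _ "us @ vs"]) (auto simp: lists_mono_S)
qed

lemma par_inv: "J \<subseteq> S \<Longrightarrow> x \<in> par J \<Longrightarrow> inv x \<in> par J"
  unfolding par_def
proof (elim imageE)
  fix us assume "J \<subseteq> S" "x = val us" "us \<in> lists J"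
  then show "inv x \<in> val ` lists J"
    by (intro image_eqI[of _ _ "rev us"]) (auto simp: lists_mono_S inv_val)
qed

lemma par_reduced_word:
  assumes J: "J \<subseteq> S" and x: "x \<in> par J"
  shows "\<exists>ss \<in> lists J. val ss = x \<and> length ss = len x"
proof -
  have "\<exists>rs \<in> lists J. val rs = val ss \<and> length rs = len (val ss)" if "ss \<in> lists J" for ss
    using that
  proof (induction ss)
    case Nil then show ?case by (intro bexI[of _ "[]"]) auto
  next
    case (Cons s ss)
    then obtain rs where rs: "rs \<in> lists J" "val rs = val ss" "length rs = len (val ss)" by blast
    have c: "s \<in> S" "val ss \<in> carrier W" "rs \<in> lists S"
      using Cons.hyps J rs lists_mono_S by auto
    show ?case
    proof (cases "len (s \<otimes> val ss) = len (val ss) + 1")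
      case True
      then show ?thesis using rs Cons.hyps by (intro bexI[of _ "s # rs"]) auto
    next
      case False
      then have less: "len (s \<otimes> val ss) + 1 = len (val ss)" using len_cases c by metis
      then have "len (s \<otimes> val rs) < len (val rs)" using rs(2) by simp
      then obtain us t vs where *: "rs = us @ t # vs" "s \<otimes> val rs = val (us @ vs)"
        using exchange[OF c(3,1)] by blast
      then show ?thesis using rs less Cons.hyps by (intro bexI[of _ "us @ vs"]) auto
    qed
  qed
  then show ?thesis using x unfolding par_def by blast
qed

lemma par_len_1: "J \<subseteq> S \<Longrightarrow> x \<in> par J \<Longrightarrow> len x = 1 \<Longrightarrow> x \<in> J"
proof -
  assume *: "J \<subseteq> S" "x \<in> par J" "len x = 1"
  then obtain ss where ss: "ss \<in> lists J" "val ss = x" "length ss = 1" using par_reduced_word by metis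
  then obtain s where "ss = [s]" by (auto simp: length_Suc_conv)
  then show "x \<in> J" using ss * by auto
qed

text \<open>A shortest element of the coset serves as \<open>d\<close>.\<close>

lemma ex_min_coset:
  assumes J: "J \<subseteq> S" and w: "w \<in> carrier W"
  shows "\<exists>x\<in>par J. \<exists>d\<in>carrier W. w = x \<otimes> d \<and> (\<forall>y\<in>par J. len (y \<otimes> d) = len y + len d)"
proof -
  define P where "P = (\<lambda>d. d \<in> carrier W \<and> (\<exists>x\<in>par J. w = x \<otimes> d))"
  have "P w" unfolding P_def using w by (intro conjI bexI[of _ "\<one>"]) (auto simp: one_par)
  then obtain d where Pd: "P d" and min: "\<And>d'. P d' \<Longrightarrow> len d \<le> len d'"
    using ex_has_least_nat[of P w len] by blast
  then obtain x where x: "x \<in> par J" "w = x \<otimes> d" and d: "d \<in> carrier W" unfolding P_def by blast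
  have min': "len d \<le> len (y \<otimes> d)" if "y \<in> par J" for y
  proof (rule min, unfold P_def, intro conjI bexI[of _ "x \<otimes> inv y"])
    have [simp]: "y \<in> carrier W" "x \<in> carrier W" using that x J par_closed by auto
    show "y \<otimes> d \<in> carrier W" "w = x \<otimes> inv y \<otimes> (y \<otimes> d)"
      using d x by (simp_all add: m_assoc)
    show "x \<otimes> inv y \<in> par J" using that x J par_mult par_inv by auto
  qed
  obtain ds where ds: "ds \<in> lists S" "val ds = d" "length ds = len d"
    using ex_reduced_word d by blast
  have add: "len (val ys \<otimes> d) = length ys + len d" if "ys \<in> lists J" "len (val ys) = length ys" for ys
    using that
  proof (induction ys)
    case Nil then show ?case using d by simp
  next
    case (Cons r ys)
    have c: "r \<in> S" "ys \<in> lists S" "r \<in> J" "ys \<in> lists J" using Cons.hyps J lists_mono_S by auto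
    have red: "len (val ys) = length ys"
      using reduced_append(2)[of "[r]" ys] c Cons.prems by simp
    then have IH: "len (val ys \<otimes> d) = length ys + len d" using Cons.IH by simp
    have "\<not> len (r \<otimes> (val ys \<otimes> d)) < len (val ys \<otimes> d)"
    proof
      assume "len (r \<otimes> (val ys \<otimes> d)) < len (val ys \<otimes> d)"
      then have "len (r \<otimes> val (ys @ ds)) < len (val (ys @ ds))" using c ds by simp
      then obtain us t vs where e: "ys @ ds = us @ t # vs" "r \<otimes> val (ys @ ds) = val (us @ vs)"
        using exchange[of "ys @ ds" r] c(1,2) ds(1) by (metis append_in_lists_conv)
      \<comment> \<open>Deleting a letter of \<open>ys\<close> contradicts that \<open>r # ys\<close> is reduced, deleting a letter of the
        word for \<open>d\<close> contradicts the minimality of \<open>d\<close>.\<close>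
      consider (left) vs' where "ys = us @ t # vs'" "vs = vs' @ ds"
        | (right) us' where "us = ys @ us'" "ds = us' @ t # vs"
        using e(1) by (auto simp: append_eq_append_conv2 Cons_eq_append_conv append_eq_Cons_conv)
      then show False
      proof cases
        case left
        then have L: "us \<in> lists S" "vs' \<in> lists S" using c by auto
        have "r \<otimes> val ys \<otimes> d = val (us @ vs') \<otimes> d"
          using e(2) left L c ds d by (simp add: m_assoc)
        then have "val (r # ys) = val (us @ vs')"
          using L c d by (metis S_closed append_in_lists_conv m_closed right_cancel val_closed val_Cons)
        then have "len (val (r # ys)) \<le> length (us @ vs')" using len_le[of "us @ vs'"] L by simp
        then show False using Cons.prems left by simp
      next
        case right
        then have L: "us' \<in> lists S" "vs \<in> lists S" using ds by auto
        have "r \<otimes> (val ys \<otimes> d) = val ys \<otimes> val (us' @ vs)"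
          using e(2) right L c ds by (simp add: m_assoc)
        then have "inv (val ys) \<otimes> (r \<otimes> (val ys \<otimes> d)) = val (us' @ vs)" using c L by simp
        then have eq: "(inv (val ys) \<otimes> (r \<otimes> val ys)) \<otimes> d = val (us' @ vs)"
          using c d by (simp add: m_assoc)
        have "val ys \<in> par J" "r \<in> par J"
          unfolding par_def using c by (auto intro!: image_eqI[of _ _ "[r]"])
        then have "inv (val ys) \<otimes> (r \<otimes> val ys) \<in> par J" using J par_mult par_inv by simp
        then have "len d \<le> len (val (us' @ vs))" using min' eq by metis
        also have "\<dots> \<le> length (us' @ vs)" using len_le[of "us' @ vs"] L by simp
        finally show False using ds right by simp
      qed
    qed
    then show ?case using len_cases[of r "val ys \<otimes> d"] c d IH by (simp add: m_assoc)
  qed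
  have "len (y \<otimes> d) = len y + len d" if "y \<in> par J" for y
    using par_reduced_word[OF J that] add by metis
  then show ?thesis using x d by blast
qed

text \<open>An element \<open>d\<close> without descents in \<open>J\<close> is the shortest element of its coset: otherwise the first
  letter of the \<open>J\<close>-part of \<open>d\<close> would be a descent.\<close>

lemma len_par_mult:
  assumes J: "J \<subseteq> S" and d: "lmin J d" and y: "y \<in> par J"
  shows "len (y \<otimes> d) = len y + len d"
proof -
  have dc: "d \<in> carrier W" using d lmin_def by simp
  obtain x d' where x: "x \<in> par J" "d' \<in> carrier W" "d = x \<otimes> d'"
    and add: "\<And>y. y \<in> par J \<Longrightarrow> len (y \<otimes> d') = len y + len d'"
    using ex_min_coset[OF J dc] by blast
  obtain ss where ss: "ss \<in> lists J" "val ss = x" "length ss = len x"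
    using par_reduced_word[OF J x(1)] by blast
  have "ss = []"
  proof (cases ss)
    case (Cons r rs)
    have c: "r \<in> S" "rs \<in> lists S" "r \<in> J" "rs \<in> lists J"
      using ss Cons J lists_mono_S by auto
    have "len (r \<otimes> d) = len (val rs \<otimes> d')" using x ss Cons c by (auto simp: m_assoc)
    also have "\<dots> = len (val rs) + len d'" using add c par_def by auto
    also have "\<dots> < len x + len d'"
      using len_le[of rs] c ss Cons by simp
    also have "\<dots> = len d" using add x by simp
    finally show ?thesis using d c lmin_def by auto
  qed simp
  then have "d = d'" using x ss by auto
  then show ?thesis using add y by simp
qed

lemma par_decomp:
  assumes J: "J \<subseteq> S" and w: "w \<in> carrier W"
  shows "\<exists>x\<in>par J. \<exists>d. lmin J d \<and> w = x \<otimes> d"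
proof -
  obtain x d where x: "x \<in> par J" "d \<in> carrier W" "w = x \<otimes> d"
    and add: "\<And>y. y \<in> par J \<Longrightarrow> len (y \<otimes> d) = len y + len d"
    using ex_min_coset[OF J w] by blast
  have "lmin J d" unfolding lmin_def using x add gen_par[OF J] J by fastforce
  then show ?thesis using x by blast
qed

lemma rmin_lmin: "J \<subseteq> S \<Longrightarrow> rmin J d \<Longrightarrow> lmin J (inv d)"
  unfolding rmin_def lmin_def using len_right_inv[of _ d] by (auto dest!: subsetD)

lemma len_mult_par:
  assumes J: "J \<subseteq> S" and d: "rmin J d" and y: "y \<in> par J"
  shows "len (d \<otimes> y) = len d + len y"
proof -
  have c: "d \<in> carrier W" "y \<in> carrier W" using d J y par_closed rmin_def by auto
  have "len (d \<otimes> y) = len (inv y \<otimes> inv d)" using len_inv[of "d \<otimes> y"] c by (simp add: inv_mult_group)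
  also have "\<dots> = len y + len d"
    using len_par_mult[OF J rmin_lmin[OF J d] par_inv[OF J y]] c by simp
  finally show ?thesis by simp
qed

text \<open>For a minimal double coset representative \<open>d\<close>, a right descent of \<open>x d\<close> comes from a simple
  reflection that \<open>d\<close> conjugates into \<open>J\<close>: the exchange condition cannot delete a letter of \<open>d\<close>,
  so it deletes a letter of \<open>x\<close>, and \<open>d r d\<^sup>-\<^sup>1\<close> lies in the parabolic subgroup.\<close>

lemma double_coset_descent:
  assumes J: "J \<subseteq> S" and d: "lmin J d" and x: "x \<in> par J" and r: "r \<in> S"
    and up: "len (d \<otimes> r) = len d + 1" and down: "len (x \<otimes> d \<otimes> r) < len (x \<otimes> d)"
  shows "\<exists>q\<in>J. d \<otimes> r = q \<otimes> d"
proof -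
  have dc: "d \<in> carrier W" using d lmin_def by simp
  have xc: "x \<in> carrier W" using x J par_closed by simp
  obtain ds where ds: "ds \<in> lists S" "val ds = d" "length ds = len d"
    using ex_reduced_word dc by blast
  obtain xs where xs: "xs \<in> lists J" "val xs = x" "length xs = len x"
    using par_reduced_word[OF J x] by blast
  have xsS: "xs \<in> lists S" using xs J lists_mono_S by simp
  have w: "xs @ ds \<in> lists S" "val (xs @ ds) = x \<otimes> d" using ds xs xsS by auto
  obtain us t vs where e: "xs @ ds = us @ t # vs" "x \<otimes> d \<otimes> r = val (us @ vs)"
    using exchange_right[OF w(1) r] w(2) down by metis
  consider (left) vs' where "xs = us @ t # vs'" "vs = vs' @ ds"
    | (right) us' where "us = xs @ us'" "ds = us' @ t # vs"
    using e(1) by (auto simp: append_eq_append_conv2 Cons_eq_append_conv append_eq_Cons_conv)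
  then show ?thesis
  proof cases
    case right
    then have L: "us' \<in> lists S" "vs \<in> lists S" using ds by auto
    have "x \<otimes> (d \<otimes> r) = x \<otimes> val (us' @ vs)"
      using e(2) right L xs xsS dc r xc by (simp add: m_assoc)
    then have "d \<otimes> r = val (us' @ vs)"
      using L xc dc r by (metis S_closed append_in_lists_conv left_cancel_W m_closed val_closed)
    then have "len (d \<otimes> r) \<le> length (us' @ vs)" using len_le[of "us' @ vs"] L by simp
    then show ?thesis using ds right up by simp
  next
    case left
    then have L: "us \<in> lists S" "vs' \<in> lists S" "us @ vs' \<in> lists J" using xs xsS by auto
    define q where "q = inv x \<otimes> val (us @ vs')"
    have q: "q \<in> par J"
      unfolding q_def using par_mult[OF J par_inv[OF J x]] L(3) par_def by auto
    have "x \<otimes> (d \<otimes> r) = val (us @ vs') \<otimes> d"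
      using e(2) left L ds xc dc r by (simp add: m_assoc)
    then have "inv x \<otimes> (x \<otimes> (d \<otimes> r)) = q \<otimes> d"
      unfolding q_def using L xc dc r by (simp add: m_assoc)
    then have eq: "d \<otimes> r = q \<otimes> d" using xc dc r by simp
    then have "len q = 1" using len_par_mult[OF J d q] up by simp
    then show ?thesis using eq q par_len_1 J by blast
  qed
qed


subsection \<open>Dihedral subgroups\<close>

abbreviation aval :: "'a \<Rightarrow> 'a \<Rightarrow> nat \<Rightarrow> 'a" where "aval s t k \<equiv> val (alt s t k)"

lemma alt_lists_S [simp, intro]: "s \<in> S \<Longrightarrow> t \<in> S \<Longrightarrow> alt s t k \<in> lists S"
  by (rule alt_in_lists)

lemma aval_closed [simp, intro]: "s \<in> S \<Longrightarrow> t \<in> S \<Longrightarrow> aval s t k \<in> carrier W"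
  by auto

lemma aval_par: "aval s t k \<in> par {s, t}" "aval s t k \<in> par {t, s}"
  unfolding par_def by (auto intro!: imageI alt_in_lists)

lemma reduced_dihedral_word:
  assumes "s \<in> S" "t \<in> S" "ss \<in> lists {s, t}" "len (val ss) = length ss"
  shows "ss = alt s t (length ss) \<or> ss = alt t s (length ss)"
  using assms(3,4)
proof (induction ss)
  case Nil then show ?case by simp
next
  case (Cons r ss)
  have c: "r \<in> S" "ss \<in> lists S" using Cons.hyps assms by (auto intro!: lists_mono_S[of "{s, t}" ss])
  have red: "len (val ss) = length ss"
    using reduced_append(2)[of "[r]" ss] c Cons.prems by simp
  have ne: "ss \<noteq> r # rs" for rs
  proof
    assume eq: "ss = r # rs"
    then have "val (r # ss) = val rs" "rs \<in> lists S" using c by auto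
    then show False using Cons.prems len_le[of rs] eq by simp
  qed
  show ?case
  proof (cases ss)
    case Nil then show ?thesis using Cons.hyps by auto
  next
    case (Cons r' rs)
    moreover have "ss = alt s t (length ss) \<or> ss = alt t s (length ss)" using Cons.IH red by simp
    ultimately show ?thesis using ne Cons.hyps by (auto split: if_splits)
  qed
qed

text \<open>The number \<open>m\<close> is the order of \<open>s t\<close>, expressed through reduced words: the two alternating words of
  length \<open>m\<close> are reduced words of the longest element of the dihedral group.\<close>

definition dih :: "'a \<Rightarrow> 'a \<Rightarrow> nat \<Rightarrow> bool" where
  "dih s t m \<longleftrightarrow> s \<in> S \<and> t \<in> S \<and> s \<noteq> t \<and> aval s t m = aval t s m \<and> len (aval s t m) = m \<and> 0 < m"

lemma dih_sym: "dih s t m \<Longrightarrow> dih t s m"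
  unfolding dih_def by auto

text \<open>The dihedral part of \<open>x\<close> has a reduced word starting with \<open>s\<close> and one starting with \<open>t\<close>; both
  alternate, so it is the longest element.\<close>

lemma two_descents:
  assumes st: "s \<in> S" "t \<in> S" "s \<noteq> t" and x: "x \<in> carrier W"
    and ds: "len (s \<otimes> x) < len x" and dt: "len (t \<otimes> x) < len x"
  shows "\<exists>m d. dih s t m \<and> lmin {s, t} d \<and> x = aval s t m \<otimes> d"
proof -
  have J: "{s, t} \<subseteq> S" using st by simp
  obtain w d where w: "w \<in> par {s, t}" and d: "lmin {s, t} d" and wd: "x = w \<otimes> d"
    using par_decomp[OF J x] by blast
  have c: "w \<in> carrier W" "d \<in> carrier W" using par_closed[OF J w] d lmin_def by auto
  have starts: "w = aval r r' (len w) \<and> 0 < len w"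
    if r: "r \<in> {s, t}" "len (r \<otimes> x) < len x" "{r, r'} = {s, t}" for r r'
  proof -
    have rS: "r \<in> S" "r' \<in> S" using r st by auto
    have rw: "r \<otimes> w \<in> par {s, t}" using gen_par[OF J r(1)] par_mult J w by blast
    have "len (r \<otimes> w) < len w"
      using len_par_mult[OF J d rw] len_par_mult[OF J d w] r(2) wd c rS by (simp add: m_assoc)
    then have l: "len w = len (r \<otimes> w) + 1" using len_cases[of r w] c rS by auto
    obtain ws where ws: "ws \<in> lists {s, t}" "val ws = r \<otimes> w" "length ws = len (r \<otimes> w)"
      using par_reduced_word[OF J rw] by blast
    have "val (r # ws) = w" using ws c rS by simp
    then have "r # ws = alt r r' (len w) \<or> r # ws = alt r' r (len w)"
      using reduced_dihedral_word[of r r' "r # ws"] rS ws l r by auto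
    moreover have "r' \<noteq> r" using r(3) st(3) by auto
    ultimately have "r # ws = alt r r' (len w)" using l by auto
    from arg_cong[OF this, of val] have "aval r r' (len w) = w" using \<open>val (r # ws) = w\<close> by metis
    then show ?thesis using l by simp
  qed
  have "dih s t (len w)"
    unfolding dih_def using starts[of s t] starts[of t s] ds dt st by (metis insert_commute insert_iff)
  then show ?thesis using starts[of s t] ds d wd by fastforce
qed

lemma aval_Suc_right:
  assumes "s \<in> S" "t \<in> S"
  shows "aval s t (Suc k) = aval s t k \<otimes> (if even k then s else t)"
  using alt_add[of s t k 1] assms by auto

lemma inv_aval:
  "s \<in> S \<Longrightarrow> t \<in> S \<Longrightarrow> inv (aval s t k) = (if even k then aval t s k else aval s t k)"
  by (simp add: inv_val rev_alt)

lemma len_aval: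
  assumes "dih s t m" "k \<le> m" shows "len (aval s t k) = k"
proof -
  have "alt s t m = alt s t k @ (if even k then alt s t (m - k) else alt t s (m - k))"
    using alt_add[of s t k "m - k"] assms by simp
  then show ?thesis
    using reduced_append(1)[of "alt s t k" "if even k then alt s t (m - k) else alt t s (m - k)"] assms
    by (auto simp: dih_def)
qed

lemma aval_ne:
  assumes "dih s t m" "0 < k" "k < m" shows "aval s t k \<noteq> aval t s k"
proof
  assume eq: "aval s t k = aval t s k"
  have S: "s \<in> S" "t \<in> S" using assms dih_def by auto
  obtain j where j: "k = Suc j" using assms gr0_implies_Suc by blast
  have "aval t s (Suc k) = aval s t (Suc j) \<otimes> \<one> \<Longrightarrow> False"
    using len_aval[OF dih_sym[OF assms(1)], of "Suc k"] len_aval[OF assms(1), of k] assms j S by simp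
  moreover have "aval t s (Suc k) = t \<otimes> aval t s (Suc j)" using eq j by simp
  then have "aval t s (Suc k) = aval s t j" using S by simp
  then have "Suc k = j"
    using len_aval[OF dih_sym[OF assms(1)], of "Suc k"] len_aval[OF assms(1), of j] assms j by simp
  ultimately show False using j by simp
qed

end

section \<open>Twisted conjugation\<close>

locale twisted_coxeter = coxeter_group W S for W :: "('a, 'b) monoid_scheme" (structure) and S +
  fixes star :: "'a \<Rightarrow> 'a"
  assumes star_closed [simp, intro]: "x \<in> carrier W \<Longrightarrow> star x \<in> carrier W"
    and star_mult [simp]: "x \<in> carrier W \<Longrightarrow> y \<in> carrier W \<Longrightarrow> star (x \<otimes> y) = star x \<otimes> star y"
    and star_star [simp]: "x \<in> carrier W \<Longrightarrow> star (star x) = x"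
    and star_S [simp, intro]: "s \<in> S \<Longrightarrow> star s \<in> S"
begin

abbreviation tinv :: "'a set" where "tinv \<equiv> twisted_involutions W star"

lemma star_one [simp]: "star \<one> = \<one>"
  by (metis l_cancel_one' one_closed r_one star_closed star_mult)

lemma star_inv [simp]: "x \<in> carrier W \<Longrightarrow> star (inv x) = inv (star x)"
  by (metis inv_closed inv_equality l_inv star_closed star_mult star_one)

lemma map_star_lists [simp]: "ss \<in> lists S \<Longrightarrow> map star ss \<in> lists S"
  by (induction ss) auto

lemma star_val [simp]: "ss \<in> lists S \<Longrightarrow> star (val ss) = val (map star ss)"
  by (induction ss) auto

lemma map_star_alt [simp]: "map star (alt s t k) = alt (star s) (star t) k"
  by (induction k arbitrary: s t) auto

lemma len_star_le: assumes "x \<in> carrier W" shows "len (star x) \<le> len x"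
proof -
  obtain ss where "ss \<in> lists S" "val ss = x" "length ss = len x"
    using ex_reduced_word assms by blast
  then show ?thesis using len_le[of "map star ss"] by auto
qed

lemma len_star [simp]: "x \<in> carrier W \<Longrightarrow> len (star x) = len x"
  using len_star_le[of x] len_star_le[of "star x"] by simp

lemma tinv_iff: "z \<in> tinv \<longleftrightarrow> z \<in> carrier W \<and> star z = inv z"
  by (auto simp: twisted_involutions_def)

lemma tinv_closed [simp, intro]: "z \<in> tinv \<Longrightarrow> z \<in> carrier W"
  by (simp add: tinv_iff)

lemma one_tinv [simp]: "\<one> \<in> tinv"
  by (simp add: tinv_iff)

definition tconj :: "'a \<Rightarrow> 'a \<Rightarrow> 'a" where "tconj y z = y \<otimes> z \<otimes> inv (star y)"

definition comm :: "'a \<Rightarrow> 'a \<Rightarrow> bool" where "comm s z \<longleftrightarrow> s \<otimes> z = z \<otimes> star s"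

definition asc :: "'a \<Rightarrow> 'a \<Rightarrow> bool" where "asc s z \<longleftrightarrow> len z < len (s \<otimes> z)"

text \<open>A generator acts on twisted involutions by twisted conjugation, except that the elements that it
  would fix are multiplied by it instead. This is an involution (\<open>tw_tw\<close>).\<close>

definition tw :: "'a \<Rightarrow> 'a \<Rightarrow> 'a" where
  "tw s z = (if comm s z then s \<otimes> z else s \<otimes> z \<otimes> star s)"

lemma tconj_closed [simp, intro]: "y \<in> carrier W \<Longrightarrow> z \<in> carrier W \<Longrightarrow> tconj y z \<in> carrier W"
  by (simp add: tconj_def)

lemma tconj_tinv: "y \<in> carrier W \<Longrightarrow> z \<in> tinv \<Longrightarrow> tconj y z \<in> tinv" (is "_ \<Longrightarrow> _ \<Longrightarrow> ?thesis")
proof -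
  assume *: "y \<in> carrier W" "z \<in> tinv"
  then have "star z = inv z" by (simp add: tinv_iff)
  then show ?thesis using * unfolding tinv_iff tconj_def by (auto simp: inv_mult_group m_assoc)
qed

lemma tconj_one [simp]: "z \<in> carrier W \<Longrightarrow> tconj \<one> z = z"
  by (simp add: tconj_def)

lemma tconj_mult:
  "x \<in> carrier W \<Longrightarrow> y \<in> carrier W \<Longrightarrow> z \<in> carrier W \<Longrightarrow> tconj (x \<otimes> y) z = tconj x (tconj y z)"
  by (simp add: tconj_def inv_mult_group m_assoc)

lemma tconj_S: "s \<in> S \<Longrightarrow> tconj s z = s \<otimes> z \<otimes> star s"
  by (simp add: tconj_def)

lemma len_mult_star:
  assumes "s \<in> S" "z \<in> tinv" shows "len (z \<otimes> star s) = len (s \<otimes> z)"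
proof -
  have "star (inv (s \<otimes> z)) = z \<otimes> star s"
    using assms by (simp add: inv_mult_group tinv_iff)
  moreover have "len (star (inv (s \<otimes> z))) = len (s \<otimes> z)" using assms by (simp del: star_inv)
  ultimately show ?thesis by simp
qed

lemma comm_tw [simp]:
  assumes "s \<in> S" "z \<in> tinv" shows "comm s (tw s z) \<longleftrightarrow> comm s z"
proof (cases "comm s z")
  case True
  then have "s \<otimes> z \<otimes> star s = z" using assms by (simp add: comm_def)
  then show ?thesis using True assms by (simp add: tw_def comm_def[of s "s \<otimes> z"])
next
  case False
  have "comm s (s \<otimes> z \<otimes> star s) \<longleftrightarrow> z \<otimes> star s = s \<otimes> z"
    using assms by (simp add: comm_def m_assoc S_sq)
  then show ?thesis using False by (auto simp: tw_def comm_def)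
qed

lemma tw_tw [simp]:
  assumes "s \<in> S" "z \<in> tinv" shows "tw s (tw s z) = z"
proof (cases "comm s z")
  case True
  then show ?thesis using comm_tw[OF assms] assms by (simp add: tw_def)
next
  case False
  then have "\<not> comm s (s \<otimes> z \<otimes> star s)" using comm_tw[OF assms] by (simp add: tw_def)
  then show ?thesis using False assms by (simp add: tw_def m_assoc S_sq)
qed

lemma tw_tinv [simp]:
  assumes "s \<in> S" "z \<in> tinv" shows "tw s z \<in> tinv"
proof (cases "comm s z")
  case True
  have "star (s \<otimes> z) = inv (z \<otimes> star s)"
    using assms by (simp add: inv_mult_group tinv_iff)
  then show ?thesis using True assms by (simp add: tw_def tinv_iff comm_def[symmetric] del: star_mult) (simp add: comm_def)
next
  case False
  have "tconj s z \<in> tinv" using assms by (intro tconj_tinv) auto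
  then show ?thesis using False assms by (simp add: tw_def tconj_S)
qed

lemma not_asc: "s \<in> S \<Longrightarrow> z \<in> carrier W \<Longrightarrow> \<not> asc s z \<longleftrightarrow> len (s \<otimes> z) < len z"
  using len_cases[of s z] unfolding asc_def by linarith

lemma asc_len: "s \<in> S \<Longrightarrow> z \<in> carrier W \<Longrightarrow> asc s z \<Longrightarrow> len (s \<otimes> z) = len z + 1"
  using len_cases[of s z] unfolding asc_def by linarith

text \<open>By the lifting property, an ascent that does not commute goes up by two.\<close>

lemma len_tw_up:
  assumes "s \<in> S" "z \<in> tinv" "asc s z"
  shows "len (tw s z) = (if comm s z then len z + 1 else len z + 2)"
proof (cases "comm s z")
  case True
  then show ?thesis using assms asc_len by (simp add: tw_def)
next
  case False
  have l: "len (s \<otimes> z) = len z + 1" "len (z \<otimes> star s) = len z + 1"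
    using assms asc_len len_mult_star[of s z] by auto
  then have "\<not> len (s \<otimes> z \<otimes> star s) \<le> len z + 1"
    using lifting[of s "star s" z] False assms by (auto simp: comm_def)
  then show ?thesis using len_cases_right[of "star s" "s \<otimes> z"] l False assms by (simp add: tw_def)
qed

lemma asc_tw [simp]:
  assumes "s \<in> S" "z \<in> tinv" shows "asc s (tw s z) \<longleftrightarrow> \<not> asc s z"
proof (cases "comm s z")
  case True
  then show ?thesis using len_cases[of s z] assms by (auto simp: tw_def asc_def)
next
  case False
  have down: "\<not> asc s (tw s y)" if "y \<in> tinv" "asc s y" "\<not> comm s y" for y
  proof -
    have "s \<otimes> tw s y = y \<otimes> star s" using that assms by (simp add: tw_def m_assoc)
    then have "len (s \<otimes> tw s y) = len y + 1"
      using len_mult_star[OF assms(1) that(1)] asc_len[OF assms(1) _ that(2)] that(1) by simp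
    moreover have "len (tw s y) = len y + 2" using len_tw_up[OF assms(1) that(1,2)] that(3) by simp
    ultimately show ?thesis unfolding asc_def by linarith
  qed
  show ?thesis
  proof (cases "asc s z")
    case True then show ?thesis using down False assms by auto
  next
    case nasc: False
    have "asc s (tw s z)"
    proof (rule ccontr)
      assume "\<not> asc s (tw s z)"
      then have 1: "len (s \<otimes> tw s z) < len (tw s z)" using not_asc assms by simp
      have "s \<otimes> tw s z = z \<otimes> star s" using False assms by (simp add: tw_def m_assoc)
      then have "len (s \<otimes> z) < len (tw s z)" using 1 len_mult_star assms by simp
      moreover have "len (s \<otimes> z) < len z" using nasc not_asc assms by simp
      ultimately have "len (tw s z) = len (s \<otimes> z) + 1" "len z = len (s \<otimes> z) + 1"
        using len_cases_right[of "star s" "s \<otimes> z"] len_cases[of s z] False assms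
        by (auto simp: tw_def)
      \<comment> \<open>Then \<open>s z\<close> goes up under \<open>s\<close> on the left and \<open>s\<^sup>*\<close> on the right, so the lifting property
        makes \<open>s\<close> and \<open>z\<close> commute.\<close>
      then have "s \<otimes> (s \<otimes> z) = s \<otimes> z \<otimes> star s"
        using assms False len_mult_star[of s z]
        by (intro lifting) (auto simp: tw_def)
      then have "z = s \<otimes> z \<otimes> star s" using assms by simp
      from arg_cong[OF this, of "\<lambda>x. s \<otimes> x"] have "comm s z"
        using assms by (simp add: comm_def m_assoc)
      then show False using False by simp
    qed
    then show ?thesis using nasc by simp
  qed
qed

lemma len_tw_down:
  assumes "s \<in> S" "z \<in> tinv" "\<not> asc s z"
  shows "len z = (if comm s z then len (tw s z) + 1 else len (tw s z) + 2)"
  using len_tw_up[OF assms(1) tw_tinv[OF assms(1,2)]] assms by (simp only: asc_tw tw_tw comm_tw not_False_eq_True simp_thms)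

lemma len_tw_less: "s \<in> S \<Longrightarrow> z \<in> tinv \<Longrightarrow> \<not> asc s z \<Longrightarrow> len (tw s z) < len z"
  using len_tw_down[of s z] by (cases "comm s z") auto

lemma ex_descent:
  assumes "z \<in> carrier W" "z \<noteq> \<one>" shows "\<exists>s\<in>S. len (s \<otimes> z) < len z"
proof -
  obtain ss where ss: "ss \<in> lists S" "val ss = z" "length ss = len z"
    using ex_reduced_word assms by blast
  then obtain s rs where "ss = s # rs" using assms by (cases ss) auto
  then have "s \<in> S" "s \<otimes> z = val rs" "rs \<in> lists S" "length rs < len z" using ss by auto
  then show ?thesis using len_le[of rs] by (intro bexI[of _ s]) auto
qed

lemma tinv_induct [consumes 1, case_names one up]:
  assumes "z \<in> tinv" and "P \<one>"
    and "\<And>s y. s \<in> S \<Longrightarrow> y \<in> tinv \<Longrightarrow> asc s y \<Longrightarrow> P y \<Longrightarrow> P (tw s y)"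
  shows "P z"
  using assms(1)
proof (induction "len z" arbitrary: z rule: less_induct)
  case less
  show ?case
  proof (cases "z = \<one>")
    case False
    then obtain s where s: "s \<in> S" "len (s \<otimes> z) < len z" using ex_descent less by blast
    then have "\<not> asc s z" using not_asc less by simp
    have "P (tw s (tw s z))"
    proof (rule assms(3))
      show "P (tw s z)" using less s len_tw_less[OF s(1) less.prems \<open>\<not> asc s z\<close>] by simp
    qed (use s less.prems \<open>\<not> asc s z\<close> in auto)
    then show ?thesis using less s by simp
  qed (use assms in simp)
qed

end


section \<open>The Hecke operators\<close>

locale hecke_operators = twisted_coxeter W S star
  for W :: "('a, 'b) monoid_scheme" (structure) and S and star +
  fixes u :: "'k :: idom"
  assumes u_nz: "u \<noteq> 0" and u1_nz: "u + 1 \<noteq> 0"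
begin

text \<open>This is the transpose of the action of a Hecke algebra generator, with eigenvalues \<open>-1\<close> and \<open>u\<^sup>2\<close>,
  on the Lusztig-Vogan module with basis the twisted involutions. Outside of these, \<open>T s\<close> is the scalar
  \<open>u\<^sup>2\<close>, which lets \<open>T_quadratic\<close> and \<open>braid\<close> hold as equations between functions.\<close>

definition T :: "'a \<Rightarrow> ('a \<Rightarrow> 'k) \<Rightarrow> 'a \<Rightarrow> 'k" where
  "T s F z =
    (if z \<in> tinv then
       if comm s z then
         if asc s z then u * F z + (u + 1) * F (tw s z)
         else (u\<^sup>2 - u - 1) * F z + (u\<^sup>2 - u) * F (tw s z)
       else
         if asc s z then F (tw s z)
         else (u\<^sup>2 - 1) * F z + u\<^sup>2 * F (tw s z)
     else u\<^sup>2 * F z)"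

lemma T_comb: "T s (\<lambda>z. a * F z + b * G z) = (\<lambda>z. a * T s F z + b * T s G z)"
  by (rule ext) (simp add: T_def algebra_simps)

lemma T_quadratic: "s \<in> S \<Longrightarrow> T s (T s F) = (\<lambda>z. (u\<^sup>2 - 1) * T s F z + u\<^sup>2 * F z)"
  by (rule ext) (auto simp: T_def algebra_simps power2_eq_square)

definition Tw :: "'a list \<Rightarrow> ('a \<Rightarrow> 'k) \<Rightarrow> 'a \<Rightarrow> 'k" where "Tw ss F = foldr T ss F"

lemma Tw_Nil [simp]: "Tw [] F = F" and Tw_Cons [simp]: "Tw (s # ss) F = T s (Tw ss F)"
  and Tw_append: "Tw (us @ vs) F = Tw us (Tw vs F)"
  by (simp_all add: Tw_def)

lemma Tw_comb: "Tw ss (\<lambda>z. a * F z + b * G z) = (\<lambda>z. a * Tw ss F z + b * Tw ss G z)"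
  by (induction ss) (simp_all add: T_comb)

lemma Tw_outside: "z \<notin> tinv \<Longrightarrow> Tw ss F z = u ^ (2 * length ss) * F z"
  by (induction ss) (auto simp: T_def power2_eq_square)

lemma T_comm_up: "d \<in> tinv \<Longrightarrow> comm s d \<Longrightarrow> asc s d \<Longrightarrow> T s F d = u * F d + (u + 1) * F (s \<otimes> d)"
  by (simp add: T_def tw_def)

text \<open>If conjugating by a word raises the length by the maximal amount, every letter has to
  act by a non-commuting ascent.\<close>

lemma Tw_chain:
  assumes "ss \<in> lists S" "d \<in> tinv" "len (tconj (inv (val ss)) d) = len d + 2 * length ss"
  shows "Tw ss F d = F (tconj (inv (val ss)) d)"
proof -
  have le: "len (tconj (inv (val ss)) d) \<le> len d + 2 * length ss"
    if "ss \<in> lists S" "d \<in> carrier W" for ss d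
    using that
  proof (induction ss arbitrary: d)
    case (Cons r ss)
    have "len (tconj r d) \<le> len d + 2"
      using len_mult_le[of "r \<otimes> d" "star r"] len_Cons_le[of r d] Cons.hyps Cons.prems
      by (simp add: tconj_S)
    moreover have "tconj (inv (val (r # ss))) d = tconj (inv (val ss)) (tconj r d)"
      using Cons.hyps Cons.prems by (simp add: inv_mult_group tconj_mult)
    ultimately show ?case using Cons.IH[of "tconj r d"] Cons.hyps Cons.prems by simp
  qed simp
  show ?thesis
    using assms
  proof (induction ss arbitrary: d)
    case (Cons r ss)
    have eq: "tconj (inv (val (r # ss))) d = tconj (inv (val ss)) (tconj r d)"
      using Cons.hyps Cons.prems by (simp add: inv_mult_group tconj_mult)
    have up: "len (r \<otimes> d) \<le> len d + 1" using len_Cons_le[of r d] Cons.hyps Cons.prems by simp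
    have "len (tconj r d) \<le> len (r \<otimes> d) + 1"
      using len_mult_le[of "r \<otimes> d" "star r"] Cons.hyps Cons.prems by (simp add: tconj_S)
    moreover have "len (tconj (inv (val ss)) (tconj r d)) \<le> len (tconj r d) + 2 * length ss"
      using le[of ss "tconj r d"] Cons.hyps Cons.prems by simp
    ultimately have l: "len (r \<otimes> d) = len d + 1" "len (tconj r d) = len d + 2"
      using Cons.prems(2) eq up by auto
    have "\<not> comm r d"
    proof
      assume "comm r d"
      then have "tconj r d = d" using Cons.hyps Cons.prems by (simp add: tconj_S comm_def)
      then show False using l by simp
    qed
    then have "Tw (r # ss) F d = Tw ss F (tconj r d)"
      using l Cons.prems by (simp add: T_def asc_def tw_def tconj_S Cons.hyps)
    also have "\<dots> = F (tconj (inv (val ss)) (tconj r d))"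
      using Cons.IH[of "tconj r d"] Cons.prems Cons.hyps eq l tconj_tinv[of r d] by simp
    finally show ?case using eq by simp
  qed simp
qed


subsection \<open>The braid relations\<close>

text \<open>By the quadratic relation, \<open>X s t\<close> is formally \<open>T s + u\<^sup>2 (T t)\<^sup>-\<^sup>1\<close> and also \<open>T t + u\<^sup>2 (T s)\<^sup>-\<^sup>1\<close>. Thus
  multiplying an alternating product by \<open>X s t\<close> on the right yields the sum of the product with one more letter and \<open>u\<^sup>2\<close> times
  the product with one letter less.\<close>

definition X :: "'a \<Rightarrow> 'a \<Rightarrow> ('a \<Rightarrow> 'k) \<Rightarrow> 'a \<Rightarrow> 'k" where
  "X s t F z = T s F z + T t F z - (u\<^sup>2 - 1) * F z"

definition D :: "'a \<Rightarrow> 'a \<Rightarrow> nat \<Rightarrow> ('a \<Rightarrow> 'k) \<Rightarrow> 'a \<Rightarrow> 'k" where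
  "D s t k F z = Tw (alt s t k) F z - Tw (alt t s k) F z"

lemma D_0 [simp]: "D s t 0 F z = 0"
  by (simp add: D_def)

lemma D_swap: "D t s k F z = - D s t k F z"
  by (simp add: D_def)

lemma X_swap: "X t s = X s t"
  by (simp add: X_def fun_eq_iff add.commute)

lemma alt_snoc: "alt s t (Suc k) = alt s t k @ [if even k then s else t]"
  using alt_add[of s t k 1] by auto

lemma Tw_alt_X:
  assumes "s \<in> S" "t \<in> S"
  shows "Tw (alt s t (Suc k)) (X s t F) z = Tw (alt s t (Suc (Suc k))) F z + u\<^sup>2 * Tw (alt s t k) F z"
proof -
  define e e' where "e = (if even k then s else t)" and "e' = (if even k then t else s)"
  have e: "e \<in> S" using assms by (simp add: e_def)
  have X: "X s t F = (\<lambda>z. 1 * T e' F z + 1 * (1 * T e F z + (- (u\<^sup>2 - 1)) * F z))"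
    by (auto simp: X_def e_def e'_def fun_eq_iff algebra_simps)
  have 1: "Tw (alt s t (Suc k)) G = Tw (alt s t k) (T e G)" for G
    by (simp add: alt_snoc e_def Tw_append del: alt.simps)
  have 2: "Tw (alt s t (Suc (Suc k))) G = Tw (alt s t (Suc k)) (T e' G)" for G
    by (subst alt_snoc) (simp add: e'_def Tw_append del: alt.simps)
  have "Tw (alt s t (Suc k)) (X s t F) z =
      Tw (alt s t (Suc k)) (T e' F) z + Tw (alt s t (Suc k)) (T e F) z
      - (u\<^sup>2 - 1) * Tw (alt s t (Suc k)) F z"
    unfolding X Tw_comb by (simp add: algebra_simps)
  also have "Tw (alt s t (Suc k)) (T e F) z =
      (u\<^sup>2 - 1) * Tw (alt s t (Suc k)) F z + u\<^sup>2 * Tw (alt s t k) F z"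
    unfolding 1 T_quadratic[OF e] Tw_comb by simp
  finally show ?thesis unfolding 2 by simp
qed

text \<open>So the differences \<open>D\<close> satisfy a three-term recursion of Chebyshev type.\<close>

lemma D_rec:
  assumes "s \<in> S" "t \<in> S"
  shows "D s t (Suc (Suc k)) F z = D s t (Suc k) (X s t F) z - u\<^sup>2 * D s t k F z"
  using Tw_alt_X[OF assms] Tw_alt_X[OF assms(2,1)]
  by (simp add: D_def X_swap[of s t] algebra_simps del: alt.simps)

text \<open>The recursion is symmetric under reflection of the index, so a relation between two of the
  differences spreads to all pairs with the same index sum, up to the pair that contains
  \<open>D s t 0 = 0\<close>.\<close>

lemma D_reflect:
  assumes st: "s \<in> S" "t \<in> S"
    and 0: "\<And>F. l * D s t a F z + c * D s t b F z = 0"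
    and 1: "\<And>F. l * D s t (Suc a) F z + c * u\<^sup>2 * D s t (b - 1) F z = 0"
    and b: "0 < b" and l: "l \<noteq> 0"
  shows "D s t (a + b) F z = 0"
proof -
  have "\<forall>F. l * D s t (a + j) F z + c * u ^ (2 * j) * D s t (b - j) F z = 0" if "j \<le> b" for j
    using that
  proof (induction j rule: less_induct)
    case (less j)
    consider "j = 0" | "j = 1" | i where "j = Suc (Suc i)" by (metis One_nat_def not0_implies_Suc)
    then show ?case
    proof cases
      case 3
      define c' where "c' = b - j"
      have b': "b - i = Suc (Suc c')" "b - Suc i = Suc c'" "b - j = c'"
        using 3 less.prems c'_def by auto
      show ?thesis
      proof
        fix F
        have "l * D s t (a + i) F z + c * u ^ (2 * i) * D s t (Suc (Suc c')) F z = 0"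
          using less.IH[of i] 3 less.prems b' by simp
        then have i: "l * D s t (a + i) F z
            = - (c * u ^ (2 * i) * (D s t (Suc c') (X s t F) z - u\<^sup>2 * D s t c' F z))"
          unfolding D_rec[OF st] by (simp add: eq_neg_iff_add_eq_0)
        have "l * D s t (a + Suc i) (X s t F) z + c * u ^ (2 * Suc i) * D s t (Suc c') (X s t F) z = 0"
          using less.IH[of "Suc i"] 3 less.prems b' by simp
        then have Si: "l * D s t (Suc (a + i)) (X s t F) z
            = - (c * u ^ (2 * Suc i) * D s t (Suc c') (X s t F) z)"
          by (simp add: eq_neg_iff_add_eq_0)
        have "l * D s t (a + j) F z = l * D s t (Suc (a + i)) (X s t F) z - u\<^sup>2 * (l * D s t (a + i) F z)"
          using 3 by (simp add: D_rec[OF st, of "a + i"] right_diff_distrib mult.left_commute del: alt.simps)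
        also have "\<dots> = - (c * u ^ (2 * j) * D s t c' F z)"
          unfolding i Si using 3 by (simp add: algebra_simps power2_eq_square)
        finally show "l * D s t (a + j) F z + c * u ^ (2 * j) * D s t (b - j) F z = 0"
          using b' by simp
      qed
    qed (use 0 1 in \<open>simp_all add: power2_eq_square\<close>)
  qed
  from this[of b] show ?thesis using l by simp
qed

text \<open>Multiplying by \<open>s\<close> on the left lengthens one of the two alternating products and shortens the
  other; multiplying by a suitable letter \<open>e\<close> on the right does the opposite.\<close>

lemma T_D:
  assumes st: "s \<in> S" "t \<in> S"
  shows "\<exists>e. T s (D s t (Suc k) F) z = (u\<^sup>2 - 1) * D s t (Suc k) F z - D s t (Suc k) (T e F) z"
proof -
  define e where "e = (if even k then t else s)"
  have e: "e \<in> S" using st by (simp add: e_def)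
  have D': "D s t (Suc k) F = (\<lambda>z. 1 * Tw (alt s t (Suc k)) F z + (-1) * Tw (alt t s (Suc k)) F z)" for F
    by (simp add: D_def fun_eq_iff)
  have 1: "T s (Tw (alt s t (Suc k)) F) z = (u\<^sup>2 - 1) * Tw (alt s t (Suc k)) F z + u\<^sup>2 * Tw (alt t s k) F z"
    using T_quadratic[OF st(1)] by simp
  have 2: "T s (Tw (alt t s (Suc k)) F) z = Tw (alt s t (Suc k)) (T e F) z"
  proof -
    have "T s (Tw (alt t s (Suc k)) F) = Tw (alt s t (Suc (Suc k))) F" by simp
    also have "\<dots> = Tw (alt s t (Suc k)) (T e F)"
      by (subst alt_snoc) (simp add: e_def Tw_append del: alt.simps)
    finally show ?thesis by simp
  qed
  have 3: "Tw (alt t s (Suc k)) (T e F) z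
      = (u\<^sup>2 - 1) * Tw (alt t s (Suc k)) F z + u\<^sup>2 * Tw (alt t s k) F z"
  proof -
    have a: "Tw (alt t s (Suc k)) G = Tw (alt t s k) (T e G)" for G
      by (simp add: alt_snoc e_def Tw_append del: alt.simps)
    show ?thesis unfolding a T_quadratic[OF e] Tw_comb by simp
  qed
  have "T s (D s t (Suc k) F) z = (u\<^sup>2 - 1) * D s t (Suc k) F z - D s t (Suc k) (T e F) z"
    unfolding D' T_comb by (simp only: 1 2 3) (simp add: algebra_simps)
  then show ?thesis by blast
qed

text \<open>By \<open>T_D\<close>, the vanishing of all values of \<open>D\<close> at \<open>y\<close> carries over to \<open>tw r y\<close>, so it is enough
  to test a braid relation at minimal elements. In the commuting case this cancels the factor
  \<open>u + 1\<close>.\<close>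

lemma D_zero_if_minimal:
  assumes st: "s \<in> S" "t \<in> S"
    and min: "\<And>d F. d \<in> tinv \<Longrightarrow> asc s d \<Longrightarrow> asc t d \<Longrightarrow> D s t (Suc k) F d = 0"
    and z: "z \<in> tinv"
  shows "D s t (Suc k) F z = 0"
  using z
proof (induction "len z" arbitrary: z F rule: less_induct)
  case less
  show ?case
  proof (cases "asc s z \<and> asc t z")
    case False
    define r r' where "r = (if asc s z then t else s)" and "r' = (if asc s z then s else t)"
    have r: "r \<in> S" "r' \<in> S" "\<not> asc r z" using False st by (auto simp: r_def r'_def)
    have D_eq: "D r r' (Suc k) G y = 0 \<longleftrightarrow> D s t (Suc k) G y = 0" for G y
      using D_swap[of t s "Suc k" G y] by (simp add: r_def r'_def)
    define y where "y = tw r z"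
    have y: "y \<in> tinv" "asc r y" "z = tw r y" "len y < len z"
      using r less.prems len_tw_less[of r z] by (auto simp: y_def)
    have IH: "D r r' (Suc k) G y = 0" for G
      using less.hyps[OF y(4,1)] D_eq by simp
    have "T r (D r r' (Suc k) F) y = 0"
      using T_D[OF r(1,2), of k F y] IH by auto
    then have "D r r' (Suc k) F z = 0"
      using y IH u1_nz by (simp add: T_def split: if_splits)
    then show ?thesis using D_eq by simp
  qed (use min less.prems in simp)
qed

lemma alt_palindrome:
  "rev (alt t s k) @ [s] @ alt t s k = (if even k then alt s t (2 * k + 1) else alt t s (2 * k + 1))"
  using alt_add[of s t k "Suc k"] alt_add[of t s k "Suc k"] by (simp add: rev_alt mult_2)

lemma alt_twisted_palindrome:
  "rev (alt s t k) @ alt t s k = (if even k then alt t s (2 * k) else alt s t (2 * k))"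
  using alt_add[of s t k k] alt_add[of t s k k] by (simp add: rev_alt mult_2)

lemma par_star: "J \<subseteq> S \<Longrightarrow> x \<in> par J \<Longrightarrow> star x \<in> par (star ` J)"
  unfolding par_def
proof (elim imageE)
  fix ss assume *: "J \<subseteq> S" "x = val ss" "ss \<in> lists J"
  then have "map star ss \<in> lists (star ` J)" by (auto simp: in_lists_conv_set)
  then show "star x \<in> val ` lists (star ` J)" using * lists_mono_S by simp
qed

lemma tconj_inv: "v \<in> carrier W \<Longrightarrow> tconj (inv v) z = inv v \<otimes> z \<otimes> star v"
  by (simp add: tconj_def)

lemma rmin_mult:
  assumes J: "J \<subseteq> S" and L: "L \<subseteq> S" and d: "lmin J d" "rmin L d" and y: "y \<in> par J"
    and up: "\<And>q r. q \<in> J \<Longrightarrow> r \<in> L \<Longrightarrow> d \<otimes> r = q \<otimes> d \<Longrightarrow> len (y \<otimes> d) \<le> len (y \<otimes> d \<otimes> r)"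
  shows "rmin L (y \<otimes> d)"
  unfolding rmin_def
proof (intro conjI ballI)
  have c: "y \<in> carrier W" "d \<in> carrier W" using par_closed[OF J y] d lmin_def by auto
  then show "y \<otimes> d \<in> carrier W" by simp
  fix r assume r: "r \<in> L"
  then have rS: "r \<in> S" using L by auto
  have "\<not> len (y \<otimes> d \<otimes> r) < len (y \<otimes> d)"
    using double_coset_descent[OF J d(1) y rS] d(2) r up unfolding rmin_def by fastforce
  then show "len (y \<otimes> d \<otimes> r) = len (y \<otimes> d) + 1"
    using len_cases_right[of r "y \<otimes> d"] c rS by auto
qed

lemma dihD:
  assumes "dih s t m" shows "s \<in> S" "t \<in> S" "s \<noteq> t" "aval t s m = aval s t m" "0 < m"
  using assms by (auto simp: dih_def)

lemma minimal_lmin_rmin: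
  assumes "s \<in> S" "t \<in> S" "d \<in> tinv" "asc s d" "asc t d"
  shows "lmin {s, t} d" "rmin {star s, star t} d"
  using assms asc_len[of _ d] len_mult_star[of _ d] by (auto simp: lmin_def rmin_def)

lemma len_aval_mult:
  assumes "dih s t m" "d \<in> tinv" "asc s d" "asc t d" "k \<le> m"
  shows "len (aval s t k \<otimes> d) = k + len d" "len (inv (aval s t k) \<otimes> d) = k + len d"
proof -
  note st = dihD[OF assms(1)]
  have J: "{s, t} \<subseteq> S" using st by simp
  note l = len_par_mult[OF J minimal_lmin_rmin(1)[OF st(1,2) assms(2-4)]]
  show "len (aval s t k \<otimes> d) = k + len d"
    using l[OF aval_par(1)] len_aval[OF assms(1,5)] by simp
  show "len (inv (aval s t k) \<otimes> d) = k + len d"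
    using l[OF par_inv[OF J aval_par(1)]] len_aval[OF assms(1,5)] st by simp
qed

text \<open>If \<open>d\<close> conjugates no element of \<open>{s\<^sup>*, t\<^sup>*}\<close> to \<open>s\<close> or \<open>t\<close>, lengths add up in
  \<open>w\<^sup>-\<^sup>1 d w\<^sup>*\<close>, so both alternating words climb without commuting steps to the same top element.\<close>

lemma D_free:
  assumes dih: "dih s t m" and d: "d \<in> tinv" "asc s d" "asc t d"
    and free: "\<And>q r. q \<in> {s, t} \<Longrightarrow> r \<in> {star s, star t} \<Longrightarrow> d \<otimes> r \<noteq> q \<otimes> d"
  shows "D s t m F d = 0"
proof -
  note st = dihD[OF dih]
  have J: "{s, t} \<subseteq> S" and L: "{star s, star t} \<subseteq> S" using st by auto
  note lr = minimal_lmin_rmin[OF st(1,2) d]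
  define w where "w = aval s t m"
  have w: "w \<in> carrier W" "w \<in> par {s, t}" "len w = m"
    using st aval_par len_aval[OF dih] by (auto simp: w_def)
  have "rmin {star s, star t} (inv w \<otimes> d)"
    using free by (intro rmin_mult[OF J L lr par_inv[OF J w(2)]]) blast
  from len_mult_par[OF L this] have "len (inv w \<otimes> d \<otimes> star w) = len (inv w \<otimes> d) + len (star w)"
    using par_star[OF J w(2)] by simp
  then have l: "len (tconj (inv w) d) = len d + 2 * m"
    using len_aval_mult(2)[OF dih d, of m] w by (simp add: tconj_inv w_def)
  have "Tw (alt s t m) F d = F (tconj (inv w) d)"
    using Tw_chain[of "alt s t m" d F] l d st by (simp add: w_def)
  moreover have "Tw (alt t s m) F d = F (tconj (inv w) d)"
    using Tw_chain[of "alt t s m" d F] l d st by (simp add: w_def)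
  ultimately show ?thesis by (simp add: D_def)
qed

text \<open>If \<open>d\<close> conjugates \<open>s\<^sup>*\<close> to \<open>s\<close> but not \<open>t\<^sup>*\<close> to \<open>t\<close>, both chains have \<open>m\<close> steps, exactly one of
  which commutes: the first step of the chain that starts with \<open>s\<close>, and the last step of the chain that
  starts with \<open>t\<close>.\<close>

lemma D_half_free:
  assumes dih: "dih s t m" and d: "d \<in> tinv" "asc s d" "asc t d"
    and s: "comm s d" and t: "\<not> comm t d"
  shows "D s t m F d = 0"
proof -
  note st = dihD[OF dih]
  have J: "{s, t} \<subseteq> S" and L: "{star s, star t} \<subseteq> S" using st by auto
  note lr = minimal_lmin_rmin[OF st(1,2) d]
  have dc: "d \<in> carrier W" using d by simp
  have sd: "s \<otimes> d = d \<otimes> star s" "t \<otimes> d \<noteq> d \<otimes> star t" using s t by (auto simp: comm_def)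
  obtain k where k: "m = Suc k" using st(5) gr0_implies_Suc by blast
  define v r where "v = aval t s k" and "r = (if even k then t else s)"
  have v: "v \<in> carrier W" "v \<in> par {s, t}" "len v = k"
    using st aval_par len_aval[OF dih_sym[OF dih], of k] k by (auto simp: v_def)
  have r: "r \<in> S" "alt t s m = alt t s k @ [r]"
    using st by (auto simp: r_def k alt_snoc simp del: alt.simps)
  have w: "s \<otimes> v = aval s t m" "v \<otimes> r = aval t s m"
    using aval_Suc_right[OF st(2,1), of k] by (simp_all add: v_def k r_def del: alt.simps) simp
  then have sv: "s \<otimes> v = v \<otimes> r" using st by simp
  have lsv: "len (s \<otimes> v) = m" using w len_aval[OF dih, of m] by simp
  have "inv (s \<otimes> v) = inv (v \<otimes> r)" using sv by simp
  then have vs: "inv v \<otimes> s = r \<otimes> inv v" using v st r by (simp add: inv_mult_group)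
  have lv: "len (inv v \<otimes> d) = k + len d"
    using len_aval_mult(2)[OF dih_sym[OF dih] d(1,3,2), of k] k by (simp add: v_def)
  have rm: "rmin {star s, star t} (inv v \<otimes> d)"
  proof (rule rmin_mult[OF J L lr par_inv[OF J v(2)]])
    fix q r' assume q: "q \<in> {s, t}" and r': "r' \<in> {star s, star t}" and e: "d \<otimes> r' = q \<otimes> d"
    have "q = s \<and> r' = star s"
    proof -
      consider "r' = star s" | "r' = star t" "q = s" | "r' = star t" "q = t" using q r' by auto
      then show ?thesis
      proof cases
        case 1
        then have "q \<otimes> d = s \<otimes> d" using e sd by simp
        then show ?thesis using 1 q dc st by auto
      next
        case 2
        then have "d \<otimes> star t = d \<otimes> star s" using e sd by simp
        then have "star (star t) = star (star s)" using dc st left_cancel_W by (metis S_closed star_closed)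
        then show ?thesis using st by simp
      next
        case 3 then show ?thesis using e sd by simp
      qed
    qed
    then have "inv v \<otimes> d \<otimes> r' = inv (s \<otimes> v) \<otimes> d"
      using e v st dc by (simp add: inv_mult_group m_assoc)
    also have "len \<dots> = m + len d"
      using len_aval_mult(2)[OF dih d, of m] w by simp
    finally show "len (inv v \<otimes> d) \<le> len (inv v \<otimes> d \<otimes> r')" using lv k by simp
  qed
  define p where "p = tconj (inv v) d"
  have p: "p = inv v \<otimes> d \<otimes> star v" using v by (simp add: p_def tconj_inv)
  have lp: "len p = len d + 2 * k"
    using len_mult_par[OF L rm, of "star v"] par_star[OF J v(2)] lv v p by simp
  have rp: "r \<otimes> p = inv v \<otimes> d \<otimes> star (s \<otimes> v)"
  proof -
    have "r \<otimes> p = (r \<otimes> inv v) \<otimes> d \<otimes> star v" using p v r dc by (simp add: m_assoc)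
    also have "\<dots> = inv v \<otimes> (s \<otimes> d) \<otimes> star v" unfolding vs[symmetric] using v st dc by (simp add: m_assoc)
    finally show ?thesis using sd(1) v st dc by (simp add: m_assoc)
  qed
  have commp: "comm r p"
    unfolding comm_def rp sv using p v r dc by (simp add: m_assoc)
  have svpar: "s \<otimes> v \<in> par {s, t}" using w aval_par by simp
  have lrp: "len (r \<otimes> p) = len d + 2 * k + 1"
  proof -
    have "len (r \<otimes> p) = len (inv v \<otimes> d) + len (star (s \<otimes> v))"
      unfolding rp using par_star[OF J svpar] by (intro len_mult_par[OF L rm]) simp
    also have "len (star (s \<otimes> v)) = len (s \<otimes> v)" using v st by (intro len_star) auto
    finally show ?thesis using lv lsv k by simp
  qed
  have pt: "p \<in> tinv" unfolding p_def using v d by (intro tconj_tinv) auto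
  have ascp: "asc r p" using lp lrp by (simp add: asc_def)
  have chain: "Tw (alt t s k) G d = G p" for G
    using Tw_chain[of "alt t s k" d G] lp d st by (simp add: p_def v_def)
  have chain': "Tw (alt t s k) G (s \<otimes> d) = G (r \<otimes> p)" for G
  proof -
    have sdt: "s \<otimes> d \<in> tinv" using tw_tinv[of s d] s st d by (simp add: tw_def)
    have e: "tconj (inv v) (s \<otimes> d) = r \<otimes> p"
      using v st dc sd by (simp add: rp tconj_inv m_assoc)
    have "len (s \<otimes> d) = len d + 1" using asc_len st d by simp
    then show ?thesis
      using Tw_chain[of "alt t s k" "s \<otimes> d" G] lrp e sdt st by (simp add: v_def)
  qed
  have "Tw (alt t s m) F d = u * F p + (u + 1) * F (r \<otimes> p)"
    using chain[of "T r F"] T_comm_up[OF pt commp ascp] r by (simp add: Tw_append)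
  moreover have "Tw (alt s t m) F d = u * F p + (u + 1) * F (r \<otimes> p)"
    using T_comm_up[OF d(1) s d(2)] chain chain' k by simp
  ultimately show ?thesis by (simp add: D_def)
qed

text \<open>If \<open>s d = d s\<^sup>*\<close> and \<open>t d = d t\<^sup>*\<close>, the twisted involutions that can be reached are \<open>d\<close>, the \<open>q d\<close>
  for the reflections \<open>q\<close> of the dihedral group, and, for even \<open>m\<close>, the top \<open>w d\<close>. A chain starts with
  a commuting step and then lengthens a palindrome \<open>q\<close> by two letters at a time, so it reaches the top
  after about \<open>m / 2\<close> steps. For \<open>m = 2 k + 1\<close> comparing the two chains gives
  \<open>D\<^sub>k\<^sub>+\<^sub>1 + u D\<^sub>k = 0\<close>. For \<open>m = 2 k + 2\<close> the last step commutes as well and the result is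
  \<open>D\<^sub>k\<^sub>+\<^sub>2 = u\<^sup>2 D\<^sub>k\<close>. Reflecting the index turns either relation into \<open>D\<^sub>m = 0\<close>.\<close>

lemma D_straight:
  assumes dih: "dih s t m" and d: "d \<in> tinv" "asc s d" "asc t d"
    and s: "comm s d" and t: "comm t d"
  shows "D s t m F d = 0"
proof -
  note st = dihD[OF dih]
  have dc: "d \<in> carrier W" using d by simp
  define w where "w = aval s t m"
  have lw: "len (w \<otimes> d) = m + len d" using len_aval_mult(1)[OF dih d, of m] by (simp add: w_def)
  have move: "val ss \<otimes> d = d \<otimes> star (val ss)" if "ss \<in> lists {s, t}" for ss
    using that
  proof (induction ss)
    case (Cons r ss)
    have c: "r \<in> S" "ss \<in> lists S" using Cons.hyps st lists_mono_S[of "{s, t}" ss] by auto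
    have "r \<otimes> d = d \<otimes> star r" using Cons.hyps s t by (auto simp: comm_def)
    have "val (r # ss) \<otimes> d = r \<otimes> (d \<otimes> star (val ss))" using Cons.IH c dc by (simp add: m_assoc)
    also have "\<dots> = (r \<otimes> d) \<otimes> star (val ss)" using c dc by (simp add: m_assoc)
    also have "\<dots> = d \<otimes> star r \<otimes> star (val ss)" using \<open>r \<otimes> d = _\<close> by simp
    finally show ?case using c dc by (simp add: m_assoc)
  qed (use dc in simp)
  have reflection: "Tw (alt y x k) G (x \<otimes> d) =
      G ((if even k then aval x y (2 * k + 1) else aval y x (2 * k + 1)) \<otimes> d)"
    if xy: "{x, y} = {s, t}" "x \<noteq> y" and k: "2 * k + 1 \<le> m" for x y k G
  proof -
    have dxy: "dih x y m" "comm x d" "asc x d" "asc y d"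
      using dih dih_sym[OF dih] s t d xy by (auto simp: doubleton_eq_iff)
    have xyS: "x \<in> S" "y \<in> S" using dihD[OF dxy(1)] by auto
    define v where "v = aval y x k"
    have v: "v \<in> carrier W" "v \<otimes> d = d \<otimes> star v"
      using move[of "alt y x k"] xy xyS alt_in_lists[of y "{s, t}" x k] by (auto simp: v_def)
    have "tconj (inv v) (x \<otimes> d) = inv v \<otimes> x \<otimes> (d \<otimes> star v)"
      using v xyS dc by (simp add: tconj_inv m_assoc)
    also have "\<dots> = (inv v \<otimes> x \<otimes> v) \<otimes> d"
      unfolding v(2)[symmetric] using v(1) xyS dc by (simp add: m_assoc)
    also have "inv v \<otimes> x \<otimes> v = val (rev (alt y x k) @ [x] @ alt y x k)"
      using xyS by (simp add: v_def inv_val m_assoc)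
    finally have e: "tconj (inv v) (x \<otimes> d) =
        (if even k then aval x y (2 * k + 1) else aval y x (2 * k + 1)) \<otimes> d"
      unfolding alt_palindrome by (simp split: if_split)
    have "len (x \<otimes> d) = len d + 1" using asc_len[of x d] xyS d dxy by simp
    moreover have "len (tconj (inv v) (x \<otimes> d)) = 2 * k + 1 + len d"
      unfolding e using len_aval_mult(1)[OF dxy(1) d(1) dxy(3,4) k]
        len_aval_mult(1)[OF dih_sym[OF dxy(1)] d(1) dxy(4,3) k] by simp
    moreover have "x \<otimes> d \<in> tinv" using tw_tinv[of x d] dxy xyS d by (simp add: tw_def)
    ultimately show ?thesis
      using Tw_chain[of "alt y x k" "x \<otimes> d" G] xyS e by (simp add: v_def)
  qed
  show ?thesis
  proof (cases "even m")
    case False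
    then obtain k where k: "m = 2 * k + 1" by (elim oddE)
    have top: "Tw (alt t s k) G (s \<otimes> d) = G (w \<otimes> d)" "Tw (alt s t k) G (t \<otimes> d) = G (w \<otimes> d)" for G
      using reflection[of s t k G] reflection[of t s k G] k st by (auto simp: w_def insert_commute simp del: alt.simps)
    have A: "Tw (alt s t (Suc k)) G d = u * Tw (alt t s k) G d + (u + 1) * G (w \<otimes> d)" for G
      using T_comm_up[OF d(1) s d(2)] top by simp
    have B: "Tw (alt t s (Suc k)) G d = u * Tw (alt s t k) G d + (u + 1) * G (w \<otimes> d)" for G
      using T_comm_up[OF d(1) t d(3)] top by simp
    have "D s t (Suc k) G d = - u * D s t k G d" for G
      unfolding D_def A B by (simp add: algebra_simps)
    then have "D s t (k + Suc k) F d = 0"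
      using u_nz by (intro D_reflect[OF st(1,2), of u k d 1 "Suc k"]) (simp_all add: power2_eq_square)
    then show ?thesis using k by (simp add: mult_2)
  next
    case True
    then obtain j where "m = 2 * j" by (elim evenE)
    then have "m = 2 * (j - 1) + 2" using st(5) by simp
    then obtain k where k: "m = 2 * k + 2" by blast
    have step: "Tw (alt x y (Suc (Suc k))) G d = u * Tw (alt y x (Suc k)) G d
        + u * (Tw (alt x y (Suc k)) G d - u * Tw (alt y x k) G d) + (u + 1)\<^sup>2 * G (w \<otimes> d)"
      if xy: "{x, y} = {s, t}" "x \<noteq> y" for x y G
    proof -
      have dxy: "dih x y m" "comm x d" "asc x d" "asc y d" "aval x y m = w" "aval y x m = w"
        using dih dih_sym[OF dih] s t d xy st by (auto simp: doubleton_eq_iff w_def)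
      have xyS: "x \<in> S" "y \<in> S" using dihD[OF dxy(1)] by auto
      define e f where "e = (if even k then x else y)" and "f = (if even k then y else x)"
      define q where "q = aval e f (2 * k + 1)"
      have ef: "e \<in> S" "f \<in> S" "aval e f m = w" "aval f e m = w" "dih e f m" "asc e d" "asc f d"
        using xyS dxy dih_sym[OF dxy(1)] by (auto simp: e_def f_def)
      have q: "q \<in> carrier W" using ef by (simp add: q_def del: alt.simps)
      have up: "Tw (alt y x k) G' (x \<otimes> d) = G' (q \<otimes> d)" for G'
        using reflection[of x y k G'] xy k by (simp add: q_def e_def f_def del: alt.simps split: if_splits)
      have fq: "f \<otimes> q = w" using ef(4) k by (simp add: q_def)
      have qf: "q \<otimes> f = w"
        using ef(3) k aval_Suc_right[OF ef(1,2), of "2 * k + 1"] by (simp add: q_def del: alt.simps)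
      have fd: "f \<otimes> d = d \<otimes> star f" using s t xy by (auto simp: comm_def f_def doubleton_eq_iff)
      have fp: "f \<otimes> (q \<otimes> d) = w \<otimes> d" using fq q ef dc by (simp flip: m_assoc)
      have "q \<otimes> d \<otimes> star f = q \<otimes> (f \<otimes> d)" using fd q ef dc by (simp add: m_assoc)
      also have "\<dots> = w \<otimes> d" using qf q ef dc by (simp flip: m_assoc)
      finally have "comm f (q \<otimes> d)" by (simp add: comm_def fp)
      moreover have "asc f (q \<otimes> d)"
        unfolding asc_def fp lw
        using len_aval_mult(1)[OF ef(5) d(1) ef(6,7), of "2 * k + 1"] k by (simp add: q_def)
      moreover have "q \<otimes> d \<in> tinv"
      proof -
        have "alt e f (2 * k + 1) \<in> lists {s, t}"
          using xy by (intro alt_in_lists) (auto simp: e_def f_def)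
        from move[OF this] have mq: "q \<otimes> d = d \<otimes> star q" unfolding q_def .
        have iq: "inv q = q" unfolding q_def inv_aval[OF ef(1,2)] by simp
        have "inv d \<otimes> q = inv d \<otimes> (q \<otimes> d) \<otimes> inv d" using q dc by (simp add: m_assoc)
        also have "\<dots> = star q \<otimes> inv d" unfolding mq using q dc by (simp add: m_assoc)
        finally have "inv (q \<otimes> d) = star q \<otimes> inv d" using q dc by (simp add: inv_mult_group iq)
        moreover have "star (q \<otimes> d) = star q \<otimes> inv d" using q d by (simp add: tinv_iff)
        ultimately show ?thesis unfolding tinv_iff using q dc by simp
      qed
      ultimately have "T f G (q \<otimes> d) = u * G (q \<otimes> d) + (u + 1) * G (w \<otimes> d)"
        using T_comm_up fp by metis
      moreover have "alt y x (Suc k) = alt y x k @ [f]" by (simp add: alt_snoc f_def del: alt.simps)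
      ultimately have 1: "Tw (alt y x (Suc k)) G (x \<otimes> d)
          = u * Tw (alt y x k) G (x \<otimes> d) + (u + 1) * G (w \<otimes> d)"
        using up by (simp add: Tw_append del: alt.simps)
      have T2: "Tw (alt x y (Suc j)) G d = u * Tw (alt y x j) G d + (u + 1) * Tw (alt y x j) G (x \<otimes> d)" for j
        using T_comm_up[OF d(1) dxy(2,3)] by simp
      show ?thesis
        unfolding T2[of "Suc k"] 1 using T2[of k] by (simp add: algebra_simps power2_eq_square)
    qed
    have "D s t (Suc (Suc k)) G d = u\<^sup>2 * D s t k G d" for G
      unfolding D_def step[of s t G, OF HOL.refl st(3)] 
      using step[of t s G] st(3) by (simp add: insert_commute algebra_simps power2_eq_square del: alt.simps)
    then have "D s t (Suc k + Suc k) F d = 0"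
      by (intro D_reflect[OF st(1,2), of 1 "Suc k" d "-1" "Suc k"]) simp_all
    then show ?thesis using k by (simp add: mult_2)
  qed
qed

text \<open>If \<open>s d = d t\<^sup>*\<close> and \<open>t d = d s\<^sup>*\<close>, twisted conjugation of \<open>d\<close> by an alternating word of length
  \<open>k\<close> gives \<open>q d\<close> with an alternating product \<open>q\<close> of length \<open>2 k\<close>.\<close>

lemma swapped_tconj:
  assumes st: "s \<in> S" "t \<in> S" and dc: "d \<in> carrier W"
    and sd: "s \<otimes> d = d \<otimes> star t" "t \<otimes> d = d \<otimes> star s"
  shows "tconj (inv (aval s t k)) d = (if even k then aval t s (2 * k) else aval s t (2 * k)) \<otimes> d"
proof -
  have move: "aval t s k \<otimes> d = d \<otimes> star (aval s t k)"
    using st sd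
  proof (induction k arbitrary: s t)
    case (Suc k)
    have "aval t s (Suc k) \<otimes> d = t \<otimes> (d \<otimes> star (aval t s k))"
      using Suc.IH[of t s] Suc.prems dc by (simp add: m_assoc)
    also have "\<dots> = (t \<otimes> d) \<otimes> star (aval t s k)" using Suc.prems(1,2) dc by (simp add: m_assoc)
    also have "\<dots> = d \<otimes> star s \<otimes> star (aval t s k)" using Suc.prems by simp
    finally show ?case using Suc.prems(1,2) dc by (simp add: m_assoc)
  qed (use dc in simp)
  have "tconj (inv (aval s t k)) d = inv (aval s t k) \<otimes> (aval t s k \<otimes> d)"
    unfolding move using st dc by (simp add: tconj_inv m_assoc)
  also have "\<dots> = val (rev (alt s t k) @ alt t s k) \<otimes> d"
    using st dc by (simp add: inv_val m_assoc)
  finally show ?thesis unfolding alt_twisted_palindrome by (simp split: if_split)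
qed

lemma swapped_up:
  assumes dih: "dih x y m" and d: "d \<in> tinv" "asc x d" "asc y d"
    and xd: "x \<otimes> d = d \<otimes> star y" "y \<otimes> d = d \<otimes> star x" and k: "2 * k \<le> m"
  shows "Tw (alt x y k) G d = G ((if even k then aval y x (2 * k) else aval x y (2 * k)) \<otimes> d)"
proof -
  note xy = dihD[OF dih]
  note e = swapped_tconj[OF xy(1,2) tinv_closed[OF d(1)] xd, of k]
  have "len (tconj (inv (aval x y k)) d) = 2 * k + len d"
    unfolding e using len_aval_mult(1)[OF dih d k]
      len_aval_mult(1)[OF dih_sym[OF dih] d(1,3,2) k] by simp
  then show ?thesis using Tw_chain[of "alt x y k" d G] xy d e by simp
qed

text \<open>For odd \<open>m\<close> the last step to the top \<open>w d\<close> commutes.\<close>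

lemma swapped_step:
  assumes dih: "dih x y m" and d: "d \<in> tinv" "asc x d" "asc y d"
    and xd: "x \<otimes> d = d \<otimes> star y" "y \<otimes> d = d \<otimes> star x" and k: "m = 2 * k + 1"
  shows "Tw (alt x y (Suc k)) G d = u * Tw (alt x y k) G d + (u + 1) * G (aval x y m \<otimes> d)"
proof -
  note xy = dihD[OF dih]
  have dc: "d \<in> carrier W" using d by simp
  define w where "w = aval x y m"
  have lw: "len (w \<otimes> d) = m + len d" using len_aval_mult(1)[OF dih d, of m] by (simp add: w_def)
  define e f where "e = (if even k then y else x)" and "f = (if even k then x else y)"
  define q where "q = aval e f (2 * k)"
  have ef: "e \<in> S" "f \<in> S" "aval e f m = w" "aval f e m = w" "dih e f m" "asc e d" "asc f d"
      "e \<otimes> d = d \<otimes> star f"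
    using xy dih dih_sym[OF dih] d xd by (auto simp: e_def f_def w_def)
  have q: "q \<in> carrier W" using ef by (simp add: q_def del: alt.simps)
  have qd: "(if even k then aval y x (2 * k) else aval x y (2 * k)) = q"
    by (simp add: q_def e_def f_def)
  have up: "Tw (alt x y k) G' d = G' (q \<otimes> d)" for G'
    using swapped_up[OF dih d xd, of k G'] k unfolding qd by simp
  have pt: "q \<otimes> d \<in> tinv"
    using swapped_tconj[OF xy(1,2) dc xd, of k] tconj_tinv[of "inv (aval x y k)" d] xy d
    unfolding qd by simp
  have fq: "f \<otimes> q = w" using ef(4) k by (simp add: q_def)
  have qe: "q \<otimes> e = w"
    using ef(3) k aval_Suc_right[OF ef(1,2), of "2 * k"] by (simp add: q_def del: alt.simps)
  have fp: "f \<otimes> (q \<otimes> d) = w \<otimes> d" using fq q ef dc by (simp flip: m_assoc)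
  have "q \<otimes> d \<otimes> star f = q \<otimes> (e \<otimes> d)" using ef(8) q ef(1,2) dc by (simp add: m_assoc)
  also have "\<dots> = w \<otimes> d" using qe q ef(1,2) dc by (simp flip: m_assoc)
  finally have "comm f (q \<otimes> d)" by (simp add: comm_def fp)
  moreover have "asc f (q \<otimes> d)"
    unfolding asc_def fp lw
    using len_aval_mult(1)[OF ef(5) d(1) ef(6,7), of "2 * k"] k by (simp add: q_def)
  ultimately have "T f G (q \<otimes> d) = u * G (q \<otimes> d) + (u + 1) * G (w \<otimes> d)"
    using T_comm_up[OF pt] fp by metis
  moreover have "alt x y (Suc k) = alt x y k @ [f]" by (simp add: alt_snoc f_def del: alt.simps)
  ultimately show ?thesis using up by (simp add: Tw_append w_def del: alt.simps)
qed

text \<open>Comparing the two chains gives \<open>D\<^sub>k = 0\<close> for \<open>m = 2 k\<close> and \<open>D\<^sub>k\<^sub>+\<^sub>1 = u D\<^sub>k\<close> for \<open>m = 2 k + 1\<close>.\<close>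

lemma D_swapped:
  assumes dih: "dih s t m" and d: "d \<in> tinv" "asc s d" "asc t d"
    and sd: "s \<otimes> d = d \<otimes> star t" "t \<otimes> d = d \<otimes> star s"
  shows "D s t m F d = 0"
proof -
  note st = dihD[OF dih]
  note dih' = dih_sym[OF dih]
  show ?thesis
  proof (cases "even m")
    case True
    then obtain k where k: "m = 2 * k" by (elim evenE)
    then obtain j where j: "k = Suc j" using st(5) by (cases k) auto
    have D0: "D s t k G d = 0" for G
      using swapped_up[OF dih d sd, of k G] swapped_up[OF dih' d(1,3,2) sd(2,1), of k G] k st
      by (simp add: D_def del: alt.simps split: if_splits)
    have D1: "D s t (Suc k) G d + u\<^sup>2 * D s t (k - 1) G d = 0" for G
      using D_rec[OF st(1,2), of j G d] D0[of "X s t G"] j by simp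
    have "D s t (k + k) F d = 0"
      using D0 D1 j by (intro D_reflect[OF st(1,2), of 1 k d 1 k]) simp_all
    then show ?thesis using k by (simp add: mult_2)
  next
    case False
    then obtain k where k: "m = 2 * k + 1" by (elim oddE)
    have DS: "D s t (Suc k) G d = u * D s t k G d" for G
      unfolding D_def swapped_step[OF dih d sd k] swapped_step[OF dih' d(1,3,2) sd(2,1) k] st(4)
      by (simp add: algebra_simps)
    then have "D s t (k + Suc k) F d = 0"
      using u_nz by (intro D_reflect[OF st(1,2), of "- u" k d 1 "Suc k"]) (simp_all add: power2_eq_square)
    then show ?thesis using k by (simp add: mult_2)
  qed
qed

text \<open>A minimal \<open>d\<close> falls into one of the cases above: an equation \<open>s d = d t\<^sup>*\<close> implies \<open>t d = d s\<^sup>*\<close>, by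
  applying \<open>*\<close> and inverting.\<close>

theorem braid:
  assumes dih: "dih s t m"
  shows "Tw (alt s t m) F = Tw (alt t s m) F"
proof -
  note st = dihD[OF dih]
  obtain k where k: "m = Suc k" using st(5) gr0_implies_Suc by blast
  have swap: "y \<otimes> d = d \<otimes> star x"
    if "d \<in> tinv" "x \<in> S" "y \<in> S" "x \<otimes> d = d \<otimes> star y" for d x y
  proof -
    have "star (inv (x \<otimes> d)) = d \<otimes> star x" "star (inv (d \<otimes> star y)) = y \<otimes> d"
      using that(1-3) by (simp_all add: inv_mult_group tinv_iff)
    then show ?thesis using that(4) by simp
  qed
  have min: "D s t (Suc k) G d = 0" if d: "d \<in> tinv" "asc s d" "asc t d" for d G
  proof -
    consider "s \<otimes> d = d \<otimes> star t" | "comm s d" "comm t d" | "comm s d" "\<not> comm t d"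
      | "\<not> comm s d" "comm t d" | "\<not> comm s d" "\<not> comm t d" "s \<otimes> d \<noteq> d \<otimes> star t" by blast
    then show ?thesis
    proof cases
      case 1
      then show ?thesis using D_swapped[OF dih d] swap[OF d(1) st(1,2)] k by simp
    next
      case 2
      then show ?thesis using D_straight[OF dih d] k by simp
    next
      case 3
      then show ?thesis using D_half_free[OF dih d] k by simp
    next
      case 4
      then have "D t s m G d = 0" using D_half_free[OF dih_sym[OF dih] d(1,3,2)] by simp
      then show ?thesis using D_swap[of s t m G d] k by simp
    next
      case 5
      have "t \<otimes> d \<noteq> d \<otimes> star s" using 5(3) swap[OF d(1) st(2,1)] by auto
      then have "D s t m G d = 0"
        using 5 by (intro D_free[OF dih d]) (auto simp: comm_def)
      then show ?thesis using k by simp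
    qed
  qed
  show ?thesis
  proof
    fix z
    show "Tw (alt s t m) F z = Tw (alt t s m) F z"
    proof (cases "z \<in> tinv")
      case True
      then have "D s t m F z = 0" using D_zero_if_minimal[OF st(1,2) min True] k by simp
      then show ?thesis by (simp add: D_def)
    qed (simp add: Tw_outside)
  qed
qed

end

section \<open>The Hecke support of a product\<close>

lemma unit_step_square:
  fixes a b c e :: nat
  assumes "b = a + 1 \<or> a = b + 1" "c = a + 1 \<or> a = c + 1" "e = c + 1 \<or> c = e + 1" "e = b + 1 \<or> b = e + 1"
    and "\<not> (b = a + 1 \<and> c = a + 1 \<and> e = a)" "\<not> (a = b + 1 \<and> a = c + 1 \<and> e = b + 1)"
  shows "e < c \<longleftrightarrow> b < a" "e < b \<longleftrightarrow> c < a"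
proof -
  show "e < c \<longleftrightarrow> b < a"
    using assms(1)
  proof
    assume "b = a + 1" then show ?thesis using assms(2-6) by linarith
  next
    assume "a = b + 1" then show ?thesis using assms(2-6) by linarith
  qed
  show "e < b \<longleftrightarrow> c < a"
    using assms(2)
  proof
    assume "c = a + 1" then show ?thesis using assms(1,3-6) by linarith
  next
    assume "a = c + 1" then show ?thesis using assms(1,3-6) by linarith
  qed
qed

context coxeter_group
begin

text \<open>The elements that occur in the product of the basis elements of \<open>s\<close> and \<open>v\<close> in the Hecke algebra are
  \<open>s v\<close>, and also \<open>v\<close> if \<open>s v < v\<close>. The operators \<open>Lop\<close> and \<open>Rop\<close> extend left and right
  multiplication by a generator to sets of elements. That they commute (\<open>Rop_Lop\<close>) expresses the
  associativity of the Hecke algebra at the level of supports.\<close>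

definition Lop :: "'a \<Rightarrow> 'a set \<Rightarrow> 'a set" where
  "Lop s A = {y. \<exists>v\<in>A. y = s \<otimes> v \<or> y = v \<and> len (s \<otimes> v) < len v}"

definition Rop :: "'a \<Rightarrow> 'a set \<Rightarrow> 'a set" where
  "Rop t A = {y. \<exists>v\<in>A. y = v \<otimes> t \<or> y = v \<and> len (v \<otimes> t) < len v}"

lemma Rop_closed: "s \<in> S \<Longrightarrow> A \<subseteq> carrier W \<Longrightarrow> Rop s A \<subseteq> carrier W"
  by (auto simp: Rop_def)

lemma Rop_mono: "A \<subseteq> B \<Longrightarrow> Rop t A \<subseteq> Rop t B"
  by (auto simp: Rop_def)

text \<open>Unless \<open>s v = v t\<close>, multiplication on one side of \<open>v\<close> does not change the descents on the other
  side; this is the lifting property at a lowest element of the square \<open>v, s v, v t, s v t\<close>.\<close>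

lemma sides_independent:
  assumes st: "s \<in> S" "t \<in> S" and v: "v \<in> carrier W" and ne: "s \<otimes> v \<noteq> v \<otimes> t"
  shows "len (s \<otimes> (v \<otimes> t)) < len (v \<otimes> t) \<longleftrightarrow> len (s \<otimes> v) < len v"
    and "len (s \<otimes> (v \<otimes> t)) < len (s \<otimes> v) \<longleftrightarrow> len (v \<otimes> t) < len v"
proof -
  have svt: "len (s \<otimes> v \<otimes> t) = len (s \<otimes> (v \<otimes> t))" using st v by (simp add: m_assoc)
  have up: "len (s \<otimes> (v \<otimes> t)) \<noteq> len v" if "len (s \<otimes> v) = len v + 1" "len (v \<otimes> t) = len v + 1"
    using lifting[OF st v that] ne svt by auto
  have down: "len (s \<otimes> (v \<otimes> t)) \<noteq> len (s \<otimes> v) + 1"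
    if *: "len v = len (s \<otimes> v) + 1" "len v = len (v \<otimes> t) + 1"
  proof
    assume "len (s \<otimes> (v \<otimes> t)) = len (s \<otimes> v) + 1"
    moreover have "s \<otimes> (v \<otimes> t) \<otimes> t = s \<otimes> v" using st v by (simp add: m_assoc S_sq)
    ultimately have "s \<otimes> (v \<otimes> t) = v \<otimes> t \<otimes> t"
      using * st v by (intro lifting) auto
    then have "s \<otimes> (s \<otimes> (v \<otimes> t)) = s \<otimes> v" using st v by simp
    then show False using ne st v by simp
  qed
  have "len (s \<otimes> (v \<otimes> t)) = len (v \<otimes> t) + 1 \<or> len (v \<otimes> t) = len (s \<otimes> (v \<otimes> t)) + 1"
    using st v by (intro len_cases) auto
  moreover have "len (s \<otimes> (v \<otimes> t)) = len (s \<otimes> v) + 1 \<or> len (s \<otimes> v) = len (s \<otimes> (v \<otimes> t)) + 1"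
    using len_cases_right[OF st(2), of "s \<otimes> v"] st v svt by simp
  ultimately show "len (s \<otimes> (v \<otimes> t)) < len (v \<otimes> t) \<longleftrightarrow> len (s \<otimes> v) < len v"
    and "len (s \<otimes> (v \<otimes> t)) < len (s \<otimes> v) \<longleftrightarrow> len (v \<otimes> t) < len v"
    using unit_step_square[OF len_cases[OF st(1) v] len_cases_right[OF st(2) v]] up down by blast+
qed

lemma Rop_Lop:
  assumes st: "s \<in> S" "t \<in> S" and A: "A \<subseteq> carrier W"
  shows "Rop t (Lop s A) = Lop s (Rop t A)"
proof -
  have eq: "y \<in> Rop t (Lop s {v}) \<longleftrightarrow> y \<in> Lop s (Rop t {v})" if v: "v \<in> carrier W" for y v
  proof (cases "s \<otimes> v = v \<otimes> t")
    case True
    have "s \<otimes> v \<otimes> t = v" "s \<otimes> (v \<otimes> t) = v"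
      using True st v S_cancel_right[of t v] S_cancel_left[of s v] by auto
    then show ?thesis using True unfolding Rop_def Lop_def by auto
  next
    case False
    note si = sides_independent[OF st v False]
    have "s \<otimes> v \<otimes> t = s \<otimes> (v \<otimes> t)" using st v by (simp add: m_assoc)
    then show ?thesis using si unfolding Rop_def Lop_def by auto
  qed
  have "Rop t (Lop s A) = (\<Union>v\<in>A. Rop t (Lop s {v}))"
    by (auto simp: Rop_def Lop_def)
  moreover have "Lop s (Rop t A) = (\<Union>v\<in>A. Lop s (Rop t {v}))"
    by (auto simp: Rop_def Lop_def)
  moreover have "(\<Union>v\<in>A. Rop t (Lop s {v})) = (\<Union>v\<in>A. Lop s (Rop t {v}))"
  proof (rule SUP_cong)
    fix v assume "v \<in> A"
    then have "v \<in> carrier W" using A by blast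
    then show "Rop t (Lop s {v}) = Lop s (Rop t {v})" using eq by (intro Set.set_eqI) simp
  qed simp
  ultimately show ?thesis by simp
qed

abbreviation Rops :: "'a list \<Rightarrow> 'a set \<Rightarrow> 'a set" where "Rops vs A \<equiv> fold Rop vs A"

lemma Rops_Lop:
  assumes "s \<in> S" "vs \<in> lists S" "A \<subseteq> carrier W"
  shows "Rops vs (Lop s A) = Lop s (Rops vs A)"
  using assms(2,3)
proof (induction vs arbitrary: A)
  case (Cons t vs)
  then show ?case using Rop_Lop[OF assms(1), of t A] Rop_closed[of t A] by simp
qed simp

lemma Rops_mono: "A \<subseteq> B \<Longrightarrow> Rops vs A \<subseteq> Rops vs B"
  by (induction vs arbitrary: A B) (simp_all add: Rop_mono)

lemma Rops_reduced:
  assumes "vs \<in> lists S" "z \<in> carrier W" "len (z \<otimes> val vs) = len z + length vs"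
  shows "Rops vs {z} = {z \<otimes> val vs}"
  using assms
proof (induction vs arbitrary: z)
  case (Cons t vs)
  have c: "t \<in> S" "vs \<in> lists S" "z \<in> carrier W" using Cons.hyps Cons.prems by auto
  have "len (z \<otimes> t \<otimes> val vs) \<le> len (z \<otimes> t) + length vs"
    using len_mult_le[of "z \<otimes> t" "val vs"] len_le[of vs] c by simp
  then have l: "len (z \<otimes> t) = len z + 1"
    using len_cases_right[of t z] Cons.prems c by (auto simp: m_assoc)
  then have "Rop t {z} = {z \<otimes> t}" by (auto simp: Rop_def)
  then show ?case using Cons.IH[of "z \<otimes> t"] Cons.prems l c by (simp add: m_assoc)
qed simp

end


section \<open>The functions attached to group elements\<close>

context hecke_operators
begin

text \<open>Matsumoto's theorem for the operators: two reduced words with different first letters \<open>s\<close>, \<open>t\<close> are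
  compared through the reduced words that start with the two alternating words of \<open>s\<close> and \<open>t\<close>.\<close>

theorem Tw_reduced_words:
  assumes "us \<in> lists S" "vs \<in> lists S" "val us = val vs"
    and "length us = len (val us)" "length vs = len (val vs)"
  shows "Tw us F = Tw vs F"
  using assms
proof (induction "length us" arbitrary: us vs rule: less_induct)
  case less
  show ?case
  proof (cases us)
    case Nil
    then show ?thesis using less.prems by simp
  next
    case (Cons s us')
    then obtain t vs' where vs: "vs = t # vs'" using less.prems by (cases vs) auto
    define x where "x = val us"
    have c: "s \<in> S" "us' \<in> lists S" "t \<in> S" "vs' \<in> lists S" "x \<in> carrier W"
      using less.prems Cons vs by (auto simp: x_def)
    have xv: "x = val vs" using less.prems(3) by (simp add: x_def)
    have val1: "s \<otimes> x = val us'" unfolding x_def Cons using c by simp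
    have val2: "t \<otimes> x = val vs'" unfolding xv vs using c by simp
    note val = val1 val2
    have red: "length us' = len (val us')" "length vs' = len (val vs')"
      using reduced_append(2)[of "[s]" us'] reduced_append(2)[of "[t]" vs'] c less.prems Cons vs
      by auto
    have lx: "len x = Suc (length us')" "len x = Suc (length vs')"
      using less.prems Cons vs by (auto simp: x_def)
    show ?thesis
    proof (cases "s = t")
      case True
      then have "Tw us' F = Tw vs' F"
        using less.hyps[of us' vs'] Cons c val red by auto
      then show ?thesis using Cons vs True by simp
    next
      case False
      have "len (s \<otimes> x) < len x" "len (t \<otimes> x) < len x" using val red lx by auto
      then obtain m d where md: "dih s t m" "lmin {s, t} d" "x = aval s t m \<otimes> d"
        using two_descents c False by blast
      have dc: "d \<in> carrier W" using md lmin_def by simp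
      obtain ds where ds: "ds \<in> lists S" "val ds = d" "length ds = len d"
        using ex_reduced_word[OF dc] by blast
      obtain k where k: "m = Suc k" using dihD(5)[OF md(1)] gr0_implies_Suc by blast
      have len_x: "len x = m + len d"
        using len_par_mult[OF _ md(2) aval_par(1)] len_aval[OF md(1), of m] md(3) c by simp
      have "x = s \<otimes> (aval t s k \<otimes> d)" using md(3) k c dc by (simp add: m_assoc)
      then have "s \<otimes> x = aval t s k \<otimes> d"
        using S_cancel_left[OF c(1), of "aval t s k \<otimes> d"] c dc by (metis aval_closed m_closed)
      then have *: "val (alt t s k @ ds) = val us'"
        unfolding val1 using c ds by simp
      have "x = aval t s m \<otimes> d" using md(3) dihD(4)[OF md(1)] by (simp only:)
      also have "\<dots> = t \<otimes> (aval s t k \<otimes> d)" using k c dc by (simp add: m_assoc)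
      finally have "t \<otimes> x = aval s t k \<otimes> d"
        using S_cancel_left[OF c(3), of "aval s t k \<otimes> d"] c dc by (metis aval_closed m_closed)
      then have **: "val (alt s t k @ ds) = val vs'"
        unfolding val2 using c ds by simp
      have "k + len d = length us'" "k + len d = length vs'" using lx len_x k by simp_all
      then have L: "length (alt t s k @ ds) = len (val us')" "length (alt s t k @ ds) = len (val vs')"
        using ds(3) red by (simp_all only: length_append length_alt)
      have "Tw us' F = Tw (alt t s k @ ds) F"
      proof (rule less.hyps)
        show "length us' < length us" unfolding Cons by simp
        show "alt t s k @ ds \<in> lists S" using c ds(1) by simp
      qed (use c(2) red(1) L(1) * in \<open>simp_all only: *\<close>)
      moreover have "Tw vs' F = Tw (alt s t k @ ds) F"
      proof (rule less.hyps)
        show "length vs' < length us" unfolding Cons using lx by simp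
        show "alt s t k @ ds \<in> lists S" using c ds(1) by simp
      qed (use c(4) red(2) L(2) ** in \<open>simp_all only: **\<close>)
      ultimately have "Tw us F = Tw (alt s t m) (Tw ds F)" "Tw vs F = Tw (alt t s m) (Tw ds F)"
        using Cons vs k by (simp_all add: Tw_append)
      then show ?thesis using braid[OF md(1)] by simp
    qed
  qed
qed

definition delta :: "'a \<Rightarrow> 'k" where "delta z = (if z = \<one> then 1 else 0)"

text \<open>In the geometric picture, \<open>fam x z\<close> counts the flags \<open>B\<close> for which \<open>(B, B\<^sub>0)\<close> has position \<open>x\<close> and
  \<open>(B, F B)\<close> has position \<open>z\<close>.\<close>

definition fam :: "'a \<Rightarrow> 'a \<Rightarrow> 'k" where
  "fam x = Tw (SOME ss. ss \<in> lists S \<and> val ss = x \<and> length ss = len x) delta"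

lemma fam_word:
  assumes "ss \<in> lists S" "length ss = len (val ss)"
  shows "fam (val ss) = Tw ss delta"
proof -
  define rs where "rs = (SOME rs. rs \<in> lists S \<and> val rs = val ss \<and> length rs = len (val ss))"
  have rs: "rs \<in> lists S \<and> val rs = val ss \<and> length rs = len (val ss)"
    unfolding rs_def by (rule someI[of _ ss]) (use assms in blast)
  have "Tw rs delta = Tw ss delta"
    using rs assms by (intro Tw_reduced_words) metis+
  then show ?thesis unfolding fam_def rs_def[symmetric] .
qed

lemma fam_word_mult:
  assumes "ss \<in> lists S" "x \<in> carrier W" "len (val ss \<otimes> x) = length ss + len x"
  shows "fam (val ss \<otimes> x) = Tw ss (fam x)"
proof -
  obtain rs where rs: "rs \<in> lists S" "val rs = x" "length rs = len x"
    using ex_reduced_word[OF assms(2)] by blast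
  have val: "val (ss @ rs) = val ss \<otimes> x" using rs assms(1) by simp
  have "fam (val (ss @ rs)) = Tw (ss @ rs) delta"
    using rs assms(1,3) by (intro fam_word) (simp_all del: val_append add: val)
  moreover have "fam (val rs) = Tw rs delta" using rs by (intro fam_word) simp_all
  ultimately show ?thesis unfolding val using rs(2) by (simp add: Tw_append)
qed

lemma fam_one: "fam \<one> = delta"
  using fam_word[of "[]"] by simp

lemma fam_up:
  assumes "s \<in> S" "x \<in> carrier W" "len x < len (s \<otimes> x)"
  shows "fam (s \<otimes> x) = T s (fam x)"
  using fam_word_mult[of "[s]" x] len_cases[of s x] assms by simp

lemma T_fam:
  assumes s: "s \<in> S" and x: "x \<in> carrier W"
  shows "T s (fam x) z = (if len x < len (s \<otimes> x) then fam (s \<otimes> x) z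
    else (u\<^sup>2 - 1) * fam x z + u\<^sup>2 * fam (s \<otimes> x) z)"
proof (cases "len x < len (s \<otimes> x)")
  case False
  then have "len (s \<otimes> x) < len (s \<otimes> (s \<otimes> x))" using len_cases[OF s x] s x by simp
  then have "fam x = T s (fam (s \<otimes> x))" using fam_up[of s "s \<otimes> x"] s x by simp
  then show ?thesis using T_quadratic[OF s, of "fam (s \<otimes> x)"] False by simp
qed (use fam_up[OF s x] in simp)


subsection \<open>Vanishing and divisibility\<close>

lemma len_le_tw: "s \<in> S \<Longrightarrow> z \<in> tinv \<Longrightarrow> len z \<le> len (tw s z) + 2"
  using len_tw_up[of s z] len_tw_down[of s z] by (cases "asc s z") (auto split: if_splits)

lemma Tw_vanish:
  assumes "J \<subseteq> S" "A \<subseteq> tinv" and closed: "\<And>s z. s \<in> J \<Longrightarrow> z \<in> A \<Longrightarrow> tw s z \<in> A"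
    and F: "\<And>z. z \<in> A \<Longrightarrow> n < len z \<Longrightarrow> F z = 0"
    and ss: "ss \<in> lists J" and z: "z \<in> A" "n + 2 * length ss < len z"
  shows "Tw ss F z = 0"
  using ss z
proof (induction ss arbitrary: z)
  case (Cons s ss)
  have "s \<in> S" "z \<in> tinv" "tw s z \<in> A" using Cons.hyps Cons.prems assms by auto
  then have "Tw ss F z = 0" "Tw ss F (tw s z) = 0"
    using Cons.IH[of z] Cons.IH[of "tw s z"] Cons.prems len_le_tw[of s z] by auto
  then show ?case by (simp add: T_def)
qed (use F in simp)

text \<open>The column of \<open>z\<close> is divisible by \<open>u\<^bsup>l(z)\<^esup>\<close>, as each coefficient in \<open>T s\<close> makes up for the lengths
  lost when passing from \<open>z\<close> to \<open>tw s z\<close>.\<close>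

lemma Tw_dvd:
  assumes "ss \<in> lists S" "z \<in> tinv"
  shows "u ^ len z dvd Tw ss delta z"
  using assms
proof (induction ss arbitrary: z)
  case (Cons s ss)
  have c: "s \<in> S" "z \<in> tinv" "tw s z \<in> tinv" using Cons by auto
  obtain a where a: "Tw ss delta z = u ^ len z * a" using Cons.IH[OF c(2)] by (elim dvdE)
  obtain b where b: "Tw ss delta (tw s z) = u ^ len (tw s z) * b" using Cons.IH[OF c(3)] by (elim dvdE)
  show ?case
  proof (cases "asc s z")
    case True
    then have "u ^ len z dvd u ^ len (tw s z)"
      using len_tw_up[OF c(1,2)] by (intro le_imp_power_dvd) (auto split: if_splits)
    then show ?thesis using a b True c by (simp add: T_def dvd_add dvd_mult dvd_mult2)
  next
    case False
    note l = len_tw_down[OF c(1,2) False]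
    show ?thesis
    proof (cases "comm s z")
      case True
      then have "T s (Tw ss delta) z = u ^ len z * ((u\<^sup>2 - u - 1) * a + (u - 1) * b)"
        using l False c by (simp add: T_def a b algebra_simps power2_eq_square)
      then show ?thesis by simp
    next
      case nc: False
      then have "T s (Tw ss delta) z = u ^ len z * ((u\<^sup>2 - 1) * a + b)"
        using l False c by (simp add: T_def a b algebra_simps power2_eq_square)
      then show ?thesis by simp
    qed
  qed
qed (simp add: delta_def)

lemma fam_dvd:
  assumes "x \<in> carrier W" "z \<in> tinv" shows "u ^ len z dvd fam x z"
proof -
  obtain ss where ss: "ss \<in> lists S" "val ss = x" "length ss = len x"
    using ex_reduced_word[OF assms(1)] by blast
  then show ?thesis using fam_word[of ss] Tw_dvd[OF ss(1) assms(2)] by simp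
qed


subsection \<open>The total mass\<close>

text \<open>The coefficients with which \<open>F z\<close> enters the values of \<open>T s F\<close> at \<open>z\<close> and at \<open>tw s z\<close> add up to
  \<open>u\<^sup>2\<close> in all four cases.\<close>

lemma sum_T:
  assumes s: "s \<in> S" and A: "A \<subseteq> tinv" and B: "finite B" "B \<subseteq> tinv" "A \<subseteq> B" "tw s ` A \<subseteq> B"
    and F: "\<And>z. z \<in> tinv \<Longrightarrow> z \<notin> A \<Longrightarrow> F z = 0"
  shows "(\<Sum>z\<in>B. T s F z) = u\<^sup>2 * (\<Sum>z\<in>B. F z)"
proof -
  define C where "C = A \<union> tw s ` A"
  have C: "finite C" "C \<subseteq> B" "C \<subseteq> tinv" using B finite_subset[of C B] by (auto simp: C_def)
  have closed: "tw s z \<in> C" if "z \<in> C" for z using that s A by (auto simp: C_def)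
  have out: "F z = 0" "F (tw s z) = 0" if z: "z \<in> tinv" "z \<notin> C" for z
  proof -
    have "tw s z \<notin> C" using closed[of "tw s z"] z s by auto
    then show "F (tw s z) = 0" using F[of "tw s z"] z s by (simp add: C_def)
    show "F z = 0" using F[of z] z by (simp add: C_def)
  qed
  define p q where "p z = (if comm s z then if asc s z then u else u\<^sup>2 - u - 1
      else if asc s z then 0 else u\<^sup>2 - 1)"
    and "q z = (if comm s z then if asc s z then u + 1 else u\<^sup>2 - u
      else if asc s z then 1 else u\<^sup>2)" for z
  have T: "T s F z = p z * F z + q z * F (tw s z)" if "z \<in> tinv" for z
    using that by (simp add: T_def p_def q_def)
  have "(\<Sum>z\<in>B. T s F z) = (\<Sum>z\<in>C. T s F z)"
    using B C out by (intro sum.mono_neutral_right) (auto simp: T)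
  also have "\<dots> = (\<Sum>z\<in>C. p z * F z) + (\<Sum>z\<in>C. q z * F (tw s z))"
    using C T by (simp add: sum.distrib[symmetric] subset_iff)
  also have "(\<Sum>z\<in>C. q z * F (tw s z)) = (\<Sum>z\<in>C. q (tw s z) * F z)"
    using C closed s by (intro sum.reindex_bij_witness[of _ "tw s" "tw s"]) auto
  also have "(\<Sum>z\<in>C. p z * F z) + (\<Sum>z\<in>C. q (tw s z) * F z) = (\<Sum>z\<in>C. u\<^sup>2 * F z)"
    unfolding sum.distrib[symmetric] using C s
    by (intro sum.cong) (auto simp: p_def q_def subset_iff algebra_simps)
  also have "\<dots> = u\<^sup>2 * (\<Sum>z\<in>B. F z)"
    unfolding sum_distrib_left using B C out by (intro sum.mono_neutral_left) auto
  finally show ?thesis .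
qed

lemma fam_sum:
  assumes x: "x \<in> carrier W" and B: "finite B" "B \<subseteq> tinv" "\<And>z. z \<in> tinv \<Longrightarrow> len z \<le> 2 * len x \<Longrightarrow> z \<in> B"
  shows "(\<Sum>z\<in>B. fam x z) = u ^ (2 * len x)"
proof -
  have *: "(\<Sum>z\<in>B. Tw ss delta z) = u ^ (2 * length ss)"
    if "ss \<in> lists S" "\<And>z. z \<in> tinv \<Longrightarrow> len z \<le> 2 * length ss \<Longrightarrow> z \<in> B" for ss
    using that
  proof (induction ss)
    case Nil
    have "(\<Sum>z\<in>B. delta z) = (\<Sum>z\<in>{\<one>}. delta z)"
      using B Nil by (intro sum.mono_neutral_right) (auto simp: delta_def)
    then show ?case by (simp add: delta_def)
  next
    case (Cons s ss)
    define A where "A = {z \<in> tinv. len z \<le> 2 * length ss}"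
    have "len (tw s z) \<le> len z + 2" if "z \<in> tinv" for z
      using len_le_tw[of s "tw s z"] that Cons.hyps by simp
    then have "tw s ` A \<subseteq> B" "A \<subseteq> B" using Cons.prems Cons.hyps by (fastforce simp: A_def)+
    moreover have "Tw ss delta z = 0" if "z \<in> tinv" "z \<notin> A" for z
      using that Cons.hyps by (intro Tw_vanish[of S tinv 0]) (auto simp: A_def delta_def)
    ultimately have "(\<Sum>z\<in>B. T s (Tw ss delta) z) = u\<^sup>2 * (\<Sum>z\<in>B. Tw ss delta z)"
      using B Cons.hyps by (intro sum_T[of s A B]) (auto simp: A_def)
    also have "\<dots> = u\<^sup>2 * u ^ (2 * length ss)" using Cons by simp
    finally show ?case by (simp add: power2_eq_square)
  qed
  obtain ss where ss: "ss \<in> lists S" "val ss = x" "length ss = len x"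
    using ex_reduced_word[OF x] by blast
  then show ?thesis using *[OF ss(1)] fam_word[of ss] B(3) by simp
qed


subsection \<open>The value at the identity\<close>

text \<open>If \<open>(B, B\<^sub>0)\<close> has position \<open>x\<close>, then \<open>(F B, B\<^sub>0)\<close> has position \<open>x\<^sup>*\<close>, so going from \<open>B\<close> to \<open>B\<^sub>0\<close> by way
  of \<open>F B\<close> shows that \<open>x\<close> occurs in the product of \<open>z\<close> and \<open>x\<^sup>*\<close>. The induction step uses that every
  twisted involution involved in \<open>T s F z\<close> occurs in the product of \<open>s\<close>, \<open>z\<close> and \<open>s\<^sup>*\<close>.\<close>

lemma Tw_support:
  assumes "ss \<in> lists S" "len (val ss) = length ss" "z \<in> tinv" "Tw ss delta z \<noteq> 0"
  shows "val ss \<in> Rops (map star ss) {z}"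
  using assms
proof (induction ss arbitrary: z)
  case Nil
  then show ?case by (auto simp: delta_def split: if_splits)
next
  case (Cons s ss)
  have c: "s \<in> S" "ss \<in> lists S" "z \<in> carrier W" using Cons by auto
  have red: "len (val ss) = length ss"
    using reduced_append(2)[of "[s]" ss] c Cons.prems by simp
  have right: "len (z \<otimes> star s) = len (s \<otimes> z)" using len_mult_star c Cons.prems by simp
  have self: "z \<in> Lop s (Rop (star s) {z})" if "\<not> asc s z"
  proof -
    have "len (s \<otimes> z) < len z" using not_asc that c by simp
    then show ?thesis using right by (auto simp: Lop_def Rop_def)
  qed
  have comm_self: "z \<in> Lop s (Rop (star s) {z})" if "comm s z"
  proof -
    have "z = s \<otimes> (z \<otimes> star s)" using that c by (simp flip: comm_def[THEN iffD1])
    then show ?thesis unfolding Lop_def Rop_def by blast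
  qed
  have comm_other: "s \<otimes> z \<in> Lop s (Rop (star s) {z})" if "comm s z"
  proof (cases "asc s z")
    case True
    then have "len (s \<otimes> (s \<otimes> z)) < len (s \<otimes> z)" using c by (simp add: asc_def)
    then show ?thesis using that unfolding Lop_def Rop_def comm_def by force
  next
    case False
    then have "len (s \<otimes> z) < len z" using not_asc c by simp
    then show ?thesis using right unfolding Lop_def Rop_def by force
  qed
  have nc_other: "s \<otimes> z \<otimes> star s \<in> Lop s (Rop (star s) {z})"
    using c by (auto simp: Lop_def Rop_def m_assoc)
  have "\<exists>z'\<in>tinv. Tw ss delta z' \<noteq> 0 \<and> z' \<in> Lop s (Rop (star s) {z})"
  proof (rule ccontr)
    assume none: "\<not> ?thesis"
    have t: "tw s z \<in> Lop s (Rop (star s) {z})" using comm_other nc_other by (simp add: tw_def)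
    then have 1: "Tw ss delta (tw s z) = 0" using none c Cons.prems by auto
    have 2: "Tw ss delta z = 0" if "comm s z \<or> \<not> asc s z"
      using none that self comm_self Cons.prems by auto
    have "T s (Tw ss delta) z = 0" using 1 2 Cons.prems(2) by (simp add: T_def)
    then show False using Cons.prems by simp
  qed
  then obtain z' where z': "z' \<in> tinv" "Tw ss delta z' \<noteq> 0" "z' \<in> Lop s (Rop (star s) {z})" by blast
  have "val ss \<in> Rops (map star ss) {z'}" using Cons.IH[OF red z'(1,2)] .
  also have "\<dots> \<subseteq> Rops (map star ss) (Lop s (Rop (star s) {z}))"
    using z'(3) by (intro Rops_mono) simp
  also have "\<dots> = Lop s (Rops (map star (s # ss)) {z})"
    using c Rop_closed[of "star s" "{z}"] by (simp add: Rops_Lop)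
  finally obtain v where v: "v \<in> Rops (map star (s # ss)) {z}"
      "val ss = s \<otimes> v \<or> val ss = v \<and> len (s \<otimes> v) < len v"
    unfolding Lop_def by blast
  have vc: "Rops vs A \<subseteq> carrier W" if "vs \<in> lists S" "A \<subseteq> carrier W" for vs A
    using that by (induction vs arbitrary: A) (simp_all add: Rop_closed)
  have "v \<in> carrier W" using v(1) vc[of "map star (s # ss)" "{z}"] c map_star_lists[of "s # ss"] by auto
  moreover have "len (s \<otimes> val ss) = len (val ss) + 1" using Cons.prems red by simp
  ultimately have "s \<otimes> val ss = v" using v(2) c by auto
  then show ?case using v(1) by simp
qed

lemma fam_support:
  assumes "x \<in> carrier W" "z \<in> tinv" "fam x z \<noteq> 0" "len (z \<otimes> star x) = len z + len x"
  shows "x = z \<otimes> star x"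
proof -
  obtain ss where ss: "ss \<in> lists S" "val ss = x" "length ss = len x"
    using ex_reduced_word[OF assms(1)] by blast
  then have "Tw ss delta z \<noteq> 0" using assms fam_word[of ss] by simp
  then have "x \<in> Rops (map star ss) {z}" using Tw_support[of ss z] ss assms by simp
  moreover have e: "val (map star ss) = star x" using star_val[OF ss(1)] ss(2) by simp
  have "Rops (map star ss) {z} = {z \<otimes> val (map star ss)}"
  proof (rule Rops_reduced)
    show "len (z \<otimes> val (map star ss)) = len z + length (map star ss)"
      unfolding e using assms(4) ss(3) by simp
  qed (use ss(1) assms(2) in simp_all)
  ultimately show ?thesis unfolding e by blast
qed

text \<open>An alternating product \<open>a b a \<dots> b\<close> with \<open>b = a\<^sup>*\<close> is reduced to the identity by stripping one letter
  from each end at a time. Each step contributes \<open>u\<^sup>2\<close>; the other term of \<open>T a\<close> vanishes, since a word of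
  \<open>k\<close> letters cannot reach elements longer than \<open>2 k\<close> from the identity.\<close>

lemma Tw_strip:
  assumes dih: "dih a b m" and b: "star a = b" and k: "2 * k \<le> m"
    and G: "\<And>z. z \<in> par {a, b} \<Longrightarrow> z \<in> tinv \<Longrightarrow> z \<noteq> \<one> \<Longrightarrow> G z = 0"
  shows "Tw (alt a b k) G (aval a b (2 * k)) = u ^ (2 * k) * G \<one>"
  using dih b k G
proof (induction k arbitrary: a b)
  case (Suc k)
  note ab = dihD[OF Suc.prems(1)]
  have ba: "star b = a" using Suc.prems(2) ab by auto
  have J: "{a, b} \<subseteq> S" using ab by simp
  define z where "z = aval a b (2 * Suc k)"
  have az: "a \<otimes> z = aval b a (2 * k + 1)" using ab by (simp add: z_def)
  have zb: "z \<otimes> b = aval a b (2 * k + 1)"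
    using ab aval_Suc_right[OF ab(1,2), of "2 * k + 1"] by (simp add: z_def del: alt.simps)
  have z: "z \<in> carrier W" "len z = 2 * Suc k"
    using ab len_aval[OF Suc.prems(1,3)] by (simp_all add: z_def del: alt.simps)
  have azb: "a \<otimes> z \<otimes> b = aval b a (2 * k)"
    using ab az aval_Suc_right[OF ab(2,1), of "2 * k"] by (simp del: alt.simps)
  have "star z = inv z" 
    using ab Suc.prems(2) ba by (simp add: z_def inv_aval del: alt.simps)
  then have zt: "z \<in> tinv" using z by (simp add: tinv_iff)
  have nc: "\<not> comm a z"
    using aval_ne[OF Suc.prems(1), of "2 * k + 1"] az zb Suc.prems(2,3) by (simp add: comm_def)
  have na: "\<not> asc a z"
    using len_aval[OF dih_sym[OF Suc.prems(1)], of "2 * k + 1"] az z Suc.prems(3)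
    by (simp add: asc_def)
  have tw: "tw a z = aval b a (2 * k)" using azb nc Suc.prems(2) by (simp add: tw_def)
  define A where "A = par {a, b} \<inter> tinv"
  have closed: "tw r y \<in> A" if "r \<in> {a, b}" "y \<in> A" for r y
  proof -
    have rr: "r \<in> {a, b}" "star r \<in> {a, b}" using that(1) Suc.prems(2) ba by auto
    then have r: "r \<in> par {a, b}" "star r \<in> par {a, b}" "r \<in> S"
      using gen_par[OF J rr(1)] gen_par[OF J rr(2)] J by auto
    then have "tw r y \<in> par {a, b}"
      using par_mult[OF J] that(2) by (simp add: tw_def A_def)
    then show ?thesis using r that(2) by (simp add: A_def)
  qed
  have "Tw (alt b a k) G z = 0"
  proof (rule Tw_vanish[OF J, of A 0])
    show "G y = 0" if "y \<in> A" "0 < len y" for y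
    proof -
      have "y \<noteq> \<one>" using that(2) by auto
      then show ?thesis using that(1) Suc.prems(4) by (simp add: A_def)
    qed
    show "alt b a k \<in> lists {a, b}" by (rule alt_in_lists) auto
    show "z \<in> A" using zt aval_par by (simp add: A_def z_def del: alt.simps)
  qed (use closed z in \<open>auto simp: A_def\<close>)
  moreover have "Tw (alt b a k) G (aval b a (2 * k)) = u ^ (2 * k) * G \<one>"
    using Suc.prems by (intro Suc.IH[OF dih_sym[OF Suc.prems(1)] ba]) (auto simp: insert_commute)
  ultimately have "Tw (alt a b (Suc k)) G z = u\<^sup>2 * (u ^ (2 * k) * G \<one>)"
    using zt nc na tw by (simp add: T_def)
  then show ?case by (simp add: z_def power2_eq_square del: alt.simps)
qed simp

text \<open>By \<open>fam_support\<close> the value vanishes unless \<open>y = y\<^sup>*\<close>. In that case a descent \<open>s\<close> of \<open>y\<close> comes with the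
  descent \<open>s\<^sup>*\<close>, and the longest element \<open>w\<close> of the subgroup generated by \<open>s\<close> and \<open>s\<^sup>*\<close> splits off:
  \<open>y = w d\<close> with \<open>d = d\<^sup>*\<close>. On that subgroup \<open>fam d\<close> is supported at the identity, so only the path
  that leads from the identity up and back down to it contributes, with the weight \<open>u\<^bsup>l(w)\<^esup>\<close>.\<close>

lemma fam_at_one:
  assumes "y \<in> carrier W"
  shows "fam y \<one> = (if star y = y then u ^ len y else 0)"
  using assms
proof (induction "len y" arbitrary: y rule: less_induct)
  case less
  show ?case
  proof (cases "star y = y \<and> y \<noteq> \<one>")
    case False
    moreover have "fam y \<one> = 0" if "star y \<noteq> y"
      using fam_support[of y "\<one>"] that less.prems by auto
    ultimately show ?thesis by (auto simp: fam_one delta_def)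
  next
    case True
    then obtain s where s: "s \<in> S" "len (s \<otimes> y) < len y" using ex_descent less.prems by blast
    show ?thesis
    proof (cases "star s = s")
      case ss: True
      define x where "x = s \<otimes> y"
      have x: "x \<in> carrier W" "star x = x" "y = s \<otimes> x" "len x < len y" "len y = len x + 1"
        using s True ss less.prems len_cases[of s y] by (auto simp: x_def)
      have st: "s \<in> tinv" using s ss by (simp add: tinv_iff)
      have "fam x s = 0"
      proof (rule ccontr)
        assume "fam x s \<noteq> 0"
        then have "x = y" using fam_support[of x s] x s st by simp
        then show False using x by simp
      qed
      moreover have "fam y \<one> = u * fam x \<one> + (u + 1) * fam x s"
        using fam_up[of s x] x s ss T_comm_up[of "\<one>" s "fam x"] by (simp add: comm_def asc_def)
      ultimately show ?thesis using less.hyps[of x] x True by simp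
    next
      case False
      define t where "t = star s"
      have t: "t \<in> S" "t \<noteq> s" "star t = s" "star s = t" using s False by (auto simp: t_def)
      have "len (t \<otimes> y) = len (star (s \<otimes> y))" using t True s less.prems by simp
      also have "\<dots> = len (s \<otimes> y)" using s less.prems by (intro len_star) auto
      finally have "len (t \<otimes> y) < len y" using s by simp
      then obtain m d where md: "dih s t m" "lmin {s, t} d" "y = aval s t m \<otimes> d"
        using two_descents[of s t y] s t less.prems by auto
      have J: "{s, t} \<subseteq> S" using s t by simp
      have dc: "d \<in> carrier W" using md lmin_def by simp
      define w where "w = aval s t m"
      have w: "w \<in> carrier W" "star w = w" "len w = m" "aval t s m = w"
        using s t dihD(4)[OF md(1)] len_aval[OF md(1), of m] by (auto simp: w_def)
      have ly: "len y = m + len d"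
        using len_par_mult[OF J md(2) aval_par(1), of m] w md(3) by (simp add: w_def)
      have "w \<otimes> star d = w \<otimes> d" using True md(3) w dc by (metis star_mult w_def)
      then have d: "star d = d" using left_cancel_W w dc by (metis star_closed)
      define G where "G = fam d"
      have G1: "G \<one> = u ^ len d"
        unfolding G_def using less.hyps[of d] d dc ly dihD(5)[OF md(1)] by simp
      have G0: "G z = 0" if "z \<in> par {s, t}" "z \<in> tinv" "z \<noteq> \<one>" for z
      proof (rule ccontr)
        assume "G z \<noteq> 0"
        then have "d = z \<otimes> d"
          using fam_support[of d z] len_par_mult[OF J md(2) that(1)] d dc that by (simp add: G_def)
        then show False using that dc by simp
      qed
      have fam_y: "fam y = Tw (alt s t m) G"
        unfolding md(3) G_def using ly md(3) s t dc by (intro fam_word_mult) auto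
      have d1: "\<one> \<in> tinv" "asc s \<one>" "asc t \<one>" "s \<otimes> \<one> = \<one> \<otimes> star t" "t \<otimes> \<one> = \<one> \<otimes> star s"
        using s t by (simp_all add: asc_def)
      have "Tw (alt s t m) G \<one> = u ^ m * G \<one>"
      proof (cases "even m")
        case True
        then obtain k where k: "m = 2 * k" by (elim evenE)
        define a b where "a = (if even k then s else t)" and "b = (if even k then t else s)"
        have ab: "dih a b m" "star a = b" "{a, b} = {s, t}" "aval a b m = w"
          using md(1) dih_sym[OF md(1)] t w by (auto simp: a_def b_def w_def)
        have "alt s t m = alt s t k @ alt a b k"
          using alt_add[of s t k k] k by (simp add: a_def b_def mult_2)
        then have "Tw (alt s t m) G \<one> = Tw (alt s t k) (Tw (alt a b k) G) \<one>"
          by (simp add: Tw_append)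
        also have "\<dots> = Tw (alt a b k) G w"
          using swapped_up[OF md(1) d1, of k] k w by (simp add: w_def del: alt.simps split: if_splits)
        also have "\<dots> = u ^ m * G \<one>"
          using Tw_strip[OF ab(1,2), of k G] G0 ab k by simp
        finally show ?thesis .
      next
        case False
        then obtain k where k: "m = 2 * k + 1" by (elim oddE)
        define a b where "a = (if even k then t else s)" and "b = (if even k then s else t)"
        have ab: "dih a b m" "star a = b" "{a, b} = {s, t}" "aval a b m = w"
          using md(1) dih_sym[OF md(1)] t w by (auto simp: a_def b_def w_def)
        have "alt s t m = alt s t (Suc k) @ alt a b k"
          using alt_add[of s t "Suc k" k] k by (simp add: a_def b_def mult_2 del: alt.simps)
        then have "Tw (alt s t m) G \<one> = Tw (alt s t (Suc k)) (Tw (alt a b k) G) \<one>"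
          by (simp add: Tw_append del: alt.simps)
        also have "\<dots> = u * Tw (alt s t k) (Tw (alt a b k) G) \<one> + (u + 1) * Tw (alt a b k) G w"
          using swapped_step[OF md(1) d1 k] w by (simp add: w_def del: alt.simps)
        also have "Tw (alt a b k) G w = 0"
        proof -
          define A where "A = par {s, t} \<inter> tinv"
          have closed: "tw r z \<in> A" if "r \<in> {s, t}" "z \<in> A" for r z
          proof -
            have rr: "r \<in> {s, t}" "star r \<in> {s, t}" using that(1) t by auto
            then have r: "r \<in> par {s, t}" "star r \<in> par {s, t}" "r \<in> S"
              using gen_par[OF J rr(1)] gen_par[OF J rr(2)] J by auto
            then have "tw r z \<in> par {s, t}"
              using par_mult[OF J] that(2) by (simp add: tw_def A_def)
            then show ?thesis using r that(2) by (simp add: A_def)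
          qed
          have "star w = inv w"
            using w s t False by (simp add: w_def inv_aval)
          then have "w \<in> A" using w aval_par by (simp add: A_def w_def tinv_iff)
          then show ?thesis
          proof (intro Tw_vanish[OF J, of A 0])
            show "G z = 0" if "z \<in> A" "0 < len z" for z
            proof -
              have "z \<noteq> \<one>" using that(2) by auto
              then show ?thesis using that(1) G0 by (simp add: A_def)
            qed
            show "alt a b k \<in> lists {s, t}" using ab(3) by (intro alt_in_lists) auto
          qed (use closed w k in \<open>auto simp: A_def\<close>)
        qed
        also have "Tw (alt s t k) (Tw (alt a b k) G) \<one> = Tw (alt a b k) G (aval a b (2 * k))"
          using swapped_up[OF md(1) d1, of k] k s t by (simp add: a_def b_def del: alt.simps split: if_splits)
        also have "\<dots> = u ^ (2 * k) * G \<one>"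
          using Tw_strip[OF ab(1,2), of k G] G0 ab k by simp
        finally show ?thesis using k by simp
      qed
      then show ?thesis using fam_y G1 ly True by (simp add: power_add)
    qed
  qed
qed

lemma power_dvd_cancel: "u ^ n dvd (u + 1) * c \<Longrightarrow> u ^ n dvd c"
proof (induction n arbitrary: c)
  case (Suc n)
  have "u dvd (u + 1) * c" using Suc.prems by (metis dvd_mult_left power_Suc)
  then have "u dvd (u + 1) * c - u * c" by (intro dvd_diff) auto
  moreover have "(u + 1) * c - u * c = c" by (simp add: algebra_simps)
  ultimately have "u dvd c" by simp
  then obtain b where b: "c = u * b" by (rule dvdE)
  have "u * u ^ n dvd u * ((u + 1) * b)" using Suc.prems b by (simp add: ac_simps)
  then show ?case using Suc.IH[of b] u_nz b by simp
qed simp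

text \<open>For a fixed \<open>z\<close> the values tend to \<open>0\<close> as \<open>x\<close> grows: solving the formula for \<open>T s\<close> at \<open>z\<close> for the
  value at \<open>tw s z\<close> reduces the claim to \<open>z = 1\<close>, where it is \<open>fam_at_one\<close>.\<close>

lemma fam_dvd_left:
  assumes "z \<in> tinv" "x \<in> carrier W"
  shows "u ^ (len x - len z) dvd fam x z"
  using assms
proof (induction arbitrary: x rule: tinv_induct)
  case one
  then show ?case by (simp add: fam_at_one)
next
  case (up s z)
  have le: "u ^ (len x - len (tw s z)) dvd u ^ (len x - len z)"
    using len_tw_up[OF up(1,2,3)] by (intro le_imp_power_dvd) (auto split: if_splits)
  have T: "u ^ (len x - len z) dvd T s (fam x) z"
  proof (cases "len x < len (s \<otimes> x)")
    case True
    have "u ^ (len x - len z) dvd u ^ (len (s \<otimes> x) - len z)"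
      using True by (intro le_imp_power_dvd) simp
    also have "\<dots> dvd fam (s \<otimes> x) z" using up by simp
    finally show ?thesis using T_fam[OF up(1), of x z] up.prems True by simp
  next
    case False
    then have "len x = len (s \<otimes> x) + 1" using len_cases[OF up(1) up.prems] by simp
    then have "u ^ (len x - len z) dvd u\<^sup>2 * u ^ (len (s \<otimes> x) - len z)"
      unfolding power_add[symmetric] by (intro le_imp_power_dvd) simp
    also have "\<dots> dvd u\<^sup>2 * fam (s \<otimes> x) z" using up by (intro mult_dvd_mono) simp_all
    finally show ?thesis using T_fam[OF up(1), of x z] up.prems False up.IH[of x] by (simp add: dvd_add)
  qed
  show ?case
  proof (cases "comm s z")
    case True
    then have "T s (fam x) z - u * fam x z = (u + 1) * fam x (tw s z)"
      using up by (simp add: T_def)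
    moreover have "u ^ (len x - len z) dvd T s (fam x) z - u * fam x z"
      using T up.IH[OF up.prems] by (intro dvd_diff dvd_mult)
    ultimately have "u ^ (len x - len z) dvd fam x (tw s z)" using power_dvd_cancel by metis
    then show ?thesis using le dvd_trans by blast
  next
    case False
    then have eq: "T s (fam x) z = fam x (tw s z)" using up by (simp add: T_def)
    show ?thesis using dvd_trans[OF le T] unfolding eq .
  qed
qed

end

section \<open>Infinite sums of power series\<close>

unbundle fps_syntax

definition coeff_finite :: "('i \<Rightarrow> int fps) \<Rightarrow> 'i set \<Rightarrow> bool" where
  "coeff_finite f A \<longleftrightarrow> (\<forall>n. finite {a \<in> A. f a $ n \<noteq> 0})"

text \<open>Sums taken coefficient by coefficient, each coefficient being a finite sum. For families in
  \<open>coeff_finite\<close> they agree with the sums in the \<open>u\<close>-adic topology (\<open>infsum_eq_coeff_sum\<close>), and their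
  algebraic rules follow from those of finite sums.\<close>

definition coeff_sum :: "('i \<Rightarrow> int fps) \<Rightarrow> 'i set \<Rightarrow> int fps" where
  "coeff_sum f A = Abs_fps (\<lambda>n. \<Sum>a \<in> {a \<in> A. f a $ n \<noteq> 0}. f a $ n)"

lemma coeff_sum_nth:
  assumes "finite B" "B \<subseteq> A" "\<And>a. a \<in> A \<Longrightarrow> f a $ n \<noteq> 0 \<Longrightarrow> a \<in> B"
  shows "coeff_sum f A $ n = (\<Sum>a\<in>B. f a $ n)"
  unfolding coeff_sum_def fps_nth_Abs_fps using assms by (intro sum.mono_neutral_left) auto

lemma infsum_eq_coeff_sum:
  assumes "coeff_finite f A" shows "infsum f A = coeff_sum f A"
proof (rule infsumI)
  have "eventually (\<lambda>B. sum f B $ n = coeff_sum f A $ n) (finite_subsets_at_top A)" for n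
    unfolding eventually_finite_subsets_at_top
  proof (intro exI conjI allI impI)
    show "finite {a \<in> A. f a $ n \<noteq> 0}" using assms by (simp add: coeff_finite_def)
    fix B assume "finite B \<and> {a \<in> A. f a $ n \<noteq> 0} \<subseteq> B \<and> B \<subseteq> A"
    then show "sum f B $ n = coeff_sum f A $ n"
      unfolding fps_sum_nth by (intro coeff_sum_nth[symmetric]) blast+
  qed auto
  then show "(f has_sum coeff_sum f A) A" by (simp add: has_sum_def tendsto_fps_iff)
qed

lemma coeff_finite_mult:
  assumes "coeff_finite f A" shows "coeff_finite (\<lambda>a. g a * f a) A"
  unfolding coeff_finite_def
proof
  fix n
  have "{a \<in> A. (g a * f a) $ n \<noteq> 0} \<subseteq> (\<Union>k\<in>{..n}. {a \<in> A. f a $ k \<noteq> 0})"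
  proof
    fix a assume "a \<in> {a \<in> A. (g a * f a) $ n \<noteq> 0}"
    then have a: "a \<in> A" "(\<Sum>i=0..n. g a $ i * f a $ (n - i)) \<noteq> 0" by (auto simp: fps_mult_nth)
    then obtain i where "f a $ (n - i) \<noteq> 0" by (metis (no_types, lifting) mult_zero_right sum.neutral)
    then show "a \<in> (\<Union>k\<in>{..n}. {a \<in> A. f a $ k \<noteq> 0})" using a(1) by (auto intro!: bexI[of _ "n - i"])
  qed
  then show "finite {a \<in> A. (g a * f a) $ n \<noteq> 0}"
    using assms by (elim finite_subset) (auto simp: coeff_finite_def)
qed

lemma coeff_sum_cong: "(\<And>a. a \<in> A \<Longrightarrow> f a = g a) \<Longrightarrow> coeff_sum f A = coeff_sum g A"
proof (rule fps_ext)
  fix n assume *: "\<And>a. a \<in> A \<Longrightarrow> f a = g a"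
  have "{a \<in> A. f a $ n \<noteq> 0} = {a \<in> A. g a $ n \<noteq> 0}" using * by auto
  then show "coeff_sum f A $ n = coeff_sum g A $ n"
    using * by (auto simp: coeff_sum_def intro!: sum.cong)
qed

lemma coeff_sum_add:
  assumes "coeff_finite f A" "coeff_finite g A"
  shows "coeff_sum (\<lambda>a. f a + g a) A = coeff_sum f A + coeff_sum g A"
proof (rule fps_ext)
  fix n
  define B where "B = {a \<in> A. f a $ n \<noteq> 0} \<union> {a \<in> A. g a $ n \<noteq> 0}"
  have B: "finite B" "B \<subseteq> A" using assms by (auto simp: B_def coeff_finite_def)
  have "coeff_sum (\<lambda>a. f a + g a) A $ n = (\<Sum>a\<in>B. (f a + g a) $ n)"
    using B by (intro coeff_sum_nth) (auto simp: B_def)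
  moreover have "coeff_sum f A $ n = (\<Sum>a\<in>B. f a $ n)" "coeff_sum g A $ n = (\<Sum>a\<in>B. g a $ n)"
    using B by (intro coeff_sum_nth; auto simp: B_def)+
  ultimately show "coeff_sum (\<lambda>a. f a + g a) A $ n = (coeff_sum f A + coeff_sum g A) $ n"
    by (simp add: sum.distrib)
qed

lemma coeff_sum_cmult:
  assumes "coeff_finite f A"
  shows "coeff_sum (\<lambda>a. c * f a) A = c * coeff_sum f A"
proof (rule fps_ext)
  fix n
  define B where "B = (\<Union>k\<in>{..n}. {a \<in> A. f a $ k \<noteq> 0}) \<union> {a \<in> A. (c * f a) $ n \<noteq> 0}"
  have B: "finite B" "B \<subseteq> A"
    using assms coeff_finite_mult[OF assms, of "\<lambda>_. c"] by (auto simp: B_def coeff_finite_def)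
  have "coeff_sum (\<lambda>a. c * f a) A $ n = (\<Sum>a\<in>B. (c * f a) $ n)"
    using B by (intro coeff_sum_nth) (auto simp: B_def)
  also have "\<dots> = (\<Sum>i=0..n. c $ i * (\<Sum>a\<in>B. f a $ (n - i)))"
    by (simp add: fps_mult_nth sum.swap[of _ B] sum_distrib_left)
  also have "\<dots> = (\<Sum>i=0..n. c $ i * coeff_sum f A $ (n - i))"
  proof (intro sum.cong HOL.refl arg_cong2[where f = "(*)"])
    fix i assume "i \<in> {0..n}"
    show "(\<Sum>a\<in>B. f a $ (n - i)) = coeff_sum f A $ (n - i)"
      using B by (intro coeff_sum_nth[symmetric]) (auto simp: B_def)
  qed
  finally show "coeff_sum (\<lambda>a. c * f a) A $ n = (c * coeff_sum f A) $ n" by (simp add: fps_mult_nth)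
qed

lemma coeff_sum_reindex:
  assumes "inj_on h A" "h ` A = B"
  shows "coeff_sum (\<lambda>a. f (h a)) A = coeff_sum f B"
proof (rule fps_ext)
  fix n
  have "{b \<in> B. f b $ n \<noteq> 0} = h ` {a \<in> A. f (h a) $ n \<noteq> 0}" using assms by auto
  then show "coeff_sum (\<lambda>a. f (h a)) A $ n = coeff_sum f B $ n"
    using assms by (simp add: coeff_sum_def sum.reindex inj_on_subset)
qed

lemma X_power_dvd_nth: "fps_X ^ k dvd f \<Longrightarrow> n < k \<Longrightarrow> f $ n = (0::int)"
  by (auto simp: fps_X_power_mult_nth elim!: dvdE)

lemma fps_unit_div_mult:
  assumes "g $ 0 = 1" shows "fps_unit_div f g * g = f"
  using fps_right_inverse[of g 1] assms by (simp add: fps_unit_div_def mult.assoc mult.commute[of _ g])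

lemma eq_fps_unit_div:
  assumes "g $ 0 = 1" "h * g = f" shows "h = fps_unit_div f g"
  using fps_right_inverse[of g 1] assms by (auto simp: fps_unit_div_def mult.assoc)


section \<open>The identity of power series\<close>

locale twisted_series = hecke_operators W S star "fps_X :: int fps"
  for W :: "('a, 'b) monoid_scheme" (structure) and S and star +
  fixes \<phi> :: "'a \<Rightarrow> nat"
  assumes finite_S: "finite S" and phi: "is_phi W S star \<phi>"
begin

definition zeta :: "'a \<Rightarrow> int fps" where
  "zeta z = fps_X ^ len z * fps_unit_div (fps_X - 1) (fps_X + 1) ^ \<phi> z"

lemma bruhat_less_descent:
  assumes "s \<in> S" "w \<in> carrier W" "len (s \<otimes> w) < len w"
  shows "bruhat_less W S (s \<otimes> w) w"
proof -
  have "s \<in> reflections W S"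
    unfolding reflections_def using assms by (intro CollectI exI[of _ "\<one>"] exI[of _ s]) simp
  moreover have "w = s \<otimes> (s \<otimes> w)" using assms by simp
  ultimately have "bruhat_step W S (s \<otimes> w) w"
    unfolding bruhat_step_def using assms by blast
  then show ?thesis using assms by (auto simp: bruhat_less_def bruhat_le_def)
qed

lemma zeta_one: "zeta \<one> = 1"
  using phi by (simp add: zeta_def is_phi_def)

lemma zeta_up:
  assumes s: "s \<in> S" and z: "z \<in> tinv" and up: "asc s z"
  shows "comm s z \<Longrightarrow> (fps_X + 1) * zeta (tw s z) = (fps_X\<^sup>2 - fps_X) * zeta z"
    and "\<not> comm s z \<Longrightarrow> zeta (tw s z) = fps_X\<^sup>2 * zeta z"
proof -
  define w where "w = tw s z"
  have w: "w \<in> tinv" "w \<in> carrier W" "tw s w = z" "comm s w \<longleftrightarrow> comm s z"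
    using s z by (simp_all add: w_def)
  have "\<not> asc s w" using s z up by (simp add: w_def)
  then have "bruhat_less W S (s \<otimes> w) w" using bruhat_less_descent not_asc s w by simp
  then have p: "if comm s w then \<phi> w = \<phi> (s \<otimes> w) + 1 else \<phi> w = \<phi> (s \<otimes> w \<otimes> star s)"
    using phi w(1) s unfolding is_phi_def comm_def by blast
  note l = len_tw_up[OF s z up]
  define e where "e = fps_unit_div (fps_X - 1) (fps_X + 1)"
  have e: "(fps_X + 1) * e = fps_X - 1"
    using fps_unit_div_mult[of "fps_X + 1" "fps_X - 1"] by (simp add: e_def mult.commute)
  {
    assume c: "comm s z"
    then have "\<phi> w = \<phi> z + 1" using p w by (simp add: tw_def)
    then have "zeta w = fps_X * e * zeta z" using l c by (simp add: zeta_def e_def w_def)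
    then have "(fps_X + 1) * zeta w = fps_X * ((fps_X + 1) * e) * zeta z" by (simp add: ac_simps)
    then show "(fps_X + 1) * zeta (tw s z) = (fps_X\<^sup>2 - fps_X) * zeta z"
      unfolding e w_def by (simp add: algebra_simps power2_eq_square)
  }
  {
    assume c: "\<not> comm s z"
    then have "\<phi> w = \<phi> z" using p w by (simp add: tw_def)
    then show "zeta (tw s z) = fps_X\<^sup>2 * zeta z"
      using l c by (simp add: zeta_def w_def power2_eq_square)
  }
qed

lemma finite_len_le: "finite {w \<in> carrier W. len w \<le> n}"
proof -
  have "{w \<in> carrier W. len w \<le> n} \<subseteq> val ` {ss. set ss \<subseteq> S \<and> length ss \<le> n}"
    using ex_reduced_word by (force simp: in_lists_conv_set)
  then show ?thesis using finite_lists_length_le[OF finite_S] finite_surj by blast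
qed

lemma finite_tinv_len_le: "finite {z \<in> tinv. len z \<le> n}"
  by (rule finite_subset[OF _ finite_len_le[of n]]) auto

lemma fam_nth_len_left: "x \<in> carrier W \<Longrightarrow> z \<in> tinv \<Longrightarrow> fam x z $ n \<noteq> 0 \<Longrightarrow> len x \<le> n + len z"
  using X_power_dvd_nth[OF fam_dvd_left, of z x n] by (meson le_diff_conv not_le)

lemma fam_nth_len: "x \<in> carrier W \<Longrightarrow> z \<in> tinv \<Longrightarrow> fam x z $ n \<noteq> 0 \<Longrightarrow> len z \<le> n"
  using X_power_dvd_nth[OF fam_dvd, of x z n] by (meson not_le)

lemma coeff_finite_fam: "z \<in> tinv \<Longrightarrow> coeff_finite (\<lambda>x. fam x z) (carrier W)"
  unfolding coeff_finite_def
proof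
  fix n assume z: "z \<in> tinv"
  show "finite {x \<in> carrier W. fam x z $ n \<noteq> 0}"
    by (rule finite_subset[OF _ finite_len_le[of "n + len z"]]) (use fam_nth_len_left[OF _ z] in auto)
qed

definition column :: "'a \<Rightarrow> int fps" where "column z = coeff_sum (\<lambda>x. fam x z) (carrier W)"

text \<open>By \<open>T_fam\<close>, a summand \<open>fam x z\<close> occurs in the expansion of \<open>T s (fam x)\<close> and of
  \<open>T s (fam (s x))\<close>, with coefficients that add up to \<open>u\<^sup>2\<close>.\<close>

lemma column_T:
  assumes s: "s \<in> S" and z: "z \<in> tinv"
  shows "coeff_sum (\<lambda>x. T s (fam x) z) (carrier W) = fps_X\<^sup>2 * column z"
proof -
  define p q :: "'a \<Rightarrow> int fps"
    where "p x = (if len (s \<otimes> x) < len x then 1 else fps_X\<^sup>2)"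
      and "q x = (if len (s \<otimes> x) < len x then fps_X\<^sup>2 - 1 else 0)" for x
  note f = coeff_finite_fam[OF z]
  have inj: "inj_on ((\<otimes>) s) (carrier W)" using s by (auto intro: inj_onI left_cancel_W[of s])
  have img: "(\<otimes>) s ` carrier W = carrier W"
  proof
    show "carrier W \<subseteq> (\<otimes>) s ` carrier W"
    proof
      fix x assume "x \<in> carrier W"
      then have "x = s \<otimes> (s \<otimes> x)" "s \<otimes> x \<in> carrier W" using s by auto
      then show "x \<in> (\<otimes>) s ` carrier W" by blast
    qed
  qed (use s in auto)
  have fin: "coeff_finite (\<lambda>x. p (s \<otimes> x) * fam (s \<otimes> x) z) (carrier W)"
    unfolding coeff_finite_def
  proof
    fix n
    have "finite {x \<in> carrier W. (p x * fam x z) $ n \<noteq> 0}"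
      using coeff_finite_mult[OF f] by (simp add: coeff_finite_def)
    then have "finite ((\<otimes>) s ` {x \<in> carrier W. (p x * fam x z) $ n \<noteq> 0})" by simp
    moreover have "{x \<in> carrier W. (p (s \<otimes> x) * fam (s \<otimes> x) z) $ n \<noteq> 0}
        \<subseteq> (\<otimes>) s ` {x \<in> carrier W. (p x * fam x z) $ n \<noteq> 0}"
    proof
      fix x assume x: "x \<in> {x \<in> carrier W. (p (s \<otimes> x) * fam (s \<otimes> x) z) $ n \<noteq> 0}"
      then have "x = s \<otimes> (s \<otimes> x)" using s by simp
      then show "x \<in> (\<otimes>) s ` {x \<in> carrier W. (p x * fam x z) $ n \<noteq> 0}" using x s by blast
    qed
    ultimately show "finite {x \<in> carrier W. (p (s \<otimes> x) * fam (s \<otimes> x) z) $ n \<noteq> 0}"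
      using finite_subset by blast
  qed
  have "coeff_sum (\<lambda>x. T s (fam x) z) (carrier W)
      = coeff_sum (\<lambda>x. p (s \<otimes> x) * fam (s \<otimes> x) z + q x * fam x z) (carrier W)"
  proof (rule coeff_sum_cong)
    fix x assume x: "x \<in> carrier W"
    have ssx: "s \<otimes> (s \<otimes> x) = x" using s x by simp
    show "T s (fam x) z = p (s \<otimes> x) * fam (s \<otimes> x) z + q x * fam x z"
    proof (cases "len (s \<otimes> x) < len x")
      case True
      then show ?thesis unfolding T_fam[OF s x] p_def q_def ssx by simp
    next
      case False
      then have "len x < len (s \<otimes> x)" using len_cases[OF s x] by linarith
      then show ?thesis unfolding T_fam[OF s x] p_def q_def ssx by simp
    qed
  qed
  also have "\<dots> = coeff_sum (\<lambda>x. p x * fam x z) (carrier W) + coeff_sum (\<lambda>x. q x * fam x z) (carrier W)"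
    unfolding coeff_sum_add[OF fin coeff_finite_mult[OF f]]
    using coeff_sum_reindex[OF inj img, of "\<lambda>x. p x * fam x z"] by simp
  also have "\<dots> = coeff_sum (\<lambda>x. p x * fam x z + q x * fam x z) (carrier W)"
    by (rule coeff_sum_add[symmetric]) (intro coeff_finite_mult f)+
  also have "\<dots> = coeff_sum (\<lambda>x. fps_X\<^sup>2 * fam x z) (carrier W)"
    by (intro coeff_sum_cong) (simp add: p_def q_def algebra_simps)
  finally show ?thesis using coeff_sum_cmult[OF f] by (simp add: column_def)
qed

lemma column_up:
  assumes s: "s \<in> S" and z: "z \<in> tinv" and up: "asc s z"
  shows "comm s z \<Longrightarrow> (fps_X + 1) * column (tw s z) = (fps_X\<^sup>2 - fps_X) * column z"
    and "\<not> comm s z \<Longrightarrow> column (tw s z) = fps_X\<^sup>2 * column z"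
proof -
  have f: "coeff_finite (\<lambda>x. fam x z) (carrier W)" "coeff_finite (\<lambda>x. fam x (tw s z)) (carrier W)"
    using coeff_finite_fam s z by auto
  {
    assume c: "comm s z"
    have "fps_X\<^sup>2 * column z
        = coeff_sum (\<lambda>x. fps_X * fam x z + (fps_X + 1) * fam x (tw s z)) (carrier W)"
      unfolding column_T[OF s z, symmetric] using c up z by (simp add: T_def)
    also have "\<dots> = fps_X * column z + (fps_X + 1) * column (tw s z)"
      unfolding coeff_sum_add[OF coeff_finite_mult[OF f(1)] coeff_finite_mult[OF f(2)]]
        coeff_sum_cmult[OF f(1)] coeff_sum_cmult[OF f(2)] column_def ..
    finally show "(fps_X + 1) * column (tw s z) = (fps_X\<^sup>2 - fps_X) * column z"
      by (simp add: algebra_simps)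
  }
  {
    assume c: "\<not> comm s z"
    then have "column (tw s z) = coeff_sum (\<lambda>x. T s (fam x) z) (carrier W)"
      unfolding column_def using up z by (simp add: T_def)
    then show "column (tw s z) = fps_X\<^sup>2 * column z" using column_T[OF s z] by simp
  }
qed

lemma coeff_finite_power:
  assumes "A \<subseteq> carrier W" shows "coeff_finite (\<lambda>x. fps_X ^ len x * g x) A"
  unfolding coeff_finite_def
proof
  fix n
  show "finite {x \<in> A. (fps_X ^ len x * g x) $ n \<noteq> 0}"
    by (rule finite_subset[OF _ finite_len_le[of n]])
      (use assms in \<open>auto simp: fps_X_power_mult_nth split: if_splits\<close>)
qed

lemma P_star_eq: "P_star_series W S star = coeff_sum (\<lambda>x. fps_X ^ len x) {x \<in> carrier W. x = star x}"
  unfolding P_star_series_def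
  using infsum_eq_coeff_sum[OF coeff_finite_power[of "{x \<in> carrier W. x = star x}" "\<lambda>_. 1"]] by simp

lemma P_eq: "P_series W S = coeff_sum (\<lambda>x. fps_X ^ len x) (carrier W)"
  unfolding P_series_def using infsum_eq_coeff_sum[OF coeff_finite_power[of "carrier W" "\<lambda>_. 1"]] by simp

lemma R_eq: "R_series W S star \<phi> = coeff_sum zeta tinv"
  unfolding R_series_def zeta_def by (intro infsum_eq_coeff_sum coeff_finite_power) auto

lemma column_one: "column \<one> = P_star_series W S star"
proof (rule fps_ext)
  fix n
  define B where "B = {x \<in> carrier W. len x \<le> n}"
  have B: "finite B" "B \<subseteq> carrier W" using finite_len_le by (auto simp: B_def)
  have "column \<one> $ n = (\<Sum>x\<in>B. fam x \<one> $ n)"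
    unfolding column_def using B fam_nth_len_left[of _ "\<one>" n] by (intro coeff_sum_nth) (auto simp: B_def)
  also have "\<dots> = (\<Sum>x\<in>B. if x = star x then fps_X ^ len x $ n else 0)"
    using B(2) by (intro sum.cong) (auto simp: fam_at_one)
  also have "\<dots> = (\<Sum>x\<in>{x \<in> B. x = star x}. fps_X ^ len x $ n)"
    using B(1) by (intro sum.inter_filter[symmetric])
  also have "\<dots> = P_star_series W S star $ n"
    unfolding P_star_eq
  proof (rule coeff_sum_nth[symmetric])
    show "finite {x \<in> B. x = star x}" using B(1) by simp
  qed (auto simp: B_def split: if_splits)
  finally show "column \<one> $ n = P_star_series W S star $ n" .
qed

lemma column_eq: "z \<in> tinv \<Longrightarrow> column z = zeta z * P_star_series W S star"
proof (induction rule: tinv_induct)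
  case one
  then show ?case by (simp add: column_one zeta_one)
next
  case (up s z)
  show ?case
  proof (cases "comm s z")
    case True
    have "(fps_X + 1) * column (tw s z) = (fps_X\<^sup>2 - fps_X) * zeta z * P_star_series W S star"
      using column_up(1)[OF up(1-3) True] up.IH by (simp add: mult.assoc)
    also have "\<dots> = (fps_X + 1) * (zeta (tw s z) * P_star_series W S star)"
      using zeta_up(1)[OF up(1-3) True] by (simp flip: mult.assoc)
    finally show ?thesis using u1_nz mult_left_cancel by blast
  next
    case False
    then show ?thesis using column_up(2)[OF up(1-3)] zeta_up(2)[OF up(1-3)] up.IH by (simp add: mult.assoc)
  qed
qed

lemma zeta_nth_len: "zeta z $ n \<noteq> 0 \<Longrightarrow> len z \<le> n"
  by (auto simp: zeta_def fps_X_power_mult_nth split: if_splits)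

text \<open>Up to a given degree, the double sum of \<open>fam y z\<close> is finite. Its columns give the left-hand side
  (\<open>column_eq\<close>) and its rows the right-hand side (\<open>fam_sum\<close>).\<close>

theorem R_times_P_star: "R_series W S star \<phi> * P_star_series W S star = fps_compose (P_series W S) (fps_X ^ 2)"
proof (rule fps_ext)
  fix n
  define Z Y where "Z = {z \<in> tinv. len z \<le> n}" and "Y = {y \<in> carrier W. len y \<le> 2 * n}"
  have Z: "finite Z" "Z \<subseteq> tinv" using finite_tinv_len_le by (auto simp: Z_def)
  have Y: "finite Y" "Y \<subseteq> carrier W" using finite_len_le by (auto simp: Y_def)
  have R: "R_series W S star \<phi> $ i = (\<Sum>z\<in>Z. zeta z) $ i" if "i \<le> n" for i
    unfolding R_eq fps_sum_nth using Z zeta_nth_len that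
    by (intro coeff_sum_nth) (force simp: Z_def)+
  have "(R_series W S star \<phi> * P_star_series W S star) $ n = ((\<Sum>z\<in>Z. zeta z) * P_star_series W S star) $ n"
    unfolding fps_mult_nth using R by (intro sum.cong) auto
  also have "\<dots> = (\<Sum>z\<in>Z. column z $ n)"
    unfolding sum_distrib_right fps_sum_nth using Z column_eq by (intro sum.cong) auto
  also have "\<dots> = (\<Sum>z\<in>Z. \<Sum>y\<in>Y. fam y z $ n)"
  proof (intro sum.cong HOL.refl)
    fix z assume z: "z \<in> Z"
    show "column z $ n = (\<Sum>y\<in>Y. fam y z $ n)"
      unfolding column_def using Y z fam_nth_len_left[of _ z n]
      by (intro coeff_sum_nth) (force simp: Y_def Z_def)+
  qed
  also have "\<dots> = (\<Sum>y\<in>Y. \<Sum>z\<in>Z. fam y z $ n)" by (rule sum.swap)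
  also have "\<dots> = (\<Sum>y\<in>Y. if 2 * len y = n then 1 else 0)"
  proof (intro sum.cong HOL.refl)
    fix y assume "y \<in> Y"
    then have y: "y \<in> carrier W" using Y by auto
    define B where "B = {z \<in> tinv. len z \<le> n + 2 * len y}"
    have B: "finite B" "B \<subseteq> tinv" using finite_tinv_len_le by (auto simp: B_def)
    have "(\<Sum>z\<in>Z. fam y z $ n) = (\<Sum>z\<in>B. fam y z $ n)"
      using B Z fam_nth_len[OF y] by (intro sum.mono_neutral_left) (auto simp: B_def Z_def)
    also have "\<dots> = (fps_X ^ (2 * len y) :: int fps) $ n"
      using fam_sum[OF y B] by (simp flip: fps_sum_nth add: B_def)
    finally show "(\<Sum>z\<in>Z. fam y z $ n) = (if 2 * len y = n then 1 else 0)" by auto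
  qed
  also have "\<dots> = (\<Sum>i=0..n. \<Sum>y\<in>Y. if len y = i \<and> 2 * i = n then 1 else 0)"
  proof -
    have "(if 2 * len y = n then 1 else 0) = (\<Sum>i=0..n. if len y = i \<and> 2 * i = n then 1 else (0::int))" for y
    proof -
      have "(\<Sum>i=0..n. if len y = i \<and> 2 * i = n then 1 else (0::int))
          = (\<Sum>i=0..n. if len y = i then if 2 * len y = n then 1 else 0 else 0)"
        by (intro sum.cong) auto
      then show ?thesis by (simp add: sum.delta)
    qed
    then show ?thesis by (subst sum.swap) simp
  qed
  also have "\<dots> = fps_compose (P_series W S) (fps_X ^ 2) $ n"
    unfolding fps_compose_nth
  proof (intro sum.cong HOL.refl)
    fix i assume "i \<in> {0..n}"
    then have "P_series W S $ i = (\<Sum>y\<in>Y. fps_X ^ len y $ i)"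
      unfolding P_eq using Y by (intro coeff_sum_nth) (auto simp: Y_def split: if_splits)
    moreover have "(fps_X ^ 2) ^ i $ n = (if 2 * i = n then 1 else (0::int))"
      by (auto simp flip: power_mult)
    ultimately show "(\<Sum>y\<in>Y. if len y = i \<and> 2 * i = n then 1 else 0) = P_series W S $ i * (fps_X ^ 2) ^ i $ n"
      by (auto simp: sum_distrib_right intro!: sum.cong)
  qed
  finally show "(R_series W S star \<phi> * P_star_series W S star) $ n = fps_compose (P_series W S) (fps_X ^ 2) $ n" .
qed

lemma P_star_nth_0: "P_star_series W S star $ 0 = 1"
proof -
  have "P_star_series W S star $ 0 = (\<Sum>x\<in>{\<one>}. fps_X ^ len x $ 0)"
    unfolding P_star_eq by (intro coeff_sum_nth) (auto simp: len_eq_0_iff split: if_splits)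
  then show ?thesis by simp
qed

end

lemma twisted_series_intro:
  assumes "coxeter_system W S" "finite S" "coxeter_involution W S star" "is_phi W S star \<phi>"
  shows "twisted_series W S star \<phi>"
proof -
  interpret coxeter_group W S using coxeter_system_imp_coxeter_group assms(1) .
  have star: "star \<in> iso W W" "\<And>w. w \<in> carrier W \<Longrightarrow> star (star w) = w" "star ` S = S"
    using assms(3) by (auto simp: coxeter_involution_def)
  then have hom: "star \<in> hom W W" by (simp add: iso_def)
  show ?thesis
  proof unfold_locales
    show "(fps_X :: int fps) + 1 \<noteq> 0"
      by (metis add.commute add_0 fps_X_nth fps_add_nth fps_one_nth fps_zero_nth zero_neq_one)
  qed (use hom star assms in \<open>auto simp: hom_def\<close>)
qed

theorem theorem0p2:
  fixes W :: "('a, 'b) monoid_scheme" and S :: "'a set"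
    and star :: "'a \<Rightarrow> 'a" and \<phi> :: "'a \<Rightarrow> nat"
  assumes "coxeter_system W S"
    and "finite S"
    and "coxeter_involution W S star"
    and "is_phi W S star \<phi>"
  shows "R_series W S star \<phi> =
    fps_unit_div (fps_compose (P_series W S) (fps_X ^ 2)) (P_star_series W S star)"
proof -
  interpret twisted_series W S star \<phi> using twisted_series_intro assms .
  show ?thesis using eq_fps_unit_div[OF P_star_nth_0 R_times_P_star] .
qed

end
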